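(* Let $\mathcal{A}$ be an abelian category with enough projectives and let $0\to K\xrightarrow{k}X\xrightarrow{f}Y\to0$ be a short exact sequence in $\mathcal{A}$. Then a right exact functor $T\colon\mathcal{A}\to\mathsf{Ab}$ yields an isomorphism of long exact sequences of abelian groups, from $$\cdots\to\mathrm{Nat}(\mathrm{Ext}^{n+1}(Y,-),T)\xrightarrow{(\delta^{n+1})^{*}}\mathrm{Nat}(\mathrm{Ext}^{n}(K,-),T)\xrightarrow{(k^{*})^{*}}\mathrm{Nat}(\mathrm{Ext}^{n}(X,-),T)\xrightarrow{(f^{*})^{*}}\mathrm{Nat}(\mathrm{Ext}^{n}(Y,-),T)\to\cdots$$ to $$\cdots\to\mathrm{L}_{n+1}T(Y)\xrightarrow{\partial_{n+1}}\mathrm{L}_nT(K)\xrightarrow{k_{*}}\mathrm{L}_nT(X)\xrightarrow{f_{*}}\mathrm{L}_nT(Y)\to\cdots,$$ given by the Yoneda isomorphisms $\mathsf{Y}_{n+1}(Y),\mathsf{Y}_n(K),\mathsf{Y}_n(X),\mathsf{Y}_n(Y)$; that is, both sequences are exact and all squares of the resulting ladder commute.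
   Context: For an object $M$ of $\mathcal{A}$ with projective resolution $P(M)$, $\mathrm{Ext}^n(M,-)=\mathrm{H}^n\mathrm{Hom}_{\mathcal{A}}(P(M),-)$ and $\mathrm{L}_nT(M)=\mathrm{H}_n(TP(M))$ is the $n$-th left derived functor of $T$. $\mathrm{Nat}$ denotes abelian groups of natural transformations between functors $\mathcal{A}\to\mathsf{Ab}$. $\delta^{n+1}\colon\mathrm{Ext}^n(K,-)\to\mathrm{Ext}^{n+1}(Y,-)$ and $\partial_{n+1}$ are the usual connecting morphisms (computed from a short exact sequence of projective resolutions covering the given sequence). The Yoneda isomorphism $\mathsf{Y}_n(M)\colon\mathrm{Nat}(\mathrm{Ext}^n(M,-),T)\to\mathrm{L}_nT(M)$ is the following. With $U=P(M)$, let $q\colon U_n\to Q=\mathrm{Coker}(d_{n+1})$ be the quotient map, an $n$-cocycle of $\mathrm{Hom}_{\mathcal{A}}(U,Q)$. Since $T$ is right exact, $TQ\cong\mathrm{Coker}(Td_{n+1})$ and $\mathrm{H}_n(TU)\cong\mathrm{Ker}(\mathrm{Coker}(Td_{n+1})\to TU_{n-1})$. Then $\mathsf{Y}_n(M)(\tau)=\tau_Q([q])$. *)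

theory Defs
  imports "HOL-Algebra.Exact_Sequence"
begin

text \<open>
  Abelian groups are HOL-Algebra's \<^locale>\<open>comm_group\<close>s, so their operation is written
  multiplicatively and their neutral element \<^term>\<open>\<one>\<^bsub>G\<^esub>\<close>, as in HOL-Homology.
\<close>

section \<open>Abelian categories\<close>

record ('o, 'm) additive_cat =
  Obj  :: "'o set"
  Arr  :: "'m set"
  Dom  :: "'m \<Rightarrow> 'o"
  Cod  :: "'m \<Rightarrow> 'o"
  Id   :: "'o \<Rightarrow> 'm"
  Comp :: "'m \<Rightarrow> 'm \<Rightarrow> 'm"  (infixl "\<bullet>\<index>" 70)
  Add  :: "'m \<Rightarrow> 'm \<Rightarrow> 'm"
  Zero :: "'o \<Rightarrow> 'o \<Rightarrow> 'm"

definition Hom :: "('o, 'm) additive_cat \<Rightarrow> 'o \<Rightarrow> 'o \<Rightarrow> 'm set" where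
  "Hom C A B = {f \<in> Arr C. Dom C f = A \<and> Cod C f = B}"

definition HomG :: "('o, 'm) additive_cat \<Rightarrow> 'o \<Rightarrow> 'o \<Rightarrow> 'm monoid" where
  "HomG C A B = \<lparr>carrier = Hom C A B, monoid.mult = Add C, one = Zero C A B\<rparr>"

definition mono_arr :: "('o, 'm) additive_cat \<Rightarrow> 'm \<Rightarrow> bool" where
  "mono_arr C m \<longleftrightarrow> m \<in> Arr C \<and>
     (\<forall>A. \<forall>g \<in> Hom C A (Dom C m). \<forall>h \<in> Hom C A (Dom C m).
        m \<bullet>\<^bsub>C\<^esub> g = m \<bullet>\<^bsub>C\<^esub> h \<longrightarrow> g = h)"

definition epi_arr :: "('o, 'm) additive_cat \<Rightarrow> 'm \<Rightarrow> bool" where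
  "epi_arr C e \<longleftrightarrow> e \<in> Arr C \<and>
     (\<forall>B. \<forall>g \<in> Hom C (Cod C e) B. \<forall>h \<in> Hom C (Cod C e) B.
        g \<bullet>\<^bsub>C\<^esub> e = h \<bullet>\<^bsub>C\<^esub> e \<longrightarrow> g = h)"

definition is_kernel :: "('o, 'm) additive_cat \<Rightarrow> 'm \<Rightarrow> 'm \<Rightarrow> bool" where
  "is_kernel C f k \<longleftrightarrow> f \<in> Arr C \<and> k \<in> Arr C \<and> Cod C k = Dom C f \<and>
     f \<bullet>\<^bsub>C\<^esub> k = Zero C (Dom C k) (Cod C f) \<and>
     (\<forall>A. \<forall>h \<in> Hom C A (Dom C f). f \<bullet>\<^bsub>C\<^esub> h = Zero C A (Cod C f) \<longrightarrow>
        (\<exists>!u. u \<in> Hom C A (Dom C k) \<and> k \<bullet>\<^bsub>C\<^esub> u = h))"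

definition is_cokernel :: "('o, 'm) additive_cat \<Rightarrow> 'm \<Rightarrow> 'm \<Rightarrow> bool" where
  "is_cokernel C f q \<longleftrightarrow> f \<in> Arr C \<and> q \<in> Arr C \<and> Dom C q = Cod C f \<and>
     q \<bullet>\<^bsub>C\<^esub> f = Zero C (Dom C f) (Cod C q) \<and>
     (\<forall>B. \<forall>h \<in> Hom C (Cod C f) B. h \<bullet>\<^bsub>C\<^esub> f = Zero C (Dom C f) B \<longrightarrow>
        (\<exists>!u. u \<in> Hom C (Cod C q) B \<and> u \<bullet>\<^bsub>C\<^esub> q = h))"

definition zero_object :: "('o, 'm) additive_cat \<Rightarrow> 'o \<Rightarrow> bool" where
  "zero_object C Z \<longleftrightarrow> Z \<in> Obj C \<and>
     (\<forall>A \<in> Obj C. (\<exists>!f. f \<in> Hom C Z A) \<and> (\<exists>!f. f \<in> Hom C A Z))"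

definition biproduct ::
  "('o, 'm) additive_cat \<Rightarrow> 'o \<Rightarrow> 'o \<Rightarrow> 'o \<Rightarrow> 'm \<Rightarrow> 'm \<Rightarrow> 'm \<Rightarrow> 'm \<Rightarrow> bool" where
  "biproduct C A B S i j p q \<longleftrightarrow>
     i \<in> Hom C A S \<and> j \<in> Hom C B S \<and> p \<in> Hom C S A \<and> q \<in> Hom C S B \<and>
     p \<bullet>\<^bsub>C\<^esub> i = Id C A \<and> q \<bullet>\<^bsub>C\<^esub> j = Id C B \<and>
     p \<bullet>\<^bsub>C\<^esub> j = Zero C B A \<and> q \<bullet>\<^bsub>C\<^esub> i = Zero C A B \<and>
     Add C (i \<bullet>\<^bsub>C\<^esub> p) (j \<bullet>\<^bsub>C\<^esub> q) = Id C S"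

locale preadditive_category =
  fixes C :: "('o, 'm) additive_cat" (structure)
  assumes Dom_in_Obj: "f \<in> Arr C \<Longrightarrow> Dom C f \<in> Obj C"
    and Cod_in_Obj: "f \<in> Arr C \<Longrightarrow> Cod C f \<in> Obj C"
    and Id_in_Hom: "A \<in> Obj C \<Longrightarrow> Id C A \<in> Hom C A A"
    and Comp_in_Hom: "\<lbrakk>f \<in> Hom C A B; g \<in> Hom C B D\<rbrakk> \<Longrightarrow> g \<bullet> f \<in> Hom C A D"
    and Comp_Id_left: "f \<in> Hom C A B \<Longrightarrow> Id C B \<bullet> f = f"
    and Comp_Id_right: "f \<in> Hom C A B \<Longrightarrow> f \<bullet> Id C A = f"
    and Comp_assoc:
      "\<lbrakk>f \<in> Hom C A B; g \<in> Hom C B D; h \<in> Hom C D E\<rbrakk> \<Longrightarrow> (h \<bullet> g) \<bullet> f = h \<bullet> (g \<bullet> f)"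
    and Hom_comm_group: "\<lbrakk>A \<in> Obj C; B \<in> Obj C\<rbrakk> \<Longrightarrow> comm_group (HomG C A B)"
    and Comp_Add_right:
      "\<lbrakk>f \<in> Hom C A B; f' \<in> Hom C A B; g \<in> Hom C B D\<rbrakk>
        \<Longrightarrow> g \<bullet> Add C f f' = Add C (g \<bullet> f) (g \<bullet> f')"
    and Comp_Add_left:
      "\<lbrakk>f \<in> Hom C A B; g \<in> Hom C B D; g' \<in> Hom C B D\<rbrakk>
        \<Longrightarrow> Add C g g' \<bullet> f = Add C (g \<bullet> f) (g' \<bullet> f)"

locale abelian_category = preadditive_category +
  assumes ex_zero_object: "\<exists>Z. zero_object C Z"
    and ex_biproduct:
      "\<lbrakk>A \<in> Obj C; B \<in> Obj C\<rbrakk> \<Longrightarrow> \<exists>S i j p q. biproduct C A B S i j p q"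
    and ex_kernel: "f \<in> Arr C \<Longrightarrow> \<exists>k. is_kernel C f k"
    and ex_cokernel: "f \<in> Arr C \<Longrightarrow> \<exists>q. is_cokernel C f q"
    and mono_normal: "mono_arr C m \<Longrightarrow> \<exists>f. is_kernel C f m"
    and epi_normal: "epi_arr C e \<Longrightarrow> \<exists>f. is_cokernel C f e"

definition projective :: "('o, 'm) additive_cat \<Rightarrow> 'o \<Rightarrow> bool" where
  "projective C Q \<longleftrightarrow> Q \<in> Obj C \<and>
     (\<forall>e g. epi_arr C e \<and> g \<in> Hom C Q (Cod C e) \<longrightarrow>
        (\<exists>h \<in> Hom C Q (Dom C e). e \<bullet>\<^bsub>C\<^esub> h = g))"

definition enough_projectives :: "('o, 'm) additive_cat \<Rightarrow> bool" where
  "enough_projectives C \<longleftrightarrow>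
     (\<forall>A \<in> Obj C. \<exists>Q e. projective C Q \<and> epi_arr C e \<and> e \<in> Hom C Q A)"

definition short_exact :: "('o, 'm) additive_cat \<Rightarrow> 'm \<Rightarrow> 'm \<Rightarrow> bool" where
  "short_exact C k f \<longleftrightarrow> is_kernel C f k \<and> is_cokernel C k f"

text \<open>The monic part of the epi-mono factorization of \<open>f\<close> is a kernel of \<open>g\<close>: the image of \<open>f\<close>
  and the kernel of \<open>g\<close> agree as subobjects.\<close>

definition exact_at :: "('o, 'm) additive_cat \<Rightarrow> 'm \<Rightarrow> 'm \<Rightarrow> bool" where
  "exact_at C f g \<longleftrightarrow>
     (\<exists>i e. is_kernel C g i \<and> epi_arr C e \<and> Cod C e = Dom C i \<and> f = i \<bullet>\<^bsub>C\<^esub> e)"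


section \<open>Functors to abelian groups and their natural transformations\<close>

record ('o, 'm, 'a) ab_functor =
  Fob  :: "'o \<Rightarrow> 'a monoid"
  Fmap :: "'m \<Rightarrow> 'a \<Rightarrow> 'a"

locale additive_functor =
  fixes C :: "('o, 'm) additive_cat" and T :: "('o, 'm, 'a) ab_functor"
  assumes Fob_comm_group: "A \<in> Obj C \<Longrightarrow> comm_group (Fob T A)"
    and Fmap_hom: "f \<in> Hom C A B \<Longrightarrow> Fmap T f \<in> hom (Fob T A) (Fob T B)"
    and Fmap_Id: "\<lbrakk>A \<in> Obj C; x \<in> carrier (Fob T A)\<rbrakk> \<Longrightarrow> Fmap T (Id C A) x = x"
    and Fmap_Comp:
      "\<lbrakk>f \<in> Hom C A B; g \<in> Hom C B D; x \<in> carrier (Fob T A)\<rbrakk>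
        \<Longrightarrow> Fmap T (g \<bullet>\<^bsub>C\<^esub> f) x = Fmap T g (Fmap T f x)"
    and Fmap_Add:
      "\<lbrakk>f \<in> Hom C A B; g \<in> Hom C A B; x \<in> carrier (Fob T A)\<rbrakk>
        \<Longrightarrow> Fmap T (Add C f g) x = Fmap T f x \<otimes>\<^bsub>Fob T B\<^esub> Fmap T g x"

locale right_exact_functor = additive_functor +
  assumes right_exact:
    "\<lbrakk>k \<in> Hom C A B; f \<in> Hom C B D; short_exact C k f\<rbrakk> \<Longrightarrow>
       kernel (Fob T B) (Fob T D) (Fmap T f) = Fmap T k ` carrier (Fob T A) \<and>
       Fmap T f ` carrier (Fob T B) = carrier (Fob T D)"

text \<open>Components are made extensional, so that equality of natural transformations is equality of
  HOL functions.\<close>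

definition nat_trans ::
  "('o, 'm) additive_cat \<Rightarrow> ('o, 'm, 'a) ab_functor \<Rightarrow> ('o, 'm, 'b) ab_functor \<Rightarrow>
   ('o \<Rightarrow> 'a \<Rightarrow> 'b) set" where
  "nat_trans C F G =
     {\<tau> \<in> extensional (Obj C).
        (\<forall>A \<in> Obj C. \<tau> A \<in> hom (Fob F A) (Fob G A) \<inter> extensional (carrier (Fob F A))) \<and>
        (\<forall>g \<in> Arr C. \<forall>x \<in> carrier (Fob F (Dom C g)).
           \<tau> (Cod C g) (Fmap F g x) = Fmap G g (\<tau> (Dom C g) x))}"

definition Nat ::
  "('o, 'm) additive_cat \<Rightarrow> ('o, 'm, 'a) ab_functor \<Rightarrow> ('o, 'm, 'b) ab_functor \<Rightarrow>
   ('o \<Rightarrow> 'a \<Rightarrow> 'b) monoid" where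
  "Nat C F G =
     \<lparr>carrier = nat_trans C F G,
      monoid.mult = (\<lambda>\<sigma> \<tau>. \<lambda>A \<in> Obj C. \<lambda>x \<in> carrier (Fob F A). \<sigma> A x \<otimes>\<^bsub>Fob G A\<^esub> \<tau> A x),
      one = (\<lambda>A \<in> Obj C. \<lambda>x \<in> carrier (Fob F A). \<one>\<^bsub>Fob G A\<^esub>)\<rparr>"

text \<open>For \<open>\<phi> : F \<rightarrow> F'\<close>, the map \<open>\<phi>\<^sup>* : Nat(F', T) \<rightarrow> Nat(F, T)\<close>.\<close>

definition precomp ::
  "('o, 'm) additive_cat \<Rightarrow> ('o, 'm, 'a) ab_functor \<Rightarrow> ('o \<Rightarrow> 'a \<Rightarrow> 'c) \<Rightarrow>
   ('o \<Rightarrow> 'c \<Rightarrow> 'b) \<Rightarrow> ('o \<Rightarrow> 'a \<Rightarrow> 'b)" where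
  "precomp C F \<phi> \<tau> = (\<lambda>A \<in> Obj C. \<lambda>x \<in> carrier (Fob F A). \<tau> A (\<phi> A x))"


section \<open>Projective resolutions\<close>

text \<open>\<open>Rdiff U (Suc n) : Rob U (Suc n) \<rightarrow> Rob U n\<close> is the differential \<open>d\<^sub>n\<^sub>+\<^sub>1\<close>; the value
  \<open>Rdiff U 0\<close> is irrelevant.  \<open>Raug U\<close> is the augmentation.\<close>

record ('o, 'm) resolution =
  Rob   :: "nat \<Rightarrow> 'o"
  Rdiff :: "nat \<Rightarrow> 'm"
  Raug  :: 'm

definition projective_resolution ::
  "('o, 'm) additive_cat \<Rightarrow> 'o \<Rightarrow> ('o, 'm) resolution \<Rightarrow> bool" where
  "projective_resolution C M U \<longleftrightarrow>
     (\<forall>n. projective C (Rob U n)) \<and>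
     (\<forall>n. Rdiff U (Suc n) \<in> Hom C (Rob U (Suc n)) (Rob U n)) \<and>
     Raug U \<in> Hom C (Rob U 0) M \<and>
     (\<forall>n. exact_at C (Rdiff U (Suc (Suc n))) (Rdiff U (Suc n))) \<and>
     exact_at C (Rdiff U 1) (Raug U) \<and>
     epi_arr C (Raug U)"

definition chain_map_over ::
  "('o, 'm) additive_cat \<Rightarrow> 'm \<Rightarrow> ('o, 'm) resolution \<Rightarrow> ('o, 'm) resolution \<Rightarrow>
   (nat \<Rightarrow> 'm) \<Rightarrow> bool" where
  "chain_map_over C f U V \<phi> \<longleftrightarrow>
     (\<forall>n. \<phi> n \<in> Hom C (Rob U n) (Rob V n)) \<and>
     (\<forall>n. \<phi> n \<bullet>\<^bsub>C\<^esub> Rdiff U (Suc n) = Rdiff V (Suc n) \<bullet>\<^bsub>C\<^esub> \<phi> (Suc n)) \<and>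
     Raug V \<bullet>\<^bsub>C\<^esub> \<phi> 0 = f \<bullet>\<^bsub>C\<^esub> Raug U"

text \<open>In the following, \<open>P\<close> assigns to every object its chosen projective resolution.\<close>

definition chain_lift ::
  "('o, 'm) additive_cat \<Rightarrow> ('o \<Rightarrow> ('o, 'm) resolution) \<Rightarrow> 'm \<Rightarrow> nat \<Rightarrow> 'm" where
  "chain_lift C P f = (SOME \<phi>. chain_map_over C f (P (Dom C f)) (P (Cod C f)) \<phi>)"

text \<open>A short exact sequence \<open>0 \<rightarrow> U \<rightarrow> V \<rightarrow> W \<rightarrow> 0\<close> of projective resolutions covering
  \<open>0 \<rightarrow> K \<rightarrow> X \<rightarrow> Y \<rightarrow> 0\<close>.\<close>

definition covering ::
  "('o, 'm) additive_cat \<Rightarrow> 'm \<Rightarrow> 'm \<Rightarrow>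
   ('o, 'm) resolution \<Rightarrow> ('o, 'm) resolution \<Rightarrow> ('o, 'm) resolution \<Rightarrow>
   (nat \<Rightarrow> 'm) \<Rightarrow> (nat \<Rightarrow> 'm) \<Rightarrow> bool" where
  "covering C k f U V W i p \<longleftrightarrow>
     projective_resolution C (Dom C k) U \<and>
     projective_resolution C (Cod C k) V \<and>
     projective_resolution C (Cod C f) W \<and>
     chain_map_over C k U V i \<and> chain_map_over C f V W p \<and>
     (\<forall>n. short_exact C (i n) (p n))"

text \<open>The outer terms are the chosen resolutions of \<open>K\<close> and \<open>Y\<close>; the middle term is some projective
  resolution of \<open>X\<close> (it exists by the horseshoe lemma), not necessarily \<open>P X\<close>.\<close>

definition chosen_covering ::
  "('o, 'm) additive_cat \<Rightarrow> ('o \<Rightarrow> ('o, 'm) resolution) \<Rightarrow> 'm \<Rightarrow> 'm \<Rightarrow>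
   ('o, 'm) resolution \<times> (nat \<Rightarrow> 'm) \<times> (nat \<Rightarrow> 'm)" where
  "chosen_covering C P k f =
     (SOME (V, i, p). covering C k f (P (Dom C k)) V (P (Cod C f)) i p)"


section \<open>Ext and left derived functors\<close>

text \<open>The map induced by \<open>\<phi>\<close> from cosets to the cosets of \<open>N\<close> in \<open>H\<close>: it sends the coset of \<open>x\<close> to
  the coset of \<open>\<phi> x\<close>, which is \<open>N\<close> added to the image of the coset of \<open>x\<close>.\<close>

definition induced :: "'b monoid \<Rightarrow> 'b set \<Rightarrow> ('a \<Rightarrow> 'b) \<Rightarrow> 'a set \<Rightarrow> 'b set" where
  "induced H N \<phi> c = N <#>\<^bsub>H\<^esub> (\<phi> ` c)"

definition cocycles ::
  "('o, 'm) additive_cat \<Rightarrow> ('o, 'm) resolution \<Rightarrow> nat \<Rightarrow> 'o \<Rightarrow> 'm set" where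
  "cocycles C U n B =
     {x \<in> Hom C (Rob U n) B. x \<bullet>\<^bsub>C\<^esub> Rdiff U (Suc n) = Zero C (Rob U (Suc n)) B}"

definition coboundaries ::
  "('o, 'm) additive_cat \<Rightarrow> ('o, 'm) resolution \<Rightarrow> nat \<Rightarrow> 'o \<Rightarrow> 'm set" where
  "coboundaries C U n B =
     (case n of 0 \<Rightarrow> {Zero C (Rob U 0) B}
      | Suc m \<Rightarrow> (\<lambda>y. y \<bullet>\<^bsub>C\<^esub> Rdiff U (Suc m)) ` Hom C (Rob U m) B)"

definition Ext ::
  "('o, 'm) additive_cat \<Rightarrow> ('o \<Rightarrow> ('o, 'm) resolution) \<Rightarrow> nat \<Rightarrow> 'o \<Rightarrow>
   ('o, 'm, 'm set) ab_functor" where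
  "Ext C P n M =
     \<lparr>Fob = (\<lambda>B. (HomG C (Rob (P M) n) B)\<lparr>carrier := cocycles C (P M) n B\<rparr>
                  Mod coboundaries C (P M) n B),
      Fmap = (\<lambda>g. induced (HomG C (Rob (P M) n) (Cod C g)) (coboundaries C (P M) n (Cod C g))
                    (\<lambda>x. g \<bullet>\<^bsub>C\<^esub> x))\<rparr>"

text \<open>For \<open>f : M \<rightarrow> M'\<close>, the natural transformation \<open>f\<^sup>* : Ext\<^sup>n(M', -) \<rightarrow> Ext\<^sup>n(M, -)\<close>.\<close>

definition Ext_map ::
  "('o, 'm) additive_cat \<Rightarrow> ('o \<Rightarrow> ('o, 'm) resolution) \<Rightarrow> nat \<Rightarrow> 'm \<Rightarrow>
   'o \<Rightarrow> 'm set \<Rightarrow> 'm set" where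
  "Ext_map C P n f B =
     induced (HomG C (Rob (P (Dom C f)) n) B) (coboundaries C (P (Dom C f)) n B)
       (\<lambda>x. x \<bullet>\<^bsub>C\<^esub> chain_lift C P f n)"

text \<open>The connecting morphism \<open>\<delta>\<^sup>n\<^sup>+\<^sup>1 : Ext\<^sup>n(K, -) \<rightarrow> Ext\<^sup>n\<^sup>+\<^sup>1(Y, -)\<close> of \<open>0 \<rightarrow> K \<rightarrow> X \<rightarrow> Y \<rightarrow> 0\<close>, by the
  snake construction without sign: extend a cocycle \<open>x\<close> along \<open>i\<^sub>n\<close> to \<open>z\<close>, apply the differential,
  and factor the result through \<open>p\<^sub>n\<^sub>+\<^sub>1\<close>.  The set of all results \<open>y\<close>, for all representatives \<open>x\<close> and
  all extensions \<open>z\<close>, is exactly one coset of the coboundaries.\<close>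

definition Ext_conn ::
  "('o, 'm) additive_cat \<Rightarrow> ('o \<Rightarrow> ('o, 'm) resolution) \<Rightarrow> nat \<Rightarrow> 'm \<Rightarrow> 'm \<Rightarrow>
   'o \<Rightarrow> 'm set \<Rightarrow> 'm set" where
  "Ext_conn C P n k f B c =
     (let W = P (Cod C f); (V, i, p) = chosen_covering C P k f in
       {y \<in> Hom C (Rob W (Suc n)) B.
          \<exists>x \<in> c. \<exists>z \<in> Hom C (Rob V n) B.
            z \<bullet>\<^bsub>C\<^esub> i n = x \<and> z \<bullet>\<^bsub>C\<^esub> Rdiff V (Suc n) = y \<bullet>\<^bsub>C\<^esub> p (Suc n)})"

definition cycles ::
  "('o, 'm, 'a) ab_functor \<Rightarrow> ('o, 'm) resolution \<Rightarrow> nat \<Rightarrow> 'a set" where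
  "cycles T U n =
     (case n of 0 \<Rightarrow> carrier (Fob T (Rob U 0))
      | Suc m \<Rightarrow> kernel (Fob T (Rob U (Suc m))) (Fob T (Rob U m)) (Fmap T (Rdiff U (Suc m))))"

definition boundaries ::
  "('o, 'm, 'a) ab_functor \<Rightarrow> ('o, 'm) resolution \<Rightarrow> nat \<Rightarrow> 'a set" where
  "boundaries T U n = Fmap T (Rdiff U (Suc n)) ` carrier (Fob T (Rob U (Suc n)))"

definition LDer ::
  "('o, 'm, 'a) ab_functor \<Rightarrow> ('o \<Rightarrow> ('o, 'm) resolution) \<Rightarrow> nat \<Rightarrow> 'o \<Rightarrow> 'a set monoid" where
  "LDer T P n M =
     (Fob T (Rob (P M) n))\<lparr>carrier := cycles T (P M) n\<rparr> Mod boundaries T (P M) n"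

definition LDer_map ::
  "('o, 'm) additive_cat \<Rightarrow> ('o, 'm, 'a) ab_functor \<Rightarrow> ('o \<Rightarrow> ('o, 'm) resolution) \<Rightarrow> nat \<Rightarrow> 'm \<Rightarrow>
   'a set \<Rightarrow> 'a set" where
  "LDer_map C T P n f =
     induced (Fob T (Rob (P (Cod C f)) n)) (boundaries T (P (Cod C f)) n)
       (Fmap T (chain_lift C P f n))"

text \<open>The connecting morphism \<open>\<partial>\<^sub>n\<^sub>+\<^sub>1 : L\<^sub>n\<^sub>+\<^sub>1T(Y) \<rightarrow> L\<^sub>nT(K)\<close>: lift a cycle \<open>w\<close> along \<open>Tp\<^sub>n\<^sub>+\<^sub>1\<close> to \<open>v\<close>,
  apply the differential, and pull the result back along \<open>Ti\<^sub>n\<close>.  Again the set of all results \<open>u\<close>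
  is exactly one coset of the boundaries.\<close>

definition LDer_conn ::
  "('o, 'm) additive_cat \<Rightarrow> ('o, 'm, 'a) ab_functor \<Rightarrow> ('o \<Rightarrow> ('o, 'm) resolution) \<Rightarrow> nat \<Rightarrow>
   'm \<Rightarrow> 'm \<Rightarrow> 'a set \<Rightarrow> 'a set" where
  "LDer_conn C T P n k f c =
     (let U = P (Dom C k); (V, i, p) = chosen_covering C P k f in
       {u \<in> carrier (Fob T (Rob U n)).
          \<exists>w \<in> c. \<exists>v \<in> carrier (Fob T (Rob V (Suc n))).
            Fmap T (p (Suc n)) v = w \<and> Fmap T (Rdiff V (Suc n)) v = Fmap T (i n) u})"


section \<open>The Yoneda maps and long exact sequences\<close>

text \<open>\<open>Y\<^sub>n(M)(\<tau>) = \<tau>\<^sub>Q([q])\<close> for a cokernel \<open>q : U\<^sub>n \<rightarrow> Q\<close> of \<open>d\<^sub>n\<^sub>+\<^sub>1\<close>.  Under the isomorphism from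
  \<open>Coker(Td\<^sub>n\<^sub>+\<^sub>1)\<close> to \<open>TQ\<close> induced by \<open>Tq\<close>, an element \<open>t\<close> of \<open>TQ\<close> corresponds to the coset
  consisting of all \<open>u\<close> in \<open>TU\<^sub>n\<close> with \<open>Tq(u) = t\<close>.\<close>

definition Yoneda ::
  "('o, 'm) additive_cat \<Rightarrow> ('o, 'm, 'a) ab_functor \<Rightarrow> ('o \<Rightarrow> ('o, 'm) resolution) \<Rightarrow> nat \<Rightarrow> 'o \<Rightarrow>
   ('o \<Rightarrow> 'm set \<Rightarrow> 'a) \<Rightarrow> 'a set" where
  "Yoneda C T P n M \<tau> =
     (let U = P M; q = (SOME q. is_cokernel C (Rdiff U (Suc n)) q); Q = Cod C q in
       {u \<in> carrier (Fob T (Rob U n)).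
          Fmap T q u = \<tau> Q (coboundaries C U n Q #>\<^bsub>HomG C (Rob U n) Q\<^esub> q)})"

text \<open>The sequence
  \<open>\<dots> \<rightarrow> GY\<^sub>n\<^sub>+\<^sub>1 \<rightarrow> GK\<^sub>n \<rightarrow> GX\<^sub>n \<rightarrow> GY\<^sub>n \<rightarrow> \<dots> \<rightarrow> GK\<^sub>0 \<rightarrow> GX\<^sub>0 \<rightarrow> GY\<^sub>0 \<rightarrow> 0\<close>
  with maps \<open>d n : GY\<^sub>n\<^sub>+\<^sub>1 \<rightarrow> GK\<^sub>n\<close>, \<open>k n\<close>, \<open>f n\<close>.  Note that \<^const>\<open>exact_seq\<close> lists the groups
  from right to left.\<close>

definition long_exact ::
  "(nat \<Rightarrow> 'a monoid) \<Rightarrow> (nat \<Rightarrow> 'a monoid) \<Rightarrow> (nat \<Rightarrow> 'a monoid) \<Rightarrow>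
   (nat \<Rightarrow> 'a \<Rightarrow> 'a) \<Rightarrow> (nat \<Rightarrow> 'a \<Rightarrow> 'a) \<Rightarrow> (nat \<Rightarrow> 'a \<Rightarrow> 'a) \<Rightarrow> bool" where
  "long_exact GK GX GY d k f \<longleftrightarrow>
     (\<forall>n. comm_group (GK n) \<and> comm_group (GX n) \<and> comm_group (GY n)) \<and>
     (\<forall>n. exact_seq ([GY n, GX n, GK n, GY (Suc n), GX (Suc n)], [f n, k n, d n, f (Suc n)])) \<and>
     f 0 ` carrier (GX 0) = carrier (GY 0)"

end

theory Submission
  imports Defs
begin

text \<open>
  Every transformation \<open>\<tau>\<close> from \<open>Ext\<^sup>n(M, -)\<close> to \<open>T\<close> has the form \<open>[x] \<mapsto> Tx(w)\<close> for an \<open>n\<close>-cycle \<open>w\<close>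
  of \<open>TP(M)\<close>: every cocycle factors through \<open>q : P(M)\<^sub>n \<rightarrow> Coker(d\<^sub>n\<^sub>+\<^sub>1)\<close>, so \<open>\<tau>\<close> is determined by its
  value at \<open>[q]\<close>, and \<open>w\<close> is any preimage of that value under \<open>Tq\<close>; the Yoneda map sends \<open>\<tau>\<close> to \<open>[w]\<close>.
  In this description precomposition with \<open>g\<^sup>*\<close> replaces \<open>w\<close> by its image under a lift of \<open>g\<close>.
  For the connecting morphism take \<open>z\<close> with \<open>zi = x\<close> and \<open>zd = yp\<close> in \<open>Hom(V, -)\<close>, and \<open>v\<close> with
  \<open>Tp(v) = w\<close> and \<open>Td(v) = Ti(u)\<close> in \<open>TV\<close>; then \<open>Ty(w) = T(yp)(v) = T(zd)(v) = T(zi)(u) = Tx(u)\<close>, which is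
  the remaining square.  Exactness of the sequence of derived functors is the usual diagram chase,
  and it is transported along the Yoneda isomorphisms to the other sequence.
\<close>

section \<open>Preadditive and abelian categories\<close>

text \<open>The obstacle is that \<open>T\<close> is only right exact, while the chase needs
  \<open>T\<close> of the sequence \<open>0 \<rightarrow> U \<rightarrow> V \<rightarrow> W
  \<rightarrow> 0\<close> of resolutions to be exact in every degree. The objects of
  \<open>W\<close> are projective, so each degree splits. The retraction of \<open>i n\<close> makes
  \<open>Ti\<close> injective, and on the Ext side the same retraction extends cocycles along
  \<open>i n\<close>. Right exactness itself speaks of short exact sequences, and a differential
  need not be monic. It is therefore applied to the image of the differential, which gives the
  kernel and the image of \<open>Tq\<close>. Both connecting morphisms are sets of all results of a
  snake construction without sign. Their values are therefore computed on representatives: one run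
  of the construction determines the whole coset, and the square that joins them becomes an equation
  between two representatives. An abelian category has no elements. In the construction of
  \<open>V\<close>, maps out of projectives take their place, which is possible because there are
  enough of them.\<close>

lemma HomI: "f \<in> Arr C \<Longrightarrow> f \<in> Hom C (Dom C f) (Cod C f)"
  by (simp add: Hom_def)

lemma HomD:
  assumes "f \<in> Hom C A B"
  shows "f \<in> Arr C" "Dom C f = A" "Cod C f = B"
  using assms by (auto simp: Hom_def)

lemma HomG_simps [simp]:
  "carrier (HomG C A B) = Hom C A B" "mult (HomG C A B) = Add C" "one (HomG C A B) = Zero C A B"
  by (simp_all add: HomG_def)

section \<open>Group arithmetic on Hom sets, monos and epis, kernels and cokernels\<close>

context preadditive_category
begin

lemma Hom_objs:
  assumes "f \<in> Hom C A B"
  shows "A \<in> Obj C" "B \<in> Obj C"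
  using assms Dom_in_Obj Cod_in_Obj by (auto simp: Hom_def)

lemma Hom_group: "f \<in> Hom C A B \<Longrightarrow> comm_group (HomG C A B)"
  using Hom_comm_group Hom_objs by blast

lemma Zero_in_Hom:
  assumes "A \<in> Obj C" "B \<in> Obj C"
  shows "Zero C A B \<in> Hom C A B"
proof -
  interpret comm_group "HomG C A B"
    using Hom_comm_group assms by blast
  show ?thesis
    using one_closed by simp
qed

lemma Add_in_Hom:
  assumes "f \<in> Hom C A B" "g \<in> Hom C A B"
  shows "Add C f g \<in> Hom C A B"
proof -
  interpret comm_group "HomG C A B"
    using Hom_group assms by blast
  show ?thesis
    using m_closed assms by simp
qed

lemma Add_Zero_left:
  assumes "f \<in> Hom C A B"
  shows "Add C (Zero C A B) f = f"
proof -
  interpret comm_group "HomG C A B"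
    using Hom_group assms by blast
  show ?thesis
    using l_one assms by simp
qed

lemma Add_commute:
  assumes "f \<in> Hom C A B" "g \<in> Hom C A B"
  shows "Add C f g = Add C g f"
proof -
  interpret comm_group "HomG C A B"
    using Hom_group assms by blast
  show ?thesis
    using m_comm assms by simp
qed

lemma Add_Zero_right: "f \<in> Hom C A B \<Longrightarrow> Add C f (Zero C A B) = f"
  using Add_Zero_left Add_commute Zero_in_Hom Hom_objs by metis

lemma Add_assoc:
  assumes "f \<in> Hom C A B" "g \<in> Hom C A B" "h \<in> Hom C A B"
  shows "Add C (Add C f g) h = Add C f (Add C g h)"
proof -
  interpret comm_group "HomG C A B"
    using Hom_group assms by blast
  show ?thesis
    using m_assoc assms by simp
qed

lemma Add_right_cancel:
  assumes "f \<in> Hom C A B" "g \<in> Hom C A B" "h \<in> Hom C A B" "Add C f h = Add C g h"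
  shows "f = g"
proof -
  interpret comm_group "HomG C A B"
    using Hom_group assms by blast
  show ?thesis
    using assms right_cancel by simp
qed

lemma Add_right_cancel_Zero:
  assumes "f \<in> Hom C A B" "h \<in> Hom C A B" "Add C f h = h"
  shows "f = Zero C A B"
  using Add_right_cancel[OF assms(1) Zero_in_Hom assms(2)] assms Add_Zero_left Hom_objs by metis

text \<open>The record provides no negation, so differences enter through equations of the form
  \<open>f = Add C h g\<close>. Splittings, homotopies and the snake argument for Ext all subtract
  in this way.\<close>

lemma ex_diff:
  assumes "f \<in> Hom C A B" "g \<in> Hom C A B"
  shows "\<exists>h \<in> Hom C A B. f = Add C h g"
proof -
  interpret comm_group "HomG C A B"
    using Hom_group assms by blast
  show ?thesis
    using assms m_assoc[of f "inv\<^bsub>HomG C A B\<^esub> g" g] m_closed[of f "inv\<^bsub>HomG C A B\<^esub> g"]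
      l_inv[of g] inv_closed[of g] r_one[of f]
    by (intro bexI[of _ "Add C f (inv\<^bsub>HomG C A B\<^esub> g)"]) auto
qed

lemma Comp_Zero_right:
  assumes "g \<in> Hom C B D" "A \<in> Obj C"
  shows "g \<bullet> Zero C A B = Zero C A D"
proof -
  have z: "Zero C A B \<in> Hom C A B"
    using Zero_in_Hom Hom_objs assms by blast
  show ?thesis
    using Comp_Add_right[OF z z assms(1)] Add_Zero_left[OF z] Comp_in_Hom[OF z assms(1)]
      Add_right_cancel_Zero by metis
qed

lemma Comp_Zero_left:
  assumes "f \<in> Hom C A B" "D \<in> Obj C"
  shows "Zero C B D \<bullet> f = Zero C A D"
proof -
  have z: "Zero C B D \<in> Hom C B D"
    using Zero_in_Hom Hom_objs assms by blast
  show ?thesis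
    using Comp_Add_left[OF assms(1) z z] Add_Zero_left[OF z] Comp_in_Hom[OF assms(1) z]
      Add_right_cancel_Zero by metis
qed

lemma mono_arr_cancel:
  assumes "mono_arr C m" "m \<in> Hom C A B" "g \<in> Hom C Q A" "h \<in> Hom C Q A" "m \<bullet> g = m \<bullet> h"
  shows "g = h"
  using assms unfolding mono_arr_def by (auto simp: Hom_def)

lemma mono_arr_cancel_Zero:
  assumes "mono_arr C m" "m \<in> Hom C A B" "g \<in> Hom C Q A" "m \<bullet> g = Zero C Q B"
  shows "g = Zero C Q A"
  using mono_arr_cancel[OF assms(1-3) Zero_in_Hom] Comp_Zero_right assms Hom_objs by metis

lemma epi_arr_cancel:
  assumes "epi_arr C e" "e \<in> Hom C A B" "g \<in> Hom C B D" "h \<in> Hom C B D" "g \<bullet> e = h \<bullet> e"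
  shows "g = h"
  using assms unfolding epi_arr_def by (auto simp: Hom_def)

lemma epi_arr_cancel_Zero:
  assumes "epi_arr C e" "e \<in> Hom C A B" "g \<in> Hom C B D" "g \<bullet> e = Zero C A D"
  shows "g = Zero C B D"
  using epi_arr_cancel[OF assms(1-3) Zero_in_Hom] Comp_Zero_left assms Hom_objs by metis

lemma epi_arrI:
  assumes "e \<in> Hom C A B" "\<And>D g h. g \<in> Hom C B D \<Longrightarrow> h \<in> Hom C B D \<Longrightarrow> g \<bullet> e = h \<bullet> e \<Longrightarrow> g = h"
  shows "epi_arr C e"
  using assms unfolding epi_arr_def by (auto simp: Hom_def)

lemma epi_arr_Comp_cancel:
  assumes "f \<in> Hom C A B" "g \<in> Hom C B D" "epi_arr C (g \<bullet> f)"
  shows "epi_arr C g"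
proof (rule epi_arrI[OF assms(2)])
  fix E u v assume "u \<in> Hom C D E" "v \<in> Hom C D E" "u \<bullet> g = v \<bullet> g"
  then show "u = v"
    using epi_arr_cancel[OF assms(3) Comp_in_Hom[OF assms(1,2)]] Comp_assoc[OF assms(1,2)] by metis
qed

lemma is_kernel_Comp:
  assumes "is_kernel C f k" "k \<in> Hom C A B" "f \<in> Hom C B D"
  shows "f \<bullet> k = Zero C A D"
  using assms by (auto simp: Hom_def is_kernel_def)

lemma is_kernel_typed:
  assumes "is_kernel C f k" "f \<in> Hom C B D"
  obtains A where "k \<in> Hom C A B"
  using assms by (auto simp: Hom_def is_kernel_def)

lemma is_kernel_factor:
  assumes "is_kernel C f k" "k \<in> Hom C A B" "f \<in> Hom C B D" "h \<in> Hom C Q B"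
    "f \<bullet> h = Zero C Q D"
  shows "\<exists>u \<in> Hom C Q A. k \<bullet> u = h"
  using assms HomD[OF assms(2)] HomD[OF assms(3)] unfolding is_kernel_def by metis

lemma is_kernel_mono:
  assumes "is_kernel C f k"
  shows "mono_arr C k"
  unfolding mono_arr_def
proof (intro conjI allI ballI impI)
  show "k \<in> Arr C"
    using assms by (simp add: is_kernel_def)
  fix A g h
  assume gh: "g \<in> Hom C A (Dom C k)" "h \<in> Hom C A (Dom C k)" "k \<bullet> g = k \<bullet> h"
  have k: "k \<in> Hom C (Dom C k) (Dom C f)" and f: "f \<in> Hom C (Dom C f) (Cod C f)"
    using assms by (auto simp: Hom_def is_kernel_def)
  have "f \<bullet> (k \<bullet> g) = Zero C A (Cod C f)"
    using Comp_assoc[OF gh(1) k f] is_kernel_Comp[OF assms k f] Comp_Zero_left[OF gh(1)] Hom_objs f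
    by metis
  then have "\<exists>!u. u \<in> Hom C A (Dom C k) \<and> k \<bullet> u = k \<bullet> g"
    using assms Comp_in_Hom[OF gh(1) k] unfolding is_kernel_def by blast
  then show "g = h"
    using gh by metis
qed

lemma is_kernelI:
  assumes "mono_arr C k" "k \<in> Hom C A B" "f \<in> Hom C B D" "f \<bullet> k = Zero C A D"
    "\<And>Q h. h \<in> Hom C Q B \<Longrightarrow> f \<bullet> h = Zero C Q D \<Longrightarrow> \<exists>u \<in> Hom C Q A. k \<bullet> u = h"
  shows "is_kernel C f k"
  unfolding is_kernel_def
  using assms HomD[OF assms(2)] HomD[OF assms(3)] mono_arr_cancel[OF assms(1,2)]
  by (metis (full_types))

lemma is_cokernel_Comp:
  assumes "is_cokernel C f q" "f \<in> Hom C A B" "q \<in> Hom C B D"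
  shows "q \<bullet> f = Zero C A D"
  using assms by (auto simp: Hom_def is_cokernel_def)

lemma is_cokernel_typed:
  assumes "is_cokernel C f q" "f \<in> Hom C A B"
  obtains D where "q \<in> Hom C B D"
  using assms by (auto simp: Hom_def is_cokernel_def)

lemma is_cokernel_factor:
  assumes "is_cokernel C f q" "f \<in> Hom C A B" "q \<in> Hom C B D" "h \<in> Hom C B E"
    "h \<bullet> f = Zero C A E"
  shows "\<exists>u \<in> Hom C D E. u \<bullet> q = h"
  using assms HomD[OF assms(2)] HomD[OF assms(3)] unfolding is_cokernel_def by metis

lemma is_cokernel_epi:
  assumes "is_cokernel C f q"
  shows "epi_arr C q"
  unfolding epi_arr_def
proof (intro conjI allI ballI impI)
  show "q \<in> Arr C"
    using assms by (simp add: is_cokernel_def)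
  fix E g h
  assume gh: "g \<in> Hom C (Cod C q) E" "h \<in> Hom C (Cod C q) E" "g \<bullet> q = h \<bullet> q"
  have q: "q \<in> Hom C (Cod C f) (Cod C q)" and f: "f \<in> Hom C (Dom C f) (Cod C f)"
    using assms by (auto simp: Hom_def is_cokernel_def)
  have "(g \<bullet> q) \<bullet> f = Zero C (Dom C f) E"
    using Comp_assoc[OF f q gh(1)] is_cokernel_Comp[OF assms f q] Comp_Zero_right[OF gh(1)] Hom_objs f
    by metis
  then have "\<exists>!u. u \<in> Hom C (Cod C q) E \<and> u \<bullet> q = g \<bullet> q"
    using assms Comp_in_Hom[OF q gh(1)] unfolding is_cokernel_def by blast
  then show "g = h"
    using gh by metis
qed

lemma is_cokernelI:
  assumes "epi_arr C q" "f \<in> Hom C A B" "q \<in> Hom C B D" "q \<bullet> f = Zero C A D"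
    "\<And>E h. h \<in> Hom C B E \<Longrightarrow> h \<bullet> f = Zero C A E \<Longrightarrow> \<exists>u \<in> Hom C D E. u \<bullet> q = h"
  shows "is_cokernel C f q"
  unfolding is_cokernel_def
  using assms HomD[OF assms(2)] HomD[OF assms(3)] epi_arr_cancel[OF assms(1,3)]
  by (metis (full_types))

text \<open>Since \<open>e\<close> is epi, a map kills \<open>i \<bullet> e\<close> exactly when it
  kills \<open>i\<close>. For a differential this allows passage to the monic part of its
  factorization, where short exactness makes sense.\<close>

lemma is_cokernel_Comp_epi:
  assumes "is_cokernel C (i \<bullet> e) q" "epi_arr C e" "e \<in> Hom C A I" "i \<in> Hom C I B"
  shows "is_cokernel C i q"
proof -
  note ie = Comp_in_Hom[OF assms(3,4)]
  obtain D where q: "q \<in> Hom C B D"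
    using is_cokernel_typed[OF assms(1) ie] by blast
  show ?thesis
  proof (rule is_cokernelI[OF is_cokernel_epi[OF assms(1)] assms(4) q])
    have "(q \<bullet> i) \<bullet> e = Zero C A D"
      using Comp_assoc[OF assms(3,4) q] is_cokernel_Comp[OF assms(1) ie q] by simp
    then show "q \<bullet> i = Zero C I D"
      using epi_arr_cancel_Zero[OF assms(2,3) Comp_in_Hom[OF assms(4) q]] by blast
  next
    fix E h assume h: "h \<in> Hom C B E" "h \<bullet> i = Zero C I E"
    then have "h \<bullet> (i \<bullet> e) = Zero C A E"
      using Comp_assoc[OF assms(3,4) h(1)] Comp_Zero_left[OF assms(3)] Hom_objs by metis
    then show "\<exists>u \<in> Hom C D E. u \<bullet> q = h"
      using is_cokernel_factor[OF assms(1) ie q h(1)] by blast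
  qed
qed

section \<open>Lifting out of projectives, and splitting\<close>

lemma projective_lift:
  assumes "projective C Q" "epi_arr C e" "e \<in> Hom C A B" "g \<in> Hom C Q B"
  shows "\<exists>h \<in> Hom C Q A. e \<bullet> h = g"
  using assms HomD[OF assms(3)] unfolding projective_def by metis

lemma exact_atE:
  assumes "exact_at C f g" "f \<in> Hom C A B" "g \<in> Hom C B D"
  obtains I i e where "is_kernel C g i" "i \<in> Hom C I B" "epi_arr C e" "e \<in> Hom C A I" "f = i \<bullet> e"
    "g \<bullet> f = Zero C A D"
proof -
  obtain i e where ie: "is_kernel C g i" "epi_arr C e" "Cod C e = Dom C i" "f = i \<bullet> e"
    using assms(1) unfolding exact_at_def by blast
  obtain I where i: "i \<in> Hom C I B"
    using is_kernel_typed[OF ie(1) assms(3)] by blast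
  have "e \<in> Arr C"
    using ie(2) unfolding epi_arr_def by blast
  then have e: "e \<in> Hom C (Dom C e) I"
    using ie i HomD by (metis HomI)
  moreover have "Dom C e = A"
    using Comp_in_Hom[OF e i] ie(4) HomD assms(2) by metis
  ultimately have e: "e \<in> Hom C A I"
    by simp
  have "g \<bullet> f = Zero C A D"
    using Comp_assoc[OF e i assms(3)] ie(4) is_kernel_Comp[OF ie(1) i assms(3)] Comp_Zero_left[OF e]
      Hom_objs assms by metis
  with that ie i e show ?thesis
    by blast
qed

lemma exact_at_Comp:
  assumes "exact_at C f g" "f \<in> Hom C A B" "g \<in> Hom C B D"
  shows "g \<bullet> f = Zero C A D"
  using exact_atE[OF assms] by blast

text \<open>The counterpart of choosing a preimage of a cycle: \<open>h\<close> factors through the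
  kernel of \<open>g\<close>, and projectivity lifts this factor along the epi onto that
  kernel.\<close>

lemma exact_at_lift:
  assumes "projective C Q" "exact_at C f g" "f \<in> Hom C A B" "g \<in> Hom C B D" "h \<in> Hom C Q B"
    "g \<bullet> h = Zero C Q D"
  shows "\<exists>l \<in> Hom C Q A. f \<bullet> l = h"
proof -
  obtain I i e where ie: "is_kernel C g i" "i \<in> Hom C I B" "epi_arr C e" "e \<in> Hom C A I" "f = i \<bullet> e"
    using exact_atE[OF assms(2-4)] by metis
  obtain u where u: "u \<in> Hom C Q I" "i \<bullet> u = h"
    using is_kernel_factor[OF ie(1,2) assms(4-6)] by blast
  obtain l where l: "l \<in> Hom C Q A" "e \<bullet> l = u"
    using projective_lift[OF assms(1) ie(3,4) u(1)] by blast
  then show ?thesis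
    using Comp_assoc[OF l(1) ie(4,2)] ie(5) u(2) by metis
qed

text \<open>With a section \<open>s\<close> of \<open>p\<close>, the map
  \<open>c = Id - s \<bullet> p\<close> is killed by \<open>p\<close>, so it has the form
  \<open>i \<bullet> r\<close>. As \<open>p\<close> kills \<open>i\<close>, composing with
  \<open>i\<close> gives \<open>i \<bullet> r \<bullet> i = i\<close>, and \<open>i\<close> is
  monic.\<close>

lemma short_exact_split:
  assumes "short_exact C i p" "i \<in> Hom C A B" "p \<in> Hom C B D" "projective C D"
  shows "\<exists>r \<in> Hom C B A. r \<bullet> i = Id C A"
proof -
  have ker: "is_kernel C p i" and coker: "is_cokernel C i p"
    using assms(1) by (auto simp: short_exact_def)
  note o = Hom_objs[OF assms(2)] Hom_objs[OF assms(3)]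
  obtain s where s: "s \<in> Hom C D B" "p \<bullet> s = Id C D"
    using projective_lift[OF assms(4) is_cokernel_epi[OF coker] assms(3) Id_in_Hom] o by blast
  note sp = Comp_in_Hom[OF assms(3) s(1)]
  obtain c where c: "c \<in> Hom C B B" "Id C B = Add C c (s \<bullet> p)"
    using ex_diff[OF Id_in_Hom sp] o by blast
  have "p \<bullet> (s \<bullet> p) = p"
    using Comp_assoc[OF assms(3) s(1) assms(3)] s(2) Comp_Id_left[OF assms(3)] by simp
  then have "Add C (p \<bullet> c) p = p"
    using Comp_Add_right[OF c(1) sp assms(3)] c(2) Comp_Id_right[OF assms(3)] by simp
  then have "p \<bullet> c = Zero C B D"
    using Add_right_cancel_Zero[OF Comp_in_Hom[OF c(1) assms(3)] assms(3)] by blast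
  then obtain r where r: "r \<in> Hom C B A" "i \<bullet> r = c"
    using is_kernel_factor[OF ker assms(2,3) c(1)] by blast
  have "(s \<bullet> p) \<bullet> i = Zero C A B"
    using Comp_assoc[OF assms(2,3) s(1)] is_kernel_Comp[OF ker assms(2,3)] Comp_Zero_right[OF s(1)] o
    by metis
  moreover have "Id C B \<bullet> i = Add C (c \<bullet> i) ((s \<bullet> p) \<bullet> i)"
    using Comp_Add_left[OF assms(2) c(1) sp] c(2) by simp
  ultimately have "c \<bullet> i = i"
    using Comp_Id_left[OF assms(2)] Add_Zero_right[OF Comp_in_Hom[OF assms(2) c(1)]] by metis
  then have "i \<bullet> (r \<bullet> i) = i \<bullet> Id C A"
    using Comp_assoc[OF assms(2) r(1) assms(2)] r(2) Comp_Id_right[OF assms(2)] by metis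
  then have "r \<bullet> i = Id C A"
    using mono_arr_cancel[OF is_kernel_mono[OF ker] assms(2) Comp_in_Hom[OF assms(2) r(1)] Id_in_Hom] o
    by blast
  with r show ?thesis
    by blast
qed

end

section \<open>Short exact sequences from epis and monos, and tests by projectives\<close>

context abelian_category
begin

text \<open>Normality only makes \<open>e\<close> the cokernel of some \<open>g\<close>. As
  \<open>g\<close> factors through the kernel \<open>k\<close> of \<open>e\<close>, every map that
  kills \<open>k\<close> kills \<open>g\<close> and hence factors through \<open>e\<close>.\<close>

lemma epi_short_exact:
  assumes "epi_arr C e" "e \<in> Hom C A B"
  obtains I k where "k \<in> Hom C I A" "short_exact C k e"
proof -
  obtain k where k: "is_kernel C e k"
    using ex_kernel HomD[OF assms(2)] by blast
  obtain I where kh: "k \<in> Hom C I A"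
    using is_kernel_typed[OF k assms(2)] .
  obtain g where g: "is_cokernel C g e"
    using epi_normal[OF assms(1)] by blast
  have gh: "g \<in> Hom C (Dom C g) A"
    using g HomD[OF assms(2)] by (auto simp: Hom_def is_cokernel_def)
  have "is_cokernel C k e"
  proof (rule is_cokernelI[OF assms(1) kh assms(2) is_kernel_Comp[OF k kh assms(2)]])
    fix E h assume h: "h \<in> Hom C A E" "h \<bullet> k = Zero C I E"
    obtain u where u: "u \<in> Hom C (Dom C g) I" "k \<bullet> u = g"
      using is_kernel_factor[OF k kh assms(2) gh is_cokernel_Comp[OF g gh assms(2)]] by blast
    have "h \<bullet> g = Zero C (Dom C g) E"
      using Comp_assoc[OF u(1) kh h(1)] u(2) h Comp_Zero_left[OF u(1)] Hom_objs by metis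
    then show "\<exists>u \<in> Hom C B E. u \<bullet> e = h"
      using is_cokernel_factor[OF g gh assms(2) h(1)] by blast
  qed
  with k kh that show ?thesis
    by (auto simp: short_exact_def)
qed

text \<open>Dual to \<open>epi_short_exact\<close>, but with the cokernel \<open>q\<close>
  prescribed: \<open>i\<close> is the kernel of some \<open>g\<close>, and \<open>g\<close> factors
  through \<open>q\<close>.\<close>

lemma mono_short_exact:
  assumes "mono_arr C i" "is_cokernel C i q"
  shows "short_exact C i q"
proof -
  have i: "i \<in> Hom C (Dom C i) (Cod C i)" and q: "q \<in> Hom C (Cod C i) (Cod C q)"
    using assms by (auto simp: mono_arr_def is_cokernel_def Hom_def)
  obtain g where g: "is_kernel C g i"
    using mono_normal[OF assms(1)] by blast
  then have gh: "g \<in> Hom C (Cod C i) (Cod C g)"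
    by (auto simp: Hom_def is_kernel_def)
  obtain u where u: "u \<in> Hom C (Cod C q) (Cod C g)" "u \<bullet> q = g"
    using is_cokernel_factor[OF assms(2) i q gh is_kernel_Comp[OF g i gh]] by blast
  have "is_kernel C q i"
  proof (rule is_kernelI[OF assms(1) i q is_cokernel_Comp[OF assms(2) i q]])
    fix Q h assume h: "h \<in> Hom C Q (Cod C i)" "q \<bullet> h = Zero C Q (Cod C q)"
    have "g \<bullet> h = Zero C Q (Cod C g)"
      using Comp_assoc[OF h(1) q u(1)] u(2) h Comp_Zero_right[OF u(1)] Hom_objs by metis
    then show "\<exists>u \<in> Hom C Q (Dom C i). i \<bullet> u = h"
      using is_kernel_factor[OF g i gh h(1)] by blast
  qed
  with assms show ?thesis
    by (simp add: short_exact_def)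
qed

text \<open>A single test suffices, an epi \<open>c\<close> from a projective onto the kernel object
  of \<open>g\<close>. A lift \<open>l\<close> of \<open>i \<bullet> c\<close> along
  \<open>f\<close> gives \<open>e \<bullet> l = c\<close>, so the factor \<open>e\<close> of
  \<open>f\<close> through the kernel is epi.\<close>

lemma exact_atI_projective:
  assumes "enough_projectives C" "f \<in> Hom C A B" "g \<in> Hom C B D" "g \<bullet> f = Zero C A D"
    "\<And>Q h. projective C Q \<Longrightarrow> h \<in> Hom C Q B \<Longrightarrow> g \<bullet> h = Zero C Q D \<Longrightarrow> \<exists>l \<in> Hom C Q A. f \<bullet> l = h"
  shows "exact_at C f g"
proof -
  obtain i where i: "is_kernel C g i"
    using ex_kernel HomD[OF assms(3)] by blast
  obtain I where ih: "i \<in> Hom C I B"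
    using is_kernel_typed[OF i assms(3)] .
  obtain e where e: "e \<in> Hom C A I" "i \<bullet> e = f"
    using is_kernel_factor[OF i ih assms(3,2,4)] by blast
  obtain Q c where c: "projective C Q" "epi_arr C c" "c \<in> Hom C Q I"
    using assms(1) Hom_objs[OF ih] unfolding enough_projectives_def by blast
  have "g \<bullet> (i \<bullet> c) = Zero C Q D"
    using Comp_assoc[OF c(3) ih assms(3)] is_kernel_Comp[OF i ih assms(3)] Comp_Zero_left[OF c(3)]
      Hom_objs[OF assms(3)] by metis
  then obtain l where l: "l \<in> Hom C Q A" "f \<bullet> l = i \<bullet> c"
    using assms(5)[OF c(1) Comp_in_Hom[OF c(3) ih]] by blast
  have "i \<bullet> (e \<bullet> l) = i \<bullet> c"
    using Comp_assoc[OF l(1) e(1) ih] e l by simp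
  then have "e \<bullet> l = c"
    using mono_arr_cancel[OF is_kernel_mono[OF i] ih Comp_in_Hom[OF l(1) e(1)] c(3)] by blast
  then have "epi_arr C e"
    using epi_arr_Comp_cancel[OF l(1) e(1)] c(2) by simp
  then show ?thesis
    unfolding exact_at_def using i e HomD[OF e(1)] HomD[OF ih] by metis
qed

lemma epi_arrI_projective:
  assumes "enough_projectives C" "f \<in> Hom C A B"
    "\<And>Q h. projective C Q \<Longrightarrow> h \<in> Hom C Q B \<Longrightarrow> \<exists>l \<in> Hom C Q A. f \<bullet> l = h"
  shows "epi_arr C f"
proof -
  obtain Q c where c: "projective C Q" "epi_arr C c" "c \<in> Hom C Q B"
    using assms(1) Hom_objs[OF assms(2)] unfolding enough_projectives_def by blast
  then show ?thesis
    using assms(3)[OF c(1,3)] epi_arr_Comp_cancel[OF _ assms(2)] by blast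
qed

end

section \<open>Projective resolutions\<close>

text \<open>The augmented complex, shifted by one: \<open>M\<close> sits in degree \<open>0\<close>.\<close>

definition aug_ob :: "('o, 'm) resolution \<Rightarrow> 'o \<Rightarrow> nat \<Rightarrow> 'o" where
  "aug_ob U M n = (case n of 0 \<Rightarrow> M | Suc m \<Rightarrow> Rob U m)"

definition aug_diff :: "('o, 'm) resolution \<Rightarrow> nat \<Rightarrow> 'm" where
  "aug_diff U n = (case n of 0 \<Rightarrow> Raug U | Suc m \<Rightarrow> Rdiff U (Suc m))"

lemma aug_simps [simp]:
  "aug_ob U M 0 = M" "aug_ob U M (Suc n) = Rob U n"
  "aug_diff U 0 = Raug U" "aug_diff U (Suc n) = Rdiff U (Suc n)"
  by (simp_all add: aug_ob_def aug_diff_def)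

lemma projective_resolutionD:
  assumes "projective_resolution C M U"
  shows "projective C (Rob U n)" "Rdiff U (Suc n) \<in> Hom C (Rob U (Suc n)) (Rob U n)"
    "Raug U \<in> Hom C (Rob U 0) M" "exact_at C (Rdiff U (Suc (Suc n))) (Rdiff U (Suc n))"
    "exact_at C (Rdiff U (Suc 0)) (Raug U)" "epi_arr C (Raug U)"
  using assms unfolding projective_resolution_def by auto

lemma aug_diff_in_Hom:
  assumes "projective_resolution C M U"
  shows "aug_diff U n \<in> Hom C (aug_ob U M (Suc n)) (aug_ob U M n)"
  using projective_resolutionD[OF assms] by (cases n) auto

lemma aug_exact:
  assumes "projective_resolution C M U"
  shows "exact_at C (aug_diff U (Suc n)) (aug_diff U n)"
  using projective_resolutionD[OF assms] by (cases n) auto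

lemma chain_map_overD:
  assumes "chain_map_over C f U V \<phi>"
  shows "\<phi> n \<in> Hom C (Rob U n) (Rob V n)"
    "\<phi> n \<bullet>\<^bsub>C\<^esub> Rdiff U (Suc n) = Rdiff V (Suc n) \<bullet>\<^bsub>C\<^esub> \<phi> (Suc n)"
    "Raug V \<bullet>\<^bsub>C\<^esub> \<phi> 0 = f \<bullet>\<^bsub>C\<^esub> Raug U"
  using assms unfolding chain_map_over_def by auto

section \<open>Comparison of resolutions: lifts and homotopies\<close>

context preadditive_category
begin

text \<open>One statement for all degrees. The cycle condition ranges over predecessors of
  \<open>n\<close>, so it is empty at \<open>0\<close>, where the augmentation is epi; above
  \<open>0\<close> the lift comes from exactness.\<close>

lemma aug_lift:
  assumes "projective_resolution C M U" "projective C Q" "h \<in> Hom C Q (aug_ob U M n)"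
    "\<And>m. n = Suc m \<Longrightarrow> aug_diff U m \<bullet> h = Zero C Q (aug_ob U M m)"
  shows "\<exists>l \<in> Hom C Q (aug_ob U M (Suc n)). aug_diff U n \<bullet> l = h"
proof (cases n)
  case 0
  then show ?thesis
    using projective_lift[OF assms(2) projective_resolutionD(6,3)[OF assms(1)]] assms(3) by simp
next
  case (Suc m)
  then show ?thesis
    using exact_at_lift[OF assms(2) aug_exact[OF assms(1)] aug_diff_in_Hom[OF assms(1)]
        aug_diff_in_Hom[OF assms(1)] _ assms(4)[OF Suc]] assms(3) by simp
qed

lemma resolution_diff_diff:
  assumes "projective_resolution C M U"
  shows "Rdiff U (Suc n) \<bullet> Rdiff U (Suc (Suc n)) = Zero C (Rob U (Suc (Suc n))) (Rob U n)"
  using exact_at_Comp[OF projective_resolutionD(4,2,2)[OF assms]] .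

lemma chain_map_exists:
  assumes U: "projective_resolution C M U" and V: "projective_resolution C M' V"
    and f: "f \<in> Hom C M M'"
  shows "\<exists>\<phi>. chain_map_over C f U V \<phi>"
proof -
  let ?A = "aug_ob U M" and ?B = "aug_ob V M'" and ?a = "aug_diff U" and ?b = "aug_diff V"
  note a = aug_diff_in_Hom[OF U] and b = aug_diff_in_Hom[OF V]
  \<comment> \<open>The last clause promises the next component in advance, since dependent choice
    continues only from a state that has a successor. Such an \<open>h\<close> becomes the next
    component, and \<open>h \<bullet> ?a (Suc n)\<close> lifts in turn because \<open>?b n\<close>
    sends it to \<open>\<phi> \<bullet> (?a n \<bullet> ?a (Suc n))\<close>, which is zero.\<close>
  let ?P = "\<lambda>n \<phi>. \<phi> \<in> Hom C (?A n) (?B n) \<and> (n = 0 \<longrightarrow> \<phi> = f) \<and>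
    (\<exists>h \<in> Hom C (?A (Suc n)) (?B (Suc n)). ?b n \<bullet> h = \<phi> \<bullet> ?a n)"
  have "\<exists>\<phi>. \<forall>n. ?P n (\<phi> n) \<and> ?b n \<bullet> \<phi> (Suc n) = \<phi> n \<bullet> ?a n"
  proof (rule dependent_nat_choice)
    have p: "projective C (?A (Suc 0))" and fa: "f \<bullet> ?a 0 \<in> Hom C (?A (Suc 0)) (?B 0)"
      using projective_resolutionD(1)[OF U] Comp_in_Hom[OF a[of 0]] f by simp_all
    show "\<exists>\<phi>. ?P 0 \<phi>"
      using aug_lift[OF V p fa] f by auto
  next
    fix \<phi> n assume P: "?P n \<phi>"
    then obtain h where h: "h \<in> Hom C (?A (Suc n)) (?B (Suc n))" "?b n \<bullet> h = \<phi> \<bullet> ?a n" by blast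
    have \<phi>: "\<phi> \<in> Hom C (?A n) (?B n)" using P by blast
    have p: "projective C (?A (Suc (Suc n)))"
      using projective_resolutionD(1)[OF U] by simp
    have "?b n \<bullet> (h \<bullet> ?a (Suc n)) = \<phi> \<bullet> (?a n \<bullet> ?a (Suc n))"
      using Comp_assoc[OF a h(1) b] Comp_assoc[OF a a \<phi>] h(2) by simp
    also have "\<dots> = Zero C (?A (Suc (Suc n))) (?B n)"
      using exact_at_Comp[OF aug_exact[OF U] a a] Comp_Zero_right[OF \<phi>] Hom_objs(1)[OF a] by metis
    finally have "\<exists>l \<in> Hom C (?A (Suc (Suc n))) (?B (Suc (Suc n))). ?b (Suc n) \<bullet> l = h \<bullet> ?a (Suc n)"
      using aug_lift[OF V p Comp_in_Hom[OF a h(1)]] by blast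
    then show "\<exists>y. ?P (Suc n) y \<and> ?b n \<bullet> y = \<phi> \<bullet> ?a n"
      using h by blast
  qed
  then obtain \<phi> where \<phi>: "\<And>n. ?P n (\<phi> n)" "\<And>n. ?b n \<bullet> \<phi> (Suc n) = \<phi> n \<bullet> ?a n"
    by blast
  \<comment> \<open>Index \<open>0\<close> of \<open>\<phi>\<close> is \<open>f\<close> itself, so
    the chain map starts at index \<open>1\<close>.\<close>
  have "chain_map_over C f U V (\<lambda>n. \<phi> (Suc n))"
    unfolding chain_map_over_def
    using \<phi>(1)[of "Suc _"] \<phi>(2)[of "Suc _"] \<phi>(1)[of 0] \<phi>(2)[of 0] by auto
  then show ?thesis
    by blast
qed

lemma chain_map_Comp:
  assumes "chain_map_over C f U V \<phi>" "chain_map_over C g V W \<psi>"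
    "projective_resolution C M U" "projective_resolution C M' V" "projective_resolution C M'' W"
    "f \<in> Hom C M M'" "g \<in> Hom C M' M''"
  shows "chain_map_over C (g \<bullet> f) U W (\<lambda>n. \<psi> n \<bullet> \<phi> n)"
  unfolding chain_map_over_def
proof (intro conjI allI)
  note \<phi> = chain_map_overD[OF assms(1)] and \<psi> = chain_map_overD[OF assms(2)]
  note U = projective_resolutionD[OF assms(3)] and V = projective_resolutionD[OF assms(4)]
    and W = projective_resolutionD[OF assms(5)]
  fix n
  show "\<psi> n \<bullet> \<phi> n \<in> Hom C (Rob U n) (Rob W n)"
    using Comp_in_Hom[OF \<phi>(1) \<psi>(1)] .
  show "\<psi> n \<bullet> \<phi> n \<bullet> Rdiff U (Suc n) = Rdiff W (Suc n) \<bullet> (\<psi> (Suc n) \<bullet> \<phi> (Suc n))"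
    using Comp_assoc[OF U(2) \<phi>(1) \<psi>(1), of n] Comp_assoc[OF \<phi>(1) V(2) \<psi>(1), of n]
      Comp_assoc[OF \<phi>(1) \<psi>(1) W(2), of n] \<phi>(2)[of n] \<psi>(2)[of n] by simp
  show "Raug W \<bullet> (\<psi> 0 \<bullet> \<phi> 0) = g \<bullet> f \<bullet> Raug U"
    using Comp_assoc[OF U(3) assms(6,7)] Comp_assoc[OF \<phi>(1) V(3) assms(7)]
      Comp_assoc[OF \<phi>(1) \<psi>(1) W(3)] \<phi>(3) \<psi>(3) by simp
qed

lemma chain_map_Id:
  assumes "projective_resolution C M U"
  shows "chain_map_over C (Id C M) U U (\<lambda>n. Id C (Rob U n))"
proof -
  note U = projective_resolutionD[OF assms]
  have "Rob U n \<in> Obj C" for n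
    using Hom_objs[OF U(2)] by blast
  then show ?thesis
    unfolding chain_map_over_def
    using Id_in_Hom Comp_Id_left[OF U(2)] Comp_Id_right[OF U(2)] Comp_Id_left[OF U(3)]
      Comp_Id_right[OF U(3)] by metis
qed

lemma chain_homotopy_exists:
  assumes U: "projective_resolution C M U" and V: "projective_resolution C M' V"
    and f: "f \<in> Hom C M M'"
    and \<phi>: "chain_map_over C f U V \<phi>" and \<psi>: "chain_map_over C f U V \<psi>"
  obtains s where "\<And>n. s n \<in> Hom C (Rob U n) (Rob V (Suc n))"
    "\<phi> 0 = Add C (\<psi> 0) (Rdiff V (Suc 0) \<bullet> s 0)"
    "\<And>n. \<phi> (Suc n) =
      Add C (\<psi> (Suc n)) (Add C (s n \<bullet> Rdiff U (Suc n)) (Rdiff V (Suc (Suc n)) \<bullet> s (Suc n)))"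
proof -
  let ?A = "aug_ob U M" and ?B = "aug_ob V M'" and ?a = "aug_diff U" and ?b = "aug_diff V"
  \<comment> \<open>\<open>F\<close> and \<open>G\<close> share \<open>f\<close> in the bottom
    degree, so their difference starts at zero and the homotopy can start with the zero map.\<close>
  define F where "F n = (case n of 0 \<Rightarrow> f | Suc m \<Rightarrow> \<phi> m)" for n
  define G where "G n = (case n of 0 \<Rightarrow> f | Suc m \<Rightarrow> \<psi> m)" for n
  note a = aug_diff_in_Hom[OF U] and b = aug_diff_in_Hom[OF V]
  have F: "F n \<in> Hom C (?A n) (?B n)" "F n \<bullet> ?a n = ?b n \<bullet> F (Suc n)" for n
    using chain_map_overD[OF \<phi>] f by (auto simp: F_def split: nat.split)
  have G: "G n \<in> Hom C (?A n) (?B n)" "G n \<bullet> ?a n = ?b n \<bullet> G (Suc n)" for n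
    using chain_map_overD[OF \<psi>] f by (auto simp: G_def split: nat.split)
  \<comment> \<open>By commutation with the differentials, the last clause says that
    \<open>?b n\<close> kills \<open>F (Suc n) - G (Suc n) - s \<bullet> ?a n\<close>. A lift of
    this difference along \<open>?b (Suc n)\<close> is the next component of the homotopy.\<close>
  let ?P = "\<lambda>n s. s \<in> Hom C (?A n) (?B (Suc n)) \<and> (n = 0 \<longrightarrow> s = Zero C (?A 0) (?B (Suc 0))) \<and>
    F n \<bullet> ?a n = Add C (G n \<bullet> ?a n) (?b n \<bullet> (s \<bullet> ?a n))"
  let ?Q = "\<lambda>n s s'. F (Suc n) = Add C (G (Suc n)) (Add C (s \<bullet> ?a n) (?b (Suc n) \<bullet> s'))"
  have "\<exists>s. \<forall>n. ?P n (s n) \<and> ?Q n (s n) (s (Suc n))"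
  proof (rule dependent_nat_choice)
    have z: "Zero C (?A 0) (?B (Suc 0)) \<in> Hom C (?A 0) (?B (Suc 0))"
      using Zero_in_Hom Hom_objs[OF a] Hom_objs[OF b] by blast
    have "?b 0 \<bullet> (Zero C (?A 0) (?B (Suc 0)) \<bullet> ?a 0) = Zero C (?A (Suc 0)) (?B 0)"
      using Comp_Zero_left[OF a] Comp_Zero_right[OF b] Hom_objs[OF a] Hom_objs[OF b] by metis
    moreover have "F 0 = G 0"
      by (simp add: F_def G_def)
    ultimately have "F 0 \<bullet> ?a 0 = Add C (G 0 \<bullet> ?a 0) (?b 0 \<bullet> (Zero C (?A 0) (?B (Suc 0)) \<bullet> ?a 0))"
      using Add_Zero_right[OF Comp_in_Hom[OF a G(1)]] by metis
    with z show "\<exists>s. ?P 0 s" by blast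
  next
    fix s n assume P: "?P n s"
    then have s: "s \<in> Hom C (?A n) (?B (Suc n))" by blast
    note sa = Comp_in_Hom[OF a s]
    obtain c where c: "c \<in> Hom C (?A (Suc n)) (?B (Suc n))"
        "F (Suc n) = Add C c (Add C (G (Suc n)) (s \<bullet> ?a n))"
      using ex_diff[OF F(1) Add_in_Hom[OF G(1) sa]] by blast
    have "?b n \<bullet> F (Suc n) = Add C (?b n \<bullet> c) (Add C (?b n \<bullet> G (Suc n)) (?b n \<bullet> (s \<bullet> ?a n)))"
      using c(2) Comp_Add_right[OF c(1) Add_in_Hom[OF G(1) sa] b] Comp_Add_right[OF G(1) sa b] by metis
    also have "Add C (?b n \<bullet> G (Suc n)) (?b n \<bullet> (s \<bullet> ?a n)) = ?b n \<bullet> F (Suc n)"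
      using P F(2) G(2) by metis
    finally have "?b n \<bullet> c = Zero C (?A (Suc n)) (?B n)"
      using Add_right_cancel_Zero[OF Comp_in_Hom[OF c(1) b] Comp_in_Hom[OF F(1) b]] by metis
    moreover have "projective C (?A (Suc n))"
      using projective_resolutionD(1)[OF U] by simp
    ultimately obtain s' where s': "s' \<in> Hom C (?A (Suc n)) (?B (Suc (Suc n)))" "?b (Suc n) \<bullet> s' = c"
      using aug_lift[OF V _ c(1)] by blast
    have Q: "?Q n s s'"
      using c s'(2) Add_commute[OF c(1) Add_in_Hom[OF G(1) sa]] Add_assoc[OF G(1) sa c(1)] by metis
    note bs' = Comp_in_Hom[OF s'(1) b]
    have "(s \<bullet> ?a n) \<bullet> ?a (Suc n) = Zero C (?A (Suc (Suc n))) (?B (Suc n))"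
      using Comp_assoc[OF a a s] exact_at_Comp[OF aug_exact[OF U] a a]
        Comp_Zero_right[OF s] Hom_objs(1)[OF a] by metis
    then have "F (Suc n) \<bullet> ?a (Suc n)
        = Add C (G (Suc n) \<bullet> ?a (Suc n)) ((?b (Suc n) \<bullet> s') \<bullet> ?a (Suc n))"
      using Q Comp_Add_left[OF a G(1) Add_in_Hom[OF sa bs']] Comp_Add_left[OF a sa bs']
        Add_Zero_left[OF Comp_in_Hom[OF a bs']] by metis
    then show "\<exists>s'. ?P (Suc n) s' \<and> ?Q n s s'"
      using Q s'(1) Comp_assoc[OF a s'(1) b] by auto
  qed
  then obtain s where s: "\<And>n. ?P n (s n)" "\<And>n. ?Q n (s n) (s (Suc n))"
    by blast
  show thesis
  proof (rule that[of "\<lambda>n. s (Suc n)"])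
    show "s (Suc n) \<in> Hom C (Rob U n) (Rob V (Suc n))" for n
      using s(1)[of "Suc n"] by simp
    show "\<phi> (Suc n) = Add C (\<psi> (Suc n))
        (Add C (s (Suc n) \<bullet> Rdiff U (Suc n)) (Rdiff V (Suc (Suc n)) \<bullet> s (Suc (Suc n))))" for n
      using s(2)[of "Suc n"] by (simp add: F_def G_def)
    have "s 0 \<bullet> Raug U = Zero C (Rob U 0) (Rob V 0)"
      using s(1)[of 0] Comp_Zero_left[OF a[of 0] Hom_objs(1)[OF b[of 0]]] by simp
    then show "\<phi> 0 = Add C (\<psi> 0) (Rdiff V (Suc 0) \<bullet> s (Suc 0))"
      using s(2)[of 0] s(1)[of "Suc 0"] Add_Zero_left[OF Comp_in_Hom[OF _ b[of "Suc 0"]]]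
      by (simp add: F_def G_def)
  qed
qed

section \<open>Biproducts\<close>

lemma biproductD:
  assumes "biproduct C A B S i j p q"
  shows "i \<in> Hom C A S" "j \<in> Hom C B S" "p \<in> Hom C S A" "q \<in> Hom C S B"
    "p \<bullet> i = Id C A" "q \<bullet> j = Id C B" "p \<bullet> j = Zero C B A" "q \<bullet> i = Zero C A B"
    "Add C (i \<bullet> p) (j \<bullet> q) = Id C S"
  using assms unfolding biproduct_def by auto

lemma biproduct_decompose:
  assumes "biproduct C A B S i j p q" "c \<in> Hom C S E"
  shows "c = Add C ((c \<bullet> i) \<bullet> p) ((c \<bullet> j) \<bullet> q)"
proof -
  note b = biproductD[OF assms(1)]
  show ?thesis
    using b(9) Comp_Add_right[OF Comp_in_Hom[OF b(3,1)] Comp_in_Hom[OF b(4,2)] assms(2)]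
      Comp_Id_right[OF assms(2)] Comp_assoc[OF b(3,1) assms(2)] Comp_assoc[OF b(4,2) assms(2)] by simp
qed

lemma biproduct_decompose':
  assumes "biproduct C A B S i j p q" "c \<in> Hom C E S"
  shows "c = Add C (i \<bullet> (p \<bullet> c)) (j \<bullet> (q \<bullet> c))"
proof -
  note b = biproductD[OF assms(1)]
  show ?thesis
    using b(9) Comp_Add_left[OF assms(2) Comp_in_Hom[OF b(3,1)] Comp_in_Hom[OF b(4,2)]]
      Comp_Id_left[OF assms(2)] Comp_assoc[OF assms(2) b(3,1)] Comp_assoc[OF assms(2) b(4,2)] by simp
qed

lemma biproduct_eqI:
  assumes "biproduct C A B S i j p q" "c \<in> Hom C S E" "c' \<in> Hom C S E"
    "c \<bullet> i = c' \<bullet> i" "c \<bullet> j = c' \<bullet> j"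
  shows "c = c'"
  using biproduct_decompose[OF assms(1)] assms(2-5) by metis

lemma biproduct_copair:
  assumes "biproduct C A B S i j p q" "a \<in> Hom C A E" "b \<in> Hom C B E"
  shows "\<exists>c \<in> Hom C S E. c \<bullet> i = a \<and> c \<bullet> j = b"
proof -
  note bp = biproductD[OF assms(1)]
  note ap = Comp_in_Hom[OF bp(3) assms(2)] and bq = Comp_in_Hom[OF bp(4) assms(3)]
  have "Add C (a \<bullet> p) (b \<bullet> q) \<bullet> i = a"
    using Comp_Add_left[OF bp(1) ap bq] Comp_assoc[OF bp(1,3) assms(2)] Comp_assoc[OF bp(1,4) assms(3)]
      bp(5,8) Comp_Id_right[OF assms(2)] Comp_Zero_right[OF assms(3)] Hom_objs(1)[OF assms(2)]
      Add_Zero_right[OF assms(2)] by simp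
  moreover have "Add C (a \<bullet> p) (b \<bullet> q) \<bullet> j = b"
    using Comp_Add_left[OF bp(2) ap bq] Comp_assoc[OF bp(2,3) assms(2)] Comp_assoc[OF bp(2,4) assms(3)]
      bp(6,7) Comp_Id_right[OF assms(3)] Comp_Zero_right[OF assms(2)] Hom_objs(1)[OF assms(3)]
      Add_Zero_left[OF assms(3)] by simp
  ultimately show ?thesis
    using Add_in_Hom[OF ap bq] by blast
qed

lemma biproduct_short_exact:
  assumes "biproduct C A B S i j p q"
  shows "short_exact C i q"
proof -
  note b = biproductD[OF assms]
  have "mono_arr C i"
    unfolding mono_arr_def
  proof (intro conjI allI ballI impI)
    show "i \<in> Arr C"
      using HomD[OF b(1)] by blast
    fix E g h assume "g \<in> Hom C E (Dom C i)" "h \<in> Hom C E (Dom C i)" "i \<bullet> g = i \<bullet> h"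
    then show "g = h"
      using Comp_assoc[OF _ b(1,3)] b(5) Comp_Id_left HomD[OF b(1)] by metis
  qed
  moreover have "\<exists>u \<in> Hom C E A. i \<bullet> u = h" if "h \<in> Hom C E S" "q \<bullet> h = Zero C E B" for E h
    using biproduct_decompose'[OF assms that(1)] that(2) Comp_Zero_right[OF b(2)]
      Hom_objs(1)[OF that(1)] Comp_in_Hom[OF that(1) b(3)] Add_Zero_right Comp_in_Hom[OF _ b(1)] by metis
  ultimately have "is_kernel C q i"
    using is_kernelI[OF _ b(1,4,8)] by blast
  moreover have "epi_arr C q"
    using epi_arrI[OF b(4)] Comp_assoc[OF b(2,4)] b(6) Comp_Id_right by metis
  moreover have "\<exists>u \<in> Hom C B E. u \<bullet> q = h" if "h \<in> Hom C S E" "h \<bullet> i = Zero C A E" for E h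
    using biproduct_decompose[OF assms that(1)] that(2) Comp_Zero_left[OF b(3)]
      Hom_objs(2)[OF that(1)] Comp_in_Hom[OF b(2) that(1)] Add_Zero_left Comp_in_Hom[OF b(4)] by metis
  then have "is_cokernel C i q" if "epi_arr C q"
    using is_cokernelI[OF that b(1,4,8)] by blast
  ultimately show ?thesis
    by (simp add: short_exact_def)
qed

lemma biproduct_projective:
  assumes "biproduct C A B S i j p q" "projective C A" "projective C B"
  shows "projective C S"
  unfolding projective_def
proof (intro conjI allI impI)
  note b = biproductD[OF assms(1)]
  show "S \<in> Obj C"
    using Hom_objs[OF b(1)] by blast
  fix e g assume "epi_arr C e \<and> g \<in> Hom C S (Cod C e)"
  then have e: "epi_arr C e" "e \<in> Hom C (Dom C e) (Cod C e)" and g: "g \<in> Hom C S (Cod C e)"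
    by (auto simp: epi_arr_def Hom_def)
  obtain x where x: "x \<in> Hom C A (Dom C e)" "e \<bullet> x = g \<bullet> i"
    using projective_lift[OF assms(2) e Comp_in_Hom[OF b(1) g]] by blast
  obtain y where y: "y \<in> Hom C B (Dom C e)" "e \<bullet> y = g \<bullet> j"
    using projective_lift[OF assms(3) e Comp_in_Hom[OF b(2) g]] by blast
  obtain c where c: "c \<in> Hom C S (Dom C e)" "c \<bullet> i = x" "c \<bullet> j = y"
    using biproduct_copair[OF assms(1) x(1) y(1)] by blast
  have "e \<bullet> c = g"
    using biproduct_eqI[OF assms(1) Comp_in_Hom[OF c(1) e(2)] g] Comp_assoc[OF b(1) c(1) e(2)]
      Comp_assoc[OF b(2) c(1) e(2)] c x y by simp
  with c show "\<exists>h \<in> Hom C S (Dom C e). e \<bullet> h = g"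
    by blast
qed

end

section \<open>The horseshoe lemma\<close>

context abelian_category
begin

text \<open>The middle resolution has objects \<open>U\<^sub>n \<oplus> W\<^sub>n\<close>; only the component of its differential on \<open>W\<^sub>n\<close>
  has to be chosen, namely a lift of the differential of \<open>W\<close> that composes to zero with the previous
  differential.\<close>

lemma horseshoe:
  assumes enough: "enough_projectives C" and k: "k \<in> Hom C K X" and f: "f \<in> Hom C X Y"
    and kf: "short_exact C k f"
    and U: "projective_resolution C K U" and W: "projective_resolution C Y W"
  obtains V i p where "covering C k f U V W i p"
proof -
  let ?A = "aug_ob U K" and ?E = "aug_ob W Y" and ?a = "aug_diff U" and ?e = "aug_diff W"
  note a = aug_diff_in_Hom[OF U] and e = aug_diff_in_Hom[OF W]
  note aa = exact_at_Comp[OF aug_exact[OF U] a a] and ee = exact_at_Comp[OF aug_exact[OF W] e e]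
  have "\<forall>n. \<exists>S i j p q. biproduct C (Rob U n) (Rob W n) S i j p q"
    using ex_biproduct Hom_objs[OF projective_resolutionD(2)[OF U]]
      Hom_objs[OF projective_resolutionD(2)[OF W]] by blast
  then obtain S i j p q where bi: "\<And>n. biproduct C (Rob U n) (Rob W n) (S n) (i n) (j n) (p n) (q n)"
    by metis
  \<comment> \<open>The given sequence is prepended as the bottom row, so that the augmentation is
    built by the same recursion as the differentials.\<close>
  define B where "B n = (case n of 0 \<Rightarrow> X | Suc m \<Rightarrow> S m)" for n
  define I where "I n = (case n of 0 \<Rightarrow> k | Suc m \<Rightarrow> i m)" for n
  define R where "R n = (case n of 0 \<Rightarrow> f | Suc m \<Rightarrow> q m)" for n
  have I: "I n \<in> Hom C (?A n) (B n)" and R: "R n \<in> Hom C (B n) (?E n)" for n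
    using k f biproductD[OF bi] by (auto simp: I_def R_def B_def split: nat.split)
  have IR: "short_exact C (I n) (R n)" for n
    using kf biproduct_short_exact[OF bi] by (auto simp: I_def R_def split: nat.split)
  then have ker: "is_kernel C (R n) (I n)" and coker: "is_cokernel C (I n) (R n)" for n
    by (auto simp: short_exact_def)
  note mono = is_kernel_mono[OF ker] and epi = is_cokernel_epi[OF coker]
  note RI = is_kernel_Comp[OF ker I R]
  have bi': "biproduct C (?A (Suc n)) (?E (Suc n)) (B (Suc n)) (I (Suc n)) (j n) (p n) (R (Suc n))" for n
    using bi by (simp add: B_def I_def R_def)
  note j = biproductD(2)[OF bi'] and Rj = biproductD(6)[OF bi']
  have pE: "projective C (?E (Suc n))" for n
    using projective_resolutionD(1)[OF W] by simp
  \<comment> \<open>On the summand from \<open>U\<close> compatibility forces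
    \<open>I n \<bullet> ?a n\<close>; on the summand from \<open>W\<close> any lift
    \<open>\<beta>\<close> of \<open>?e n\<close> along \<open>R n\<close> is admissible.
    Compatibility with \<open>R\<close> is then checked on both summands.\<close>
  have construct: "\<exists>D \<in> Hom C (B (Suc n)) (B n). D \<bullet> I (Suc n) = I n \<bullet> ?a n \<and>
      R n \<bullet> D = ?e n \<bullet> R (Suc n) \<and> D \<bullet> j n = \<beta>"
    if \<beta>: "\<beta> \<in> Hom C (?E (Suc n)) (B n)" "R n \<bullet> \<beta> = ?e n" for n \<beta>
  proof -
    obtain D where D: "D \<in> Hom C (B (Suc n)) (B n)" "D \<bullet> I (Suc n) = I n \<bullet> ?a n" "D \<bullet> j n = \<beta>"
      using biproduct_copair[OF bi' Comp_in_Hom[OF a I] \<beta>(1)] by blast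
    have "(R n \<bullet> D) \<bullet> I (Suc n) = Zero C (?A (Suc n)) (?E n)"
      using Comp_assoc[OF I D(1) R] Comp_assoc[OF a I R, of n] D(2) RI[of n] Comp_Zero_left[OF a]
        Hom_objs[OF R] by metis
    also have "\<dots> = (?e n \<bullet> R (Suc n)) \<bullet> I (Suc n)"
      using Comp_assoc[OF I R e, of n] RI[of "Suc n"] Comp_Zero_right[OF e] Hom_objs(1)[OF I] by metis
    finally have 1: "(R n \<bullet> D) \<bullet> I (Suc n) = (?e n \<bullet> R (Suc n)) \<bullet> I (Suc n)" .
    have "(R n \<bullet> D) \<bullet> j n = (?e n \<bullet> R (Suc n)) \<bullet> j n"
      using Comp_assoc[OF j D(1) R] Comp_assoc[OF j R e] D(3) \<beta>(2) Rj Comp_Id_right[OF e] by simp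
    then have "R n \<bullet> D = ?e n \<bullet> R (Suc n)"
      using biproduct_eqI[OF bi' Comp_in_Hom[OF D(1) R] Comp_in_Hom[OF R e] 1] by blast
    with D show ?thesis by blast
  qed
  \<comment> \<open>The lifting clause is the part of exactness that the recursion consumes: if
    \<open>I n \<bullet> t\<close> comes from \<open>D\<close>, then \<open>t\<close> itself comes
    from \<open>?a n\<close>. In the bottom degree it holds because \<open>?a 0\<close> is
    epi.\<close>
  let ?P = "\<lambda>n D. D \<in> Hom C (B (Suc n)) (B n) \<and> D \<bullet> I (Suc n) = I n \<bullet> ?a n \<and>
    R n \<bullet> D = ?e n \<bullet> R (Suc n) \<and>
    (\<forall>Q t h. projective C Q \<and> t \<in> Hom C Q (?A n) \<and> h \<in> Hom C Q (B (Suc n)) \<and> D \<bullet> h = I n \<bullet> t \<longrightarrow>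
      (\<exists>l \<in> Hom C Q (?A (Suc n)). ?a n \<bullet> l = t))"
  let ?Q = "\<lambda>n D D'. D \<bullet> D' = Zero C (B (Suc (Suc n))) (B n)"
  have "\<exists>D. \<forall>n. ?P n (D n) \<and> ?Q n (D n) (D (Suc n))"
  proof (rule dependent_nat_choice)
    obtain \<sigma> where "\<sigma> \<in> Hom C (?E (Suc 0)) (B 0)" "R 0 \<bullet> \<sigma> = ?e 0"
      using projective_lift[OF pE epi R e] by blast
    then obtain D where "D \<in> Hom C (B (Suc 0)) (B 0)" "D \<bullet> I (Suc 0) = I 0 \<bullet> ?a 0"
        "R 0 \<bullet> D = ?e 0 \<bullet> R (Suc 0)"
      using construct by blast
    moreover have "\<exists>l \<in> Hom C Q (?A (Suc 0)). ?a 0 \<bullet> l = t"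
      if "projective C Q" "t \<in> Hom C Q (?A 0)" for Q t
      using aug_lift[OF U that] by simp
    ultimately show "\<exists>D. ?P 0 D" by blast
  next
    fix D n assume "?P n D"
    then have D: "D \<in> Hom C (B (Suc n)) (B n)" "D \<bullet> I (Suc n) = I n \<bullet> ?a n" "R n \<bullet> D = ?e n \<bullet> R (Suc n)"
      and lift: "\<And>Q t h. \<lbrakk>projective C Q; t \<in> Hom C Q (?A n); h \<in> Hom C Q (B (Suc n)); D \<bullet> h = I n \<bullet> t\<rbrakk>
        \<Longrightarrow> \<exists>l \<in> Hom C Q (?A (Suc n)). ?a n \<bullet> l = t"
      by blast+
    \<comment> \<open>An arbitrary lift \<open>\<gamma>\<close> gets corrected. \<open>R n\<close>
      kills \<open>D \<bullet> \<gamma>\<close>, which is therefore \<open>I n \<bullet> s\<close>,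
      and the lifting clause gives \<open>s = ?a n \<bullet> t\<close>. The difference
      \<open>\<beta>\<close> of \<open>\<gamma>\<close> and \<open>I (Suc n) \<bullet> t\<close>
      still lifts \<open>?e (Suc n)\<close>, and now \<open>D \<bullet> \<beta>\<close> is
      zero.\<close>
    obtain \<gamma> where \<gamma>: "\<gamma> \<in> Hom C (?E (Suc (Suc n))) (B (Suc n))" "R (Suc n) \<bullet> \<gamma> = ?e (Suc n)"
      using projective_lift[OF pE epi R e] by blast
    note D\<gamma> = Comp_in_Hom[OF \<gamma>(1) D(1)]
    have "R n \<bullet> (D \<bullet> \<gamma>) = Zero C (?E (Suc (Suc n))) (?E n)"
      using Comp_assoc[OF \<gamma>(1) D(1) R] Comp_assoc[OF \<gamma>(1) R e] D(3) \<gamma>(2) ee by metis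
    then obtain s where s: "s \<in> Hom C (?E (Suc (Suc n))) (?A n)" "I n \<bullet> s = D \<bullet> \<gamma>"
      using is_kernel_factor[OF ker I R D\<gamma>] by blast
    then obtain t where t: "t \<in> Hom C (?E (Suc (Suc n))) (?A (Suc n))" "?a n \<bullet> t = s"
      using lift[OF pE s(1) \<gamma>(1)] by metis
    note It = Comp_in_Hom[OF t(1) I]
    obtain \<beta> where \<beta>: "\<beta> \<in> Hom C (?E (Suc (Suc n))) (B (Suc n))" "\<gamma> = Add C \<beta> (I (Suc n) \<bullet> t)"
      using ex_diff[OF \<gamma>(1) It] by blast
    have "R (Suc n) \<bullet> (I (Suc n) \<bullet> t) = Zero C (?E (Suc (Suc n))) (?E (Suc n))"
      using Comp_assoc[OF t(1) I R] RI Comp_Zero_left[OF t(1)] Hom_objs[OF R] by metis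
    then have R\<beta>: "R (Suc n) \<bullet> \<beta> = ?e (Suc n)"
      using \<gamma>(2) \<beta>(2) Comp_Add_right[OF \<beta>(1) It R] Add_Zero_right[OF Comp_in_Hom[OF \<beta>(1) R]] by metis
    have "D \<bullet> (I (Suc n) \<bullet> t) = D \<bullet> \<gamma>"
      using Comp_assoc[OF t(1) I D(1)] Comp_assoc[OF t(1) a I] D(2) s(2) t(2) by metis
    then have D\<beta>: "D \<bullet> \<beta> = Zero C (?E (Suc (Suc n))) (B n)"
      using \<beta>(2) Comp_Add_right[OF \<beta>(1) It D(1)]
        Add_right_cancel_Zero[OF Comp_in_Hom[OF \<beta>(1) D(1)] D\<gamma>] by metis
    obtain D' where D': "D' \<in> Hom C (B (Suc (Suc n))) (B (Suc n))"
        "D' \<bullet> I (Suc (Suc n)) = I (Suc n) \<bullet> ?a (Suc n)"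
        "R (Suc n) \<bullet> D' = ?e (Suc n) \<bullet> R (Suc (Suc n))" "D' \<bullet> j (Suc n) = \<beta>"
      using construct[OF \<beta>(1) R\<beta>] by blast
    note objs = Hom_objs[OF D(1)] Hom_objs[OF D'(1)]
    note DD' = Comp_in_Hom[OF D'(1) D(1)]
    have z: "Zero C (B (Suc (Suc n))) (B n) \<in> Hom C (B (Suc (Suc n))) (B n)"
      using Zero_in_Hom objs by blast
    have "(D \<bullet> D') \<bullet> I (Suc (Suc n)) = (D \<bullet> I (Suc n)) \<bullet> ?a (Suc n)"
      using Comp_assoc[OF I D'(1) D(1)] Comp_assoc[OF a I D(1)] D'(2) by metis
    also have "\<dots> = Zero C (?A (Suc (Suc n))) (B n)"
      using D(2) Comp_assoc[OF a a I, of n] aa[of n] Comp_Zero_right[OF I] Hom_objs(1)[OF a] by metis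
    finally have "(D \<bullet> D') \<bullet> I (Suc (Suc n)) = Zero C (B (Suc (Suc n))) (B n) \<bullet> I (Suc (Suc n))"
      using Comp_Zero_left[OF I] objs by metis
    moreover have "(D \<bullet> D') \<bullet> j (Suc n) = Zero C (B (Suc (Suc n))) (B n) \<bullet> j (Suc n)"
      using Comp_assoc[OF j D'(1) D(1)] D'(4) D\<beta> Comp_Zero_left[OF j] objs by metis
    ultimately have Q: "?Q n D D'"
      using biproduct_eqI[OF bi' DD' z] by blast
    \<comment> \<open>The lifting clause renews itself: \<open>D \<bullet> D' = 0\<close> forces
      \<open>?a n \<bullet> t = 0\<close>, and exactness of \<open>U\<close> applies.\<close>
    have "\<exists>l \<in> Hom C Q (?A (Suc (Suc n))). ?a (Suc n) \<bullet> l = t"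
      if Qt: "projective C Q" "t \<in> Hom C Q (?A (Suc n))" and h: "h \<in> Hom C Q (B (Suc (Suc n)))"
        "D' \<bullet> h = I (Suc n) \<bullet> t" for Q t h
    proof -
      have "I n \<bullet> (?a n \<bullet> t) = D \<bullet> (D' \<bullet> h)"
        using Comp_assoc[OF Qt(2) a I] Comp_assoc[OF Qt(2) I D(1)] D(2) h(2) by metis
      also have "\<dots> = Zero C Q (B n)"
        using Comp_assoc[OF h(1) D'(1) D(1)] Q Comp_Zero_left[OF h(1)] objs by metis
      finally have "?a n \<bullet> t = Zero C Q (?A n)"
        using mono_arr_cancel_Zero[OF mono I Comp_in_Hom[OF Qt(2) a]] by blast
      then show ?thesis
        using aug_lift[OF U Qt] by blast
    qed
    with D' Q show "\<exists>D'. ?P (Suc n) D' \<and> ?Q n D D'"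
      by blast
  qed
  then obtain D where D: "\<And>n. D n \<in> Hom C (B (Suc n)) (B n)" "\<And>n. D n \<bullet> I (Suc n) = I n \<bullet> ?a n"
      "\<And>n. R n \<bullet> D n = ?e n \<bullet> R (Suc n)"
    and lift: "\<And>n Q t h. \<lbrakk>projective C Q; t \<in> Hom C Q (?A n); h \<in> Hom C Q (B (Suc n)); D n \<bullet> h = I n \<bullet> t\<rbrakk>
        \<Longrightarrow> \<exists>l \<in> Hom C Q (?A (Suc n)). ?a n \<bullet> l = t"
    and DD: "\<And>n. D n \<bullet> D (Suc n) = Zero C (B (Suc (Suc n))) (B n)"
    by metis
  \<comment> \<open>Exactness of the middle complex, tested by projectives.
    \<open>R n \<bullet> h\<close> lifts in \<open>W\<close>, the lift pulls back to
    \<open>v\<close>, and the remainder \<open>c = h - D n \<bullet> v\<close> comes from a map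
    \<open>u\<close> into \<open>U\<close> that satisfies the cycle condition there and so lifts in
    turn.\<close>
  have lift_D: "\<exists>l \<in> Hom C Q (B (Suc n)). D n \<bullet> l = h"
    if Q: "projective C Q" and h: "h \<in> Hom C Q (B n)"
      and Dh: "\<And>m. n = Suc m \<Longrightarrow> D m \<bullet> h = Zero C Q (B m)" for n Q h
  proof -
    have "?e m \<bullet> (R n \<bullet> h) = Zero C Q (?E m)" if n: "n = Suc m" for m
      using Comp_assoc[OF h[unfolded n] R e] Comp_assoc[OF h[unfolded n] D(1) R] Dh[OF n]
        Comp_Zero_right[OF R] Hom_objs(1)[OF h] D(3) n by metis
    then obtain w where w: "w \<in> Hom C Q (?E (Suc n))" "?e n \<bullet> w = R n \<bullet> h"
      using aug_lift[OF W Q Comp_in_Hom[OF h R]] by blast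
    obtain v where v: "v \<in> Hom C Q (B (Suc n))" "R (Suc n) \<bullet> v = w"
      using projective_lift[OF Q epi R w(1)] by blast
    note Dv = Comp_in_Hom[OF v(1) D(1)]
    obtain c where c: "c \<in> Hom C Q (B n)" "h = Add C c (D n \<bullet> v)"
      using ex_diff[OF h Dv] by blast
    have "R n \<bullet> (D n \<bullet> v) = R n \<bullet> h"
      using Comp_assoc[OF v(1) D(1) R] Comp_assoc[OF v(1) R e] D(3) w v by metis
    then have "R n \<bullet> c = Zero C Q (?E n)"
      using Comp_Add_right[OF c(1) Dv R] c(2)
        Add_right_cancel_Zero[OF Comp_in_Hom[OF c(1) R] Comp_in_Hom[OF h R]] by metis
    then obtain u where u: "u \<in> Hom C Q (?A n)" "I n \<bullet> u = c"
      using is_kernel_factor[OF ker I R c(1)] by blast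
    have "?a m \<bullet> u' = Zero C Q (?A m)" if n: "n = Suc m" and u': "u' = u" for m u'
    proof -
      have u1: "u' \<in> Hom C Q (?A (Suc m))" "I (Suc m) \<bullet> u' = c" and v1: "v \<in> Hom C Q (B (Suc (Suc m)))"
        and c1: "c \<in> Hom C Q (B (Suc m))"
        using u u' v(1) c n by simp_all
      note Dc = Comp_in_Hom[OF c1 D(1)] and Dv1 = Comp_in_Hom[OF v1 D(1)]
      have "D m \<bullet> (D n \<bullet> v) = Zero C Q (B m)"
        using Comp_assoc[OF v1 D(1,1)] DD n Comp_Zero_left[OF v1] Hom_objs[OF D(1)] by metis
      then have "D m \<bullet> c = Zero C Q (B m)"
        using Comp_Add_right[OF c1 Dv1 D(1)] c(2) Dh[OF n] Add_Zero_right[OF Dc] n by metis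
      then have "I m \<bullet> (?a m \<bullet> u') = Zero C Q (B m)"
        using Comp_assoc[OF u1(1) a I] Comp_assoc[OF u1(1) I D(1)] D(2) u1(2) by metis
      then show ?thesis
        using mono_arr_cancel_Zero[OF mono I Comp_in_Hom[OF u1(1) a]] by blast
    qed
    then obtain t where t: "t \<in> Hom C Q (?A (Suc n))" "?a n \<bullet> t = u"
      using aug_lift[OF U Q u(1)] by blast
    note It = Comp_in_Hom[OF t(1) I]
    have "D n \<bullet> (I (Suc n) \<bullet> t) = c"
      using Comp_assoc[OF t(1) I D(1)] Comp_assoc[OF t(1) a I] D(2) t(2) u(2) by metis
    then have "D n \<bullet> Add C (I (Suc n) \<bullet> t) v = h"
      using Comp_Add_right[OF It v(1) D(1)] c(2) by metis
    then show ?thesis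
      using Add_in_Hom[OF It v(1)] by blast
  qed
  \<comment> \<open>\<open>D 0\<close> is the augmentation and \<open>D (Suc n)\<close> leaves
    degree \<open>Suc n\<close>, so the numbering of the augmented complex agrees with that of
    \<open>Rdiff\<close> and \<open>D\<close> itself can serve.\<close>
  define V where "V = \<lparr>Rob = S, Rdiff = D, Raug = D 0\<rparr>"
  have V: "aug_ob V X = B" "aug_diff V = D"
    by (auto simp: V_def B_def aug_ob_def aug_diff_def fun_eq_iff split: nat.split)
  have "projective_resolution C X V"
    unfolding projective_resolution_def
  proof (intro conjI allI)
    show "projective C (Rob V n)" for n
      using biproduct_projective[OF bi] projective_resolutionD(1)[OF U] projective_resolutionD(1)[OF W]
      by (simp add: V_def)
    show "Rdiff V (Suc n) \<in> Hom C (Rob V (Suc n)) (Rob V n)" for n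
      using D(1)[of "Suc n"] by (simp add: V_def B_def)
    show "Raug V \<in> Hom C (Rob V 0) X"
      using D(1)[of 0] by (simp add: V_def B_def)
    show "exact_at C (Rdiff V (Suc (Suc n))) (Rdiff V (Suc n))" for n
      using exact_atI_projective[OF enough D(1) D(1) DD] lift_D[of _ _ "Suc _"] by (simp add: V_def)
    show "exact_at C (Rdiff V 1) (Raug V)"
      using exact_atI_projective[OF enough D(1) D(1) DD, of 0] lift_D[of _ _ "Suc 0"] by (simp add: V_def)
    show "epi_arr C (Raug V)"
      using epi_arrI_projective[OF enough D(1)[of 0]] lift_D[of _ _ 0] by (simp add: V_def)
  qed
  moreover have "chain_map_over C k U V i"
    unfolding chain_map_over_def
    using biproductD(1)[OF bi] D(2)[of 0] D(2)[of "Suc _"] by (auto simp: V_def I_def)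
  moreover have "chain_map_over C f V W q"
    unfolding chain_map_over_def
    using biproductD(4)[OF bi] D(3)[of 0] D(3)[of "Suc _"] by (auto simp: V_def R_def)
  moreover have "short_exact C (i n) (q n)" for n
    using biproduct_short_exact[OF bi] .
  ultimately have "covering C k f U V W i q"
    unfolding covering_def using U W HomD[OF k] HomD[OF f] by simp
  then show thesis
    by (rule that)
qed

end

section \<open>Subquotients of abelian groups\<close>

context comm_group
begin

lemma ex_mult_eq:
  assumes "x \<in> carrier G" "y \<in> carrier G"
  shows "\<exists>z \<in> carrier G. x = z \<otimes> y"
  using assms by (intro bexI[of _ "x \<otimes> inv y"]) (simp_all add: m_assoc)

lemma rcos_eq_iff:
  assumes "subgroup N G" "x \<in> carrier G" "y \<in> carrier G"
  shows "N #> x = N #> y \<longleftrightarrow> (\<exists>b \<in> N. x = b \<otimes> y)"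
proof
  assume "N #> x = N #> y"
  then have "x \<in> N #> y"
    using rcos_self[OF assms(2,1)] by simp
  then show "\<exists>b \<in> N. x = b \<otimes> y"
    by (auto simp: r_coset_def)
next
  assume "\<exists>b \<in> N. x = b \<otimes> y"
  then have "x \<in> N #> y"
    by (auto simp: r_coset_def)
  then show "N #> x = N #> y"
    using repr_independence[OF _ assms(3,1)] by simp
qed

lemma carrier_subquotient: "carrier (G\<lparr>carrier := Z\<rparr> Mod N) = (\<lambda>z. N #> z) ` Z"
  by (auto simp: FactGroup_def RCOSETS_def r_coset_def)

lemma one_subquotient: "\<one>\<^bsub>G\<lparr>carrier := Z\<rparr> Mod N\<^esub> = N"
  by (simp add: FactGroup_def)

lemma rcos_one: "subgroup N G \<Longrightarrow> N #> \<one> = N"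
  by (simp add: subgroup.subset)

lemma mult_subquotient:
  assumes "subgroup N G" "x \<in> carrier G" "y \<in> carrier G"
  shows "(N #> x) \<otimes>\<^bsub>G\<lparr>carrier := Z\<rparr> Mod N\<^esub> (N #> y) = N #> (x \<otimes> y)"
proof -
  interpret normal N G
    using subgroup_imp_normal[OF assms(1)] .
  show ?thesis
    using rcos_sum[OF assms(2,3)] by (simp add: FactGroup_def set_mult_def)
qed

lemma subgroup_is_comm_group:
  assumes "subgroup Z G"
  shows "comm_group (G\<lparr>carrier := Z\<rparr>)"
  using group.group_comm_groupI[OF subgroup_imp_group[OF assms]] subgroup.mem_carrier[OF assms]
  by (auto intro: m_comm)

lemma comm_group_subquotient:
  assumes "subgroup Z G" "subgroup N G" "N \<subseteq> Z"
  shows "comm_group (G\<lparr>carrier := Z\<rparr> Mod N)"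
proof -
  interpret Z: comm_group "G\<lparr>carrier := Z\<rparr>"
    using subgroup_is_comm_group[OF assms(1)] .
  show ?thesis
    using Z.abelian_FactGroup subgroup_incl[OF assms(2,1,3)] by blast
qed

end

text \<open>\<open>\<phi>\<close> sends the coset of \<open>x\<close> into the coset of
  \<open>\<phi> x\<close>, so the product set is not larger than that coset, and a single point of
  the image already makes it fill the coset. Every induced map is thereby reduced to its effect on a
  representative.\<close>

lemma induced_rcos:
  assumes "subgroup M G" "group G" "subgroup N H" "group H" "\<phi> \<in> hom (G\<lparr>carrier := Z\<rparr>) H" "M \<subseteq> Z"
    "\<phi> ` M \<subseteq> N" "x \<in> Z"
  shows "induced H N \<phi> (M #>\<^bsub>G\<^esub> x) = N #>\<^bsub>H\<^esub> \<phi> x"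
proof -
  interpret G: group G by fact
  interpret H: group H by fact
  interpret M: subgroup M G by fact
  interpret N: subgroup N H by fact
  have \<phi>: "\<phi> (m \<otimes>\<^bsub>G\<^esub> x) = \<phi> m \<otimes>\<^bsub>H\<^esub> \<phi> x" if "m \<in> M" for m
    using that assms(5,6,8) by (auto simp: hom_def)
  have x: "\<phi> x \<in> carrier H"
    using assms(5,8) by (auto simp: hom_def)
  have "u \<otimes>\<^bsub>H\<^esub> \<phi> x \<in> induced H N \<phi> (M #>\<^bsub>G\<^esub> x)" if u: "u \<in> N" for u
  proof -
    \<comment> \<open>The point used is \<open>\<phi>\<close> of the product of the unit with
      \<open>x\<close>. Its factor \<open>?o\<close> lies in \<open>N\<close> and is cancelled
      there.\<close>
    let ?o = "\<phi> \<one>\<^bsub>G\<^esub>"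
    have o: "?o \<in> N"
      using assms(7) M.one_closed by blast
    have c: "u \<in> carrier H" "?o \<in> carrier H" "inv\<^bsub>H\<^esub> ?o \<in> carrier H"
      using u o by auto
    have "(u \<otimes>\<^bsub>H\<^esub> inv\<^bsub>H\<^esub> ?o) \<otimes>\<^bsub>H\<^esub> (?o \<otimes>\<^bsub>H\<^esub> \<phi> x) = u \<otimes>\<^bsub>H\<^esub> ((inv\<^bsub>H\<^esub> ?o \<otimes>\<^bsub>H\<^esub> ?o) \<otimes>\<^bsub>H\<^esub> \<phi> x)"
      using c x by (simp only: H.m_assoc H.m_closed)
    then have "u \<otimes>\<^bsub>H\<^esub> \<phi> x = (u \<otimes>\<^bsub>H\<^esub> inv\<^bsub>H\<^esub> ?o) \<otimes>\<^bsub>H\<^esub> (?o \<otimes>\<^bsub>H\<^esub> \<phi> x)"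
      using c x by (simp only: H.l_inv H.l_one)
    moreover have "u \<otimes>\<^bsub>H\<^esub> inv\<^bsub>H\<^esub> ?o \<in> N"
      using u o by blast
    moreover have "?o \<otimes>\<^bsub>H\<^esub> \<phi> x \<in> \<phi> ` (M #>\<^bsub>G\<^esub> x)"
      using \<phi>[OF M.one_closed, symmetric] M.one_closed unfolding r_coset_def by blast
    ultimately show ?thesis
      unfolding induced_def set_mult_def by blast
  qed
  moreover have "u \<otimes>\<^bsub>H\<^esub> \<phi> (m \<otimes>\<^bsub>G\<^esub> x) \<in> N #>\<^bsub>H\<^esub> \<phi> x" if "u \<in> N" "m \<in> M" for u m
  proof -
    have "\<phi> m \<in> N"
      using that assms(7) by blast
    then have "u \<otimes>\<^bsub>H\<^esub> \<phi> (m \<otimes>\<^bsub>G\<^esub> x) = (u \<otimes>\<^bsub>H\<^esub> \<phi> m) \<otimes>\<^bsub>H\<^esub> \<phi> x" "u \<otimes>\<^bsub>H\<^esub> \<phi> m \<in> N"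
      using \<phi> that x by (simp_all add: H.m_assoc)
    then show ?thesis
      by (auto simp: r_coset_def)
  qed
  ultimately show ?thesis
    by (auto simp: induced_def r_coset_def set_mult_def)
qed

section \<open>Transport of exactness along isomorphisms\<close>

lemma long_exact_iff:
  "long_exact GK GX GY d k f \<longleftrightarrow>
     (\<forall>n. comm_group (GK n) \<and> comm_group (GX n) \<and> comm_group (GY n)) \<and>
     (\<forall>n. f n \<in> hom (GX n) (GY n)) \<and> (\<forall>n. k n \<in> hom (GK n) (GX n)) \<and>
     (\<forall>n. d n \<in> hom (GY (Suc n)) (GK n)) \<and>
     (\<forall>n. kernel (GX n) (GY n) (f n) = k n ` carrier (GK n)) \<and>
     (\<forall>n. kernel (GK n) (GX n) (k n) = d n ` carrier (GY (Suc n))) \<and>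
     (\<forall>n. kernel (GY (Suc n)) (GK n) (d n) = f (Suc n) ` carrier (GX (Suc n))) \<and>
     f 0 ` carrier (GX 0) = carrier (GY 0)"
  unfolding long_exact_def by (auto simp: group_hom_def group_hom_axioms_def comm_group_def)

text \<open>Membership in the kernel of \<open>h\<close> is tested through \<open>Yc\<close>,
  membership in the image of \<open>g\<close> through \<open>Yb\<close>, and both are injective. The
  input about \<open>g\<close> and \<open>h\<close> is where they land and that the squares commute;
  additivity is recovered by the same kind of test in \<open>hom_iso_transport\<close>.\<close>

lemma kernel_iso_transport:
  assumes "Ya \<in> iso NA LA" "Yb \<in> iso NB LB" "Yc \<in> iso NC LC" "group NB" "group NC" "group LB" "group LC"
    "\<And>x. x \<in> carrier NA \<Longrightarrow> g x \<in> carrier NB" "\<And>x. x \<in> carrier NA \<Longrightarrow> Yb (g x) = g' (Ya x)"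
    "\<And>x. x \<in> carrier NB \<Longrightarrow> h x \<in> carrier NC" "\<And>x. x \<in> carrier NB \<Longrightarrow> Yc (h x) = h' (Yb x)"
    "kernel LB LC h' = g' ` carrier LA"
  shows "kernel NB NC h = g ` carrier NA"
proof -
  have a: "Ya ` carrier NA = carrier LA" and b: "inj_on Yb (carrier NB)" "Yb ` carrier NB = carrier LB"
    and c: "inj_on Yc (carrier NC)"
    using assms(1-3) by (auto simp: iso_iff)
  have one: "Yc \<one>\<^bsub>NC\<^esub> = \<one>\<^bsub>LC\<^esub>"
    using assms(3,5,7) hom_one by (auto simp: iso_iff)
  have oneC: "\<one>\<^bsub>NC\<^esub> \<in> carrier NC"
    using assms(5) by (simp add: group.is_monoid monoid.one_closed)
  have "x \<in> kernel NB NC h \<longleftrightarrow> x \<in> g ` carrier NA" if x: "x \<in> carrier NB" for x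
  proof -
    have "x \<in> kernel NB NC h \<longleftrightarrow> Yc (h x) = Yc \<one>\<^bsub>NC\<^esub>"
      using x assms(10) c oneC by (auto simp: kernel_def inj_on_eq_iff)
    also have "\<dots> \<longleftrightarrow> Yb x \<in> kernel LB LC h'"
      using x assms(11) one b(2) by (auto simp: kernel_def)
    also have "\<dots> \<longleftrightarrow> Yb x \<in> Yb ` g ` carrier NA"
      using assms(9) unfolding assms(12) a[symmetric] image_image by simp
    also have "\<dots> \<longleftrightarrow> x \<in> g ` carrier NA"
      using inj_on_image_mem_iff[OF b(1) x] assms(8) by blast
    finally show ?thesis .
  qed
  then show ?thesis
    using assms(8) by (auto simp: kernel_def)
qed

lemma hom_iso_transport:
  assumes "Ya \<in> iso NA LA" "Yb \<in> iso NB LB" "group NA" "group NB"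
    "\<And>x. x \<in> carrier NA \<Longrightarrow> g x \<in> carrier NB" "\<And>x. x \<in> carrier NA \<Longrightarrow> Yb (g x) = g' (Ya x)"
    "g' \<in> hom LA LB"
  shows "g \<in> hom NA NB"
proof (rule homI)
  fix x y assume xy: "x \<in> carrier NA" "y \<in> carrier NA"
  have Ya: "Ya \<in> hom NA LA" and Yb: "Yb \<in> hom NB LB" "inj_on Yb (carrier NB)"
    using assms(1,2) by (auto simp: iso_iff)
  have m: "x \<otimes>\<^bsub>NA\<^esub> y \<in> carrier NA"
    using assms(3) xy by (simp add: group.is_monoid monoid.m_closed)
  have gm: "g x \<otimes>\<^bsub>NB\<^esub> g y \<in> carrier NB"
    using assms(4,5) xy by (simp add: group.is_monoid monoid.m_closed)
  have "Yb (g (x \<otimes>\<^bsub>NA\<^esub> y)) = g' (Ya x \<otimes>\<^bsub>LA\<^esub> Ya y)"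
    using assms(6)[OF m] hom_mult[OF Ya xy] by simp
  also have "\<dots> = Yb (g x) \<otimes>\<^bsub>LB\<^esub> Yb (g y)"
    using assms(6) xy hom_mult[OF assms(7)] hom_in_carrier[OF Ya] by simp
  also have "\<dots> = Yb (g x \<otimes>\<^bsub>NB\<^esub> g y)"
    using hom_mult[OF Yb(1)] assms(5) xy by simp
  finally show "g (x \<otimes>\<^bsub>NA\<^esub> y) = g x \<otimes>\<^bsub>NB\<^esub> g y"
    using inj_onD[OF Yb(2)] assms(5)[OF m] gm by blast
qed (use assms(5) in blast)

text \<open>All exactness is imported from the row of the \<open>L\<close> groups. Given the
  isomorphisms, the other row only has to supply maps that land in the right groups and make the
  squares commute.\<close>

lemma long_exact_transport:
  assumes exact: "long_exact LK LX LY d' k' f'"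
    and groups: "\<And>n. comm_group (NK n)" "\<And>n. comm_group (NX n)" "\<And>n. comm_group (NY n)"
    and isos: "\<And>n. YK n \<in> iso (NK n) (LK n)" "\<And>n. YX n \<in> iso (NX n) (LX n)"
      "\<And>n. YY n \<in> iso (NY n) (LY n)"
    and d: "\<And>n x. x \<in> carrier (NY (Suc n)) \<Longrightarrow> d n x \<in> carrier (NK n)"
      "\<And>n x. x \<in> carrier (NY (Suc n)) \<Longrightarrow> YK n (d n x) = d' n (YY (Suc n) x)"
    and k: "\<And>n x. x \<in> carrier (NK n) \<Longrightarrow> k n x \<in> carrier (NX n)"
      "\<And>n x. x \<in> carrier (NK n) \<Longrightarrow> YX n (k n x) = k' n (YK n x)"
    and f: "\<And>n x. x \<in> carrier (NX n) \<Longrightarrow> f n x \<in> carrier (NY n)"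
      "\<And>n x. x \<in> carrier (NX n) \<Longrightarrow> YY n (f n x) = f' n (YX n x)"
  shows "long_exact NK NX NY d k f"
proof -
  note L = exact[unfolded long_exact_iff]
  have gN: "group (NK n)" "group (NX n)" "group (NY n)" for n
    using groups by (auto simp: comm_group_def)
  have gL: "group (LK n)" "group (LX n)" "group (LY n)" for n
    using L by (auto simp: comm_group_def)
  have "f n \<in> hom (NX n) (NY n)" for n
    by (rule hom_iso_transport[where g' = "f' n", OF isos(2,3) gN(2,3)]) (use f L in auto)
  moreover have "k n \<in> hom (NK n) (NX n)" for n
    by (rule hom_iso_transport[where g' = "k' n", OF isos(1,2) gN(1,2)]) (use k L in auto)
  moreover have "d n \<in> hom (NY (Suc n)) (NK n)" for n
    by (rule hom_iso_transport[where g' = "d' n", OF isos(3,1) gN(3,1)]) (use d L in auto)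
  moreover have "kernel (NX n) (NY n) (f n) = k n ` carrier (NK n)" for n
    by (rule kernel_iso_transport[where g' = "k' n" and h' = "f' n", OF isos gN(2,3) gL(2,3)])
      (use k f L in auto)
  moreover have "kernel (NK n) (NX n) (k n) = d n ` carrier (NY (Suc n))" for n
    by (rule kernel_iso_transport[where g' = "d' n" and h' = "k' n", OF isos(3,1,2) gN(1,2) gL(1,2)])
      (use d k L in auto)
  moreover have "kernel (NY (Suc n)) (NK n) (d n) = f (Suc n) ` carrier (NX (Suc n))" for n
    by (rule kernel_iso_transport[where g' = "f' (Suc n)" and h' = "d' n",
          OF isos(2,3,1) gN(3,1) gL(3,1)]) (use f d L in auto)
  moreover have "f 0 ` carrier (NX 0) = carrier (NY 0)"
  proof -
    have "YY 0 ` f 0 ` carrier (NX 0) = f' 0 ` YX 0 ` carrier (NX 0)"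
      using f(2) unfolding image_image by simp
    also have "\<dots> = YY 0 ` carrier (NY 0)"
      using isos(2,3)[of 0] L by (simp add: iso_iff)
    finally show ?thesis
      using isos(3)[of 0] f(1)[of _ 0] inj_on_image_eq_iff[of "YY 0" "carrier (NY 0)"]
      unfolding iso_iff by (metis image_subsetI order_refl)
  qed
  ultimately show ?thesis
    unfolding long_exact_iff using groups by simp
qed

section \<open>Right exact functors and left derived functors\<close>

locale abelian_right_exact = abelian_category C + right_exact_functor C T
  for C :: "('o, 'm) additive_cat" (structure) and T :: "('o, 'm, 't) ab_functor"
begin

lemma Fob_group: "A \<in> Obj C \<Longrightarrow> group (Fob T A)"
  using Fob_comm_group by (simp add: comm_group_def)

lemma Fmap_group_hom: "f \<in> Hom C A B \<Longrightarrow> group_hom (Fob T A) (Fob T B) (Fmap T f)"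
  using Fob_group Hom_objs Fmap_hom by (simp add: group_hom_def group_hom_axioms_def)

lemma Fmap_closed:
  "f \<in> Hom C A B \<Longrightarrow> x \<in> carrier (Fob T A) \<Longrightarrow> Fmap T f x \<in> carrier (Fob T B)"
  using hom_in_carrier[OF Fmap_hom] .

lemma Fmap_mult:
  "\<lbrakk>f \<in> Hom C A B; x \<in> carrier (Fob T A); y \<in> carrier (Fob T A)\<rbrakk>
    \<Longrightarrow> Fmap T f (x \<otimes>\<^bsub>Fob T A\<^esub> y) = Fmap T f x \<otimes>\<^bsub>Fob T B\<^esub> Fmap T f y"
  using hom_mult[OF Fmap_hom] .

lemma Fmap_one: "f \<in> Hom C A B \<Longrightarrow> Fmap T f \<one>\<^bsub>Fob T A\<^esub> = \<one>\<^bsub>Fob T B\<^esub>"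
  using group_hom.hom_one[OF Fmap_group_hom] .

lemma Fob_one_closed: "A \<in> Obj C \<Longrightarrow> \<one>\<^bsub>Fob T A\<^esub> \<in> carrier (Fob T A)"
  using Fob_group by (simp add: group.is_monoid monoid.one_closed)

lemma Fob_mult_closed:
  "\<lbrakk>A \<in> Obj C; x \<in> carrier (Fob T A); y \<in> carrier (Fob T A)\<rbrakk> \<Longrightarrow> x \<otimes>\<^bsub>Fob T A\<^esub> y \<in> carrier (Fob T A)"
  using Fob_group by (simp add: group.is_monoid monoid.m_closed)

lemma Fob_l_one:
  "\<lbrakk>A \<in> Obj C; x \<in> carrier (Fob T A)\<rbrakk> \<Longrightarrow> \<one>\<^bsub>Fob T A\<^esub> \<otimes>\<^bsub>Fob T A\<^esub> x = x"
  using Fob_group by (simp add: group.is_monoid)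

lemma Fob_r_one:
  "\<lbrakk>A \<in> Obj C; x \<in> carrier (Fob T A)\<rbrakk> \<Longrightarrow> x \<otimes>\<^bsub>Fob T A\<^esub> \<one>\<^bsub>Fob T A\<^esub> = x"
  using Fob_group by (simp add: group.is_monoid)

lemma Fmap_Zero:
  assumes "A \<in> Obj C" "B \<in> Obj C" "x \<in> carrier (Fob T A)"
  shows "Fmap T (Zero C A B) x = \<one>\<^bsub>Fob T B\<^esub>"
proof -
  interpret group "Fob T B"
    using Fob_group assms(2) .
  have z: "Zero C A B \<in> Hom C A B"
    using Zero_in_Hom assms by blast
  have "Fmap T (Zero C A B) x \<otimes>\<^bsub>Fob T B\<^esub> Fmap T (Zero C A B) x = Fmap T (Zero C A B) x"
    using Fmap_Add[OF z z assms(3)] Add_Zero_left[OF z] by simp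
  then show ?thesis
    using Fmap_closed[OF z assms(3)] by simp
qed

lemma Fmap_Comp_Zero:
  assumes "f \<in> Hom C A B" "g \<in> Hom C B D" "g \<bullet> f = Zero C A D" "x \<in> carrier (Fob T A)"
  shows "Fmap T g (Fmap T f x) = \<one>\<^bsub>Fob T D\<^esub>"
  using Fmap_Comp[OF assms(1,2,4)] Fmap_Zero[OF _ _ assms(4)] Hom_objs assms by metis

text \<open>Right exactness is stated for short exact sequences, so the epi is first completed by
  its kernel.\<close>

lemma Fmap_epi_surj:
  assumes "epi_arr C e" "e \<in> Hom C A B"
  shows "Fmap T e ` carrier (Fob T A) = carrier (Fob T B)"
proof -
  obtain I k where "k \<in> Hom C I A" "short_exact C k e"
    using epi_short_exact[OF assms] .
  then show ?thesis
    using right_exact[OF _ assms(2)] by blast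
qed

text \<open>For \<open>d = i \<bullet> e\<close> the pair of \<open>i\<close> and \<open>q\<close>
  is short exact, and \<open>Te\<close> is onto, so \<open>Td\<close> and \<open>Ti\<close> have the
  same image, the kernel of \<open>Tq\<close>. This identifies the cokernel of \<open>Td\<close>
  with \<open>TQ\<close>.\<close>

lemma Fmap_cokernel:
  assumes "exact_at C d g" "d \<in> Hom C A B" "g \<in> Hom C B D" "is_cokernel C d q" "q \<in> Hom C B Q"
  shows "kernel (Fob T B) (Fob T Q) (Fmap T q) = Fmap T d ` carrier (Fob T A)"
    "Fmap T q ` carrier (Fob T B) = carrier (Fob T Q)"
proof -
  obtain I i e where ie: "is_kernel C g i" "i \<in> Hom C I B" "epi_arr C e" "e \<in> Hom C A I" "d = i \<bullet> e"
    using exact_atE[OF assms(1-3)] by metis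
  have "short_exact C i q"
    using mono_short_exact[OF is_kernel_mono[OF ie(1)]] is_cokernel_Comp_epi[OF _ ie(3,4,2)] assms(4) ie(5)
    by blast
  then have r: "kernel (Fob T B) (Fob T Q) (Fmap T q) = Fmap T i ` carrier (Fob T I)"
      "Fmap T q ` carrier (Fob T B) = carrier (Fob T Q)"
    using right_exact[OF ie(2) assms(5)] by blast+
  have "Fmap T d ` carrier (Fob T A) = Fmap T i ` Fmap T e ` carrier (Fob T A)"
    using Fmap_Comp[OF ie(4,2)] ie(5) unfolding image_image by simp
  then show "kernel (Fob T B) (Fob T Q) (Fmap T q) = Fmap T d ` carrier (Fob T A)"
    using r Fmap_epi_surj[OF ie(3,4)] by simp
  show "Fmap T q ` carrier (Fob T B) = carrier (Fob T Q)"
    by (rule r)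
qed

text \<open>\<open>T\<close> need not preserve monos, but every functor preserves
  retractions.\<close>

lemma Fmap_split_inj:
  assumes "i \<in> Hom C A B" "r \<in> Hom C B A" "r \<bullet> i = Id C A" "x \<in> carrier (Fob T A)"
    "y \<in> carrier (Fob T A)" "Fmap T i x = Fmap T i y"
  shows "x = y"
  using Fmap_Comp[OF assms(1,2)] Fmap_Id[OF Hom_objs(1)[OF assms(1)]] assms(3-6) by metis

end

definition homology_class ::
  "('o, 'm, 'a) ab_functor \<Rightarrow> ('o, 'm) resolution \<Rightarrow> nat \<Rightarrow> 'a \<Rightarrow> 'a set" where
  "homology_class T U n x = boundaries T U n #>\<^bsub>Fob T (Rob U n)\<^esub> x"

section \<open>Cycles, boundaries and maps on homology\<close>

context abelian_right_exact
begin

lemma cyclesI: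
  assumes "x \<in> carrier (Fob T (Rob U n))"
    "\<And>m. n = Suc m \<Longrightarrow> Fmap T (Rdiff U (Suc m)) x = \<one>\<^bsub>Fob T (Rob U m)\<^esub>"
  shows "x \<in> cycles T U n"
  using assms by (cases n) (auto simp: cycles_def kernel_def)

lemma cyclesD:
  assumes "x \<in> cycles T U n"
  shows "x \<in> carrier (Fob T (Rob U n))"
    "n = Suc m \<Longrightarrow> Fmap T (Rdiff U (Suc m)) x = \<one>\<^bsub>Fob T (Rob U m)\<^esub>"
  using assms by (cases n; auto simp: cycles_def kernel_def)+

context
  fixes M U
  assumes U: "projective_resolution C M U"
begin

lemma Rob_in_Obj: "Rob U n \<in> Obj C"
  using Hom_objs projective_resolutionD(2)[OF U] by blast

lemma Fob_Rob_comm_group: "comm_group (Fob T (Rob U n))"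
  using Fob_comm_group Rob_in_Obj by blast

lemma Fmap_diff_diff:
  assumes "x \<in> carrier (Fob T (Rob U (Suc (Suc n))))"
  shows "Fmap T (Rdiff U (Suc n)) (Fmap T (Rdiff U (Suc (Suc n))) x) = \<one>\<^bsub>Fob T (Rob U n)\<^esub>"
  using Fmap_Comp_Zero[OF projective_resolutionD(2,2)[OF U] resolution_diff_diff[OF U] assms] .

lemma subgroup_boundaries: "subgroup (boundaries T U n) (Fob T (Rob U n))"
proof -
  interpret group_hom "Fob T (Rob U (Suc n))" "Fob T (Rob U n)" "Fmap T (Rdiff U (Suc n))"
    using Fmap_group_hom projective_resolutionD(2)[OF U] by blast
  show ?thesis
    using img_is_subgroup by (simp add: boundaries_def)
qed

lemma subgroup_cycles: "subgroup (cycles T U n) (Fob T (Rob U n))"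
proof (cases n)
  case 0
  then show ?thesis
    using group.subgroup_self[OF Fob_group[OF Rob_in_Obj]] by (simp add: cycles_def)
next
  case (Suc m)
  interpret group_hom "Fob T (Rob U (Suc m))" "Fob T (Rob U m)" "Fmap T (Rdiff U (Suc m))"
    using Fmap_group_hom projective_resolutionD(2)[OF U] by blast
  show ?thesis
    using subgroup_kernel by (simp add: cycles_def Suc)
qed

lemma boundaries_subset_cycles: "boundaries T U n \<subseteq> cycles T U n"
proof
  fix x assume "x \<in> boundaries T U n"
  then obtain y where y: "y \<in> carrier (Fob T (Rob U (Suc n)))" "x = Fmap T (Rdiff U (Suc n)) y"
    by (auto simp: boundaries_def)
  show "x \<in> cycles T U n"
  proof (rule cyclesI)
    show "x \<in> carrier (Fob T (Rob U n))"
      using Fmap_closed[OF projective_resolutionD(2)[OF U] y(1)] y(2) by simp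
    fix m assume m: "n = Suc m"
    show "Fmap T (Rdiff U (Suc m)) x = \<one>\<^bsub>Fob T (Rob U m)\<^esub>"
      using Fmap_diff_diff[of y m] y m by simp
  qed
qed

lemma homology_class_eq_iff:
  assumes "x \<in> carrier (Fob T (Rob U n))" "y \<in> carrier (Fob T (Rob U n))"
  shows "homology_class T U n x = homology_class T U n y \<longleftrightarrow>
    (\<exists>b \<in> carrier (Fob T (Rob U (Suc n))). x = Fmap T (Rdiff U (Suc n)) b \<otimes>\<^bsub>Fob T (Rob U n)\<^esub> y)"
  using comm_group.rcos_eq_iff[OF Fob_Rob_comm_group subgroup_boundaries assms]
  by (simp add: homology_class_def boundaries_def)

lemma homology_class_mem_iff:
  assumes "x \<in> carrier (Fob T (Rob U n))"
  shows "y \<in> homology_class T U n x \<longleftrightarrow>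
    y \<in> carrier (Fob T (Rob U n)) \<and> homology_class T U n y = homology_class T U n x"
proof -
  interpret comm_group "Fob T (Rob U n)"
    using Fob_Rob_comm_group .
  have "y \<in> homology_class T U n x \<longleftrightarrow> (\<exists>b \<in> boundaries T U n. y = b \<otimes>\<^bsub>Fob T (Rob U n)\<^esub> x)"
    by (auto simp: homology_class_def r_coset_def)
  also have "\<dots> \<longleftrightarrow> y \<in> carrier (Fob T (Rob U n)) \<and> homology_class T U n y = homology_class T U n x"
    using rcos_eq_iff[OF subgroup_boundaries _ assms, of y] subgroup.mem_carrier[OF subgroup_boundaries]
      assms m_closed unfolding homology_class_def by blast
  finally show ?thesis .
qed

lemma homology_class_mult:
  assumes "x \<in> carrier (Fob T (Rob U n))" "y \<in> carrier (Fob T (Rob U n))"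
  shows "homology_class T U n x \<otimes>\<^bsub>(Fob T (Rob U n))\<lparr>carrier := cycles T U n\<rparr> Mod boundaries T U n\<^esub>
      homology_class T U n y = homology_class T U n (x \<otimes>\<^bsub>Fob T (Rob U n)\<^esub> y)"
  unfolding homology_class_def
  using comm_group.mult_subquotient[OF Fob_Rob_comm_group subgroup_boundaries assms] .

lemma homology_comm_group:
  "comm_group ((Fob T (Rob U n))\<lparr>carrier := cycles T U n\<rparr> Mod boundaries T U n)"
  using comm_group.comm_group_subquotient[OF Fob_Rob_comm_group subgroup_cycles subgroup_boundaries
      boundaries_subset_cycles] .

lemma carrier_homology:
  "carrier ((Fob T (Rob U n))\<lparr>carrier := cycles T U n\<rparr> Mod boundaries T U n) =
    homology_class T U n ` cycles T U n"
  unfolding homology_class_def using comm_group.carrier_subquotient[OF Fob_Rob_comm_group] .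

lemma homology_one:
  "\<one>\<^bsub>(Fob T (Rob U n))\<lparr>carrier := cycles T U n\<rparr> Mod boundaries T U n\<^esub> =
    homology_class T U n \<one>\<^bsub>Fob T (Rob U n)\<^esub>"
  unfolding homology_class_def comm_group.one_subquotient[OF Fob_Rob_comm_group]
  using comm_group.rcos_one[OF Fob_Rob_comm_group subgroup_boundaries] by simp

lemma one_in_cycles: "\<one>\<^bsub>Fob T (Rob U n)\<^esub> \<in> cycles T U n"
  using subgroup.one_closed[OF subgroup_cycles] .

lemma mult_in_cycles:
  "x \<in> cycles T U n \<Longrightarrow> y \<in> cycles T U n \<Longrightarrow> x \<otimes>\<^bsub>Fob T (Rob U n)\<^esub> y \<in> cycles T U n"
  using subgroup.m_closed[OF subgroup_cycles] .

end

context
  fixes M U M' V f \<phi>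
  assumes U: "projective_resolution C M U" and V: "projective_resolution C M' V"
    and \<phi>: "chain_map_over C f U V \<phi>"
begin

lemma chain_map_diff:
  assumes "x \<in> carrier (Fob T (Rob U (Suc n)))"
  shows "Fmap T (Rdiff V (Suc n)) (Fmap T (\<phi> (Suc n)) x) = Fmap T (\<phi> n) (Fmap T (Rdiff U (Suc n)) x)"
  using Fmap_Comp[OF chain_map_overD(1)[OF \<phi>] projective_resolutionD(2)[OF V] assms]
    Fmap_Comp[OF projective_resolutionD(2)[OF U] chain_map_overD(1)[OF \<phi>] assms]
    chain_map_overD(2)[OF \<phi>] by metis

lemma chain_map_cycles:
  assumes "x \<in> cycles T U n"
  shows "Fmap T (\<phi> n) x \<in> cycles T V n"
proof (rule cyclesI)
  note x = cyclesD[OF assms]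
  show "Fmap T (\<phi> n) x \<in> carrier (Fob T (Rob V n))"
    using Fmap_closed[OF chain_map_overD(1)[OF \<phi>] x(1)] .
  fix m assume m: "n = Suc m"
  show "Fmap T (Rdiff V (Suc m)) (Fmap T (\<phi> n) x) = \<one>\<^bsub>Fob T (Rob V m)\<^esub>"
    using chain_map_diff[of x m] x m Fmap_one[OF chain_map_overD(1)[OF \<phi>]] by simp
qed

lemma chain_map_class_cong:
  assumes "x \<in> carrier (Fob T (Rob U n))" "y \<in> carrier (Fob T (Rob U n))"
    "homology_class T U n x = homology_class T U n y"
  shows "homology_class T V n (Fmap T (\<phi> n) x) = homology_class T V n (Fmap T (\<phi> n) y)"
proof -
  note c = chain_map_overD(1)[OF \<phi>]
  obtain b where b: "b \<in> carrier (Fob T (Rob U (Suc n)))"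
      "x = Fmap T (Rdiff U (Suc n)) b \<otimes>\<^bsub>Fob T (Rob U n)\<^esub> y"
    using homology_class_eq_iff[OF U assms(1,2)] assms(3) by blast
  have "Fmap T (\<phi> n) x
      = Fmap T (Rdiff V (Suc n)) (Fmap T (\<phi> (Suc n)) b) \<otimes>\<^bsub>Fob T (Rob V n)\<^esub> Fmap T (\<phi> n) y"
    using b(2) Fmap_mult[OF c Fmap_closed[OF projective_resolutionD(2)[OF U] b(1)] assms(2)]
      chain_map_diff[OF b(1)] by simp
  then show ?thesis
    using homology_class_eq_iff[OF V Fmap_closed[OF c assms(1)] Fmap_closed[OF c assms(2)]]
      Fmap_closed[OF c b(1)] by blast
qed

end

text \<open>On a cycle the homotopy term through \<open>Rdiff U\<close> vanishes, and the other term
  is a boundary. Hence it does not matter on homology which lift the choice operator in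
  \<open>chain_lift\<close> picks.\<close>

lemma chain_map_class_unique:
  assumes U: "projective_resolution C M U" and V: "projective_resolution C M' V"
    and f: "f \<in> Hom C M M'"
    and \<phi>: "chain_map_over C f U V \<phi>" and \<psi>: "chain_map_over C f U V \<psi>"
    and x: "x \<in> cycles T U n"
  shows "homology_class T V n (Fmap T (\<phi> n) x) = homology_class T V n (Fmap T (\<psi> n) x)"
proof -
  obtain s where s: "\<And>n. s n \<in> Hom C (Rob U n) (Rob V (Suc n))"
    "\<phi> 0 = Add C (\<psi> 0) (Rdiff V (Suc 0) \<bullet> s 0)"
    "\<And>n. \<phi> (Suc n) =
      Add C (\<psi> (Suc n)) (Add C (s n \<bullet> Rdiff U (Suc n)) (Rdiff V (Suc (Suc n)) \<bullet> s (Suc n)))"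
    using chain_homotopy_exists[OF U V f \<phi> \<psi>] by blast
  note dU = projective_resolutionD(2)[OF U] and dV = projective_resolutionD(2)[OF V]
  note \<phi>h = chain_map_overD(1)[OF \<phi>] and \<psi>h = chain_map_overD(1)[OF \<psi>]
  note xc = cyclesD[OF x]
  interpret comm_group "Fob T (Rob V n)"
    using Fob_Rob_comm_group[OF V] .
  note sx = Fmap_closed[OF s(1) xc(1)]
  have "Fmap T (\<phi> n) x
      = Fmap T (\<psi> n) x \<otimes>\<^bsub>Fob T (Rob V n)\<^esub> Fmap T (Rdiff V (Suc n)) (Fmap T (s n) x)"
  proof (cases n)
    case 0
    then show ?thesis
      using Fmap_Add[OF \<psi>h Comp_in_Hom[OF s(1) dV], of x 0] Fmap_Comp[OF s(1) dV] xc(1) s(2) by simp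
  next
    case (Suc m)
    have x': "x \<in> carrier (Fob T (Rob U (Suc m)))"
      using xc(1) Suc by simp
    note sd = Comp_in_Hom[OF dU s(1)] and ds = Comp_in_Hom[OF s(1) dV]
    have "Fmap T (s m \<bullet> Rdiff U (Suc m)) x = \<one>\<^bsub>Fob T (Rob V (Suc m))\<^esub>"
      using Fmap_Comp[OF dU s(1) x'] xc(2)[OF Suc] Fmap_one[OF s(1)] by simp
    moreover have "Fmap T (Rdiff V (Suc (Suc m)) \<bullet> s (Suc m)) x \<in> carrier (Fob T (Rob V (Suc m)))"
      using Fmap_closed[OF ds x'] .
    ultimately show ?thesis
      using Fmap_Add[OF \<psi>h Add_in_Hom[OF sd ds] x'] Fmap_Add[OF sd ds x'] s(3)[of m] Suc
        Fmap_Comp[OF s(1) dV x'] l_one by simp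
  qed
  then have "Fmap T (\<phi> n) x
      = Fmap T (Rdiff V (Suc n)) (Fmap T (s n) x) \<otimes>\<^bsub>Fob T (Rob V n)\<^esub> Fmap T (\<psi> n) x"
    using m_comm Fmap_closed[OF dV sx] Fmap_closed[OF \<psi>h xc(1)] by simp
  then show ?thesis
    using homology_class_eq_iff[OF V Fmap_closed[OF \<phi>h xc(1)] Fmap_closed[OF \<psi>h xc(1)]] sx by blast
qed

end

section \<open>Left derived functors on representatives\<close>

locale derived_setting = abelian_right_exact C T
  for C :: "('o, 'm) additive_cat" (structure) and T :: "('o, 'm, 't) ab_functor" +
  fixes P :: "'o \<Rightarrow> ('o, 'm) resolution"
  assumes enough: "enough_projectives C"
    and resolution: "M \<in> Obj C \<Longrightarrow> projective_resolution C M (P M)"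
begin

lemma chain_lift_over:
  assumes "f \<in> Hom C M M'"
  shows "chain_map_over C f (P M) (P M') (chain_lift C P f)"
  using someI_ex[OF chain_map_exists[OF resolution resolution assms]] Hom_objs[OF assms] HomD[OF assms]
  by (simp add: chain_lift_def)

lemma LDer_comm_group: "M \<in> Obj C \<Longrightarrow> comm_group (LDer T P n M)"
  unfolding LDer_def using homology_comm_group[OF resolution] .

lemma carrier_LDer: "M \<in> Obj C \<Longrightarrow> carrier (LDer T P n M) = homology_class T (P M) n ` cycles T (P M) n"
  unfolding LDer_def using carrier_homology[OF resolution] .

lemma LDer_mult:
  assumes "M \<in> Obj C" "x \<in> cycles T (P M) n" "y \<in> cycles T (P M) n"
  shows "homology_class T (P M) n x \<otimes>\<^bsub>LDer T P n M\<^esub> homology_class T (P M) n y =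
    homology_class T (P M) n (x \<otimes>\<^bsub>Fob T (Rob (P M) n)\<^esub> y)"
  unfolding LDer_def using homology_class_mult[OF resolution] cyclesD assms by blast

lemma LDer_one:
  "M \<in> Obj C \<Longrightarrow> \<one>\<^bsub>LDer T P n M\<^esub> = homology_class T (P M) n \<one>\<^bsub>Fob T (Rob (P M) n)\<^esub>"
  unfolding LDer_def using homology_one[OF resolution] .

lemma LDer_map_class:
  assumes f: "f \<in> Hom C M M'" and x: "x \<in> cycles T (P M) n"
  shows "LDer_map C T P n f (homology_class T (P M) n x) =
    homology_class T (P M') n (Fmap T (chain_lift C P f n) x)"
proof -
  note o = Hom_objs[OF f]
  note M = resolution[OF o(1)] and M' = resolution[OF o(2)]
  note l = chain_lift_over[OF f]
  have "Fmap T (chain_lift C P f n) ` boundaries T (P M) n \<subseteq> boundaries T (P M') n"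
    using chain_map_diff[OF M M' l, of _ n] Fmap_closed[OF chain_map_overD(1)[OF l]]
    by (auto simp: boundaries_def) (metis imageI)
  moreover have "boundaries T (P M) n \<subseteq> carrier (Fob T (Rob (P M) n))"
    using subgroup.subset[OF subgroup_boundaries[OF M]] .
  moreover have "Fmap T (chain_lift C P f n) \<in>
      hom ((Fob T (Rob (P M) n))\<lparr>carrier := carrier (Fob T (Rob (P M) n))\<rparr>) (Fob T (Rob (P M') n))"
    using Fmap_hom[OF chain_map_overD(1)[OF l]] by simp
  ultimately show ?thesis
    unfolding LDer_map_def homology_class_def HomD(2,3)[OF f]
    using induced_rcos[OF subgroup_boundaries[OF M] Fob_group[OF Rob_in_Obj[OF M]]
        subgroup_boundaries[OF M'] Fob_group[OF Rob_in_Obj[OF M']] _ _ _ cyclesD(1)[OF x]] by blast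
qed

lemma LDer_map_hom:
  assumes f: "f \<in> Hom C M M'"
  shows "LDer_map C T P n f \<in> hom (LDer T P n M) (LDer T P n M')"
proof (rule homI)
  note o = Hom_objs[OF f]
  note M = resolution[OF o(1)] and M' = resolution[OF o(2)]
  note l = chain_lift_over[OF f]
  note lc = chain_map_cycles[OF M M' l]
  show "LDer_map C T P n f c \<in> carrier (LDer T P n M')" if "c \<in> carrier (LDer T P n M)" for c
    using that lc carrier_LDer o LDer_map_class[OF f] by auto
  fix c d assume "c \<in> carrier (LDer T P n M)" "d \<in> carrier (LDer T P n M)"
  then have "c \<in> homology_class T (P M) n ` cycles T (P M) n" "d \<in> homology_class T (P M) n ` cycles T (P M) n"
    using carrier_LDer[OF o(1)] by simp_all
  then obtain x y where xy: "x \<in> cycles T (P M) n" "y \<in> cycles T (P M) n"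
      "c = homology_class T (P M) n x" "d = homology_class T (P M) n y"
    by blast
  then show "LDer_map C T P n f (c \<otimes>\<^bsub>LDer T P n M\<^esub> d)
      = LDer_map C T P n f c \<otimes>\<^bsub>LDer T P n M'\<^esub> LDer_map C T P n f d"
    using LDer_mult[OF o(1) xy(1,2)] LDer_map_class[OF f] mult_in_cycles[OF M xy(1,2)]
      LDer_mult[OF o(2) lc[OF xy(1)] lc[OF xy(2)]]
      Fmap_mult[OF chain_map_overD(1)[OF l] cyclesD(1)[OF xy(1)] cyclesD(1)[OF xy(2)]] by simp
qed

end

section \<open>The long exact sequence of left derived functors\<close>

text \<open>The chosen covering is named by an equation, so that the pattern matches in
  \<open>Ext_conn\<close> and \<open>LDer_conn\<close> reduce to the same \<open>V\<close>,
  \<open>i\<close> and \<open>p\<close>.\<close>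

locale ses_setting = derived_setting C T P
  for C :: "('o, 'm) additive_cat" (structure) and T :: "('o, 'm, 't) ab_functor"
    and P :: "'o \<Rightarrow> ('o, 'm) resolution" +
  fixes k f :: 'm and K X Y :: 'o and V :: "('o, 'm) resolution" and i p :: "nat \<Rightarrow> 'm"
  assumes k: "k \<in> Hom C K X" and f: "f \<in> Hom C X Y" and short_exact_kf: "short_exact C k f"
    and chosen: "chosen_covering C P k f = (V, i, p)"
begin

abbreviation "U \<equiv> P K"
abbreviation "W \<equiv> P Y"

lemma cover: "covering C k f U V W i p"
proof -
  have "\<exists>c. case c of (V, i, p) \<Rightarrow> covering C k f (P (Dom C k)) V (P (Cod C f)) i p"
    using horseshoe[OF enough k f short_exact_kf resolution resolution] Hom_objs[OF k] Hom_objs[OF f]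
      HomD[OF k] HomD[OF f] by (metis (no_types, lifting) case_prodI)
  from someI_ex[OF this] show ?thesis
    using chosen HomD[OF k] HomD[OF f] unfolding chosen_covering_def by simp
qed

lemma res_U: "projective_resolution C K U" and res_X: "projective_resolution C X (P X)"
  and res_W: "projective_resolution C Y W"
  using resolution Hom_objs[OF k] Hom_objs[OF f] by auto

lemma res_V: "projective_resolution C X V" and chain_i: "chain_map_over C k U V i"
  and chain_p: "chain_map_over C f V W p" and short_exact_ip: "short_exact C (i n) (p n)"
  using cover HomD[OF k] by (auto simp: covering_def)

lemmas dU = projective_resolutionD(2)[OF res_U] and dV = projective_resolutionD(2)[OF res_V]
  and dW = projective_resolutionD(2)[OF res_W]

lemmas i_Hom = chain_map_overD(1)[OF chain_i] and p_Hom = chain_map_overD(1)[OF chain_p]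

lemma is_kernel_pi: "is_kernel C (p n) (i n)" and is_cokernel_ip: "is_cokernel C (i n) (p n)"
  using short_exact_ip by (auto simp: short_exact_def)

text \<open>The retractions exist degree by degree and need not form a chain map, so the homology of
  \<open>V\<close> does not split along with them.\<close>

lemma i_retraction: "\<exists>r \<in> Hom C (Rob V n) (Rob U n). r \<bullet> i n = Id C (Rob U n)"
  using short_exact_split[OF short_exact_ip i_Hom p_Hom projective_resolutionD(1)[OF res_W]] .

lemma Fmap_i_inj:
  "\<lbrakk>x \<in> carrier (Fob T (Rob U n)); y \<in> carrier (Fob T (Rob U n)); Fmap T (i n) x = Fmap T (i n) y\<rbrakk>
    \<Longrightarrow> x = y"
  using i_retraction Fmap_split_inj[OF i_Hom] by metis

lemma Fmap_p_surj:
  assumes "w \<in> carrier (Fob T (Rob W n))"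
  obtains v where "v \<in> carrier (Fob T (Rob V n))" "Fmap T (p n) v = w"
  using right_exact[OF i_Hom p_Hom short_exact_ip, of n] assms that by (metis imageE)

lemma Fmap_p_kernel:
  assumes "v \<in> carrier (Fob T (Rob V n))" "Fmap T (p n) v = \<one>\<^bsub>Fob T (Rob W n)\<^esub>"
  obtains u where "u \<in> carrier (Fob T (Rob U n))" "Fmap T (i n) u = v"
proof -
  have "v \<in> kernel (Fob T (Rob V n)) (Fob T (Rob W n)) (Fmap T (p n))"
    using assms by (simp add: kernel_def)
  then show ?thesis
    using right_exact[OF i_Hom p_Hom short_exact_ip, of n] that by (metis imageE)
qed

lemma Fmap_p_i:
  "u \<in> carrier (Fob T (Rob U n)) \<Longrightarrow> Fmap T (p n) (Fmap T (i n) u) = \<one>\<^bsub>Fob T (Rob W n)\<^esub>"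
  using Fmap_Comp_Zero[OF i_Hom p_Hom is_kernel_Comp[OF is_kernel_pi i_Hom p_Hom]] .

text \<open>The snake construction as a relation between representatives. It is many-valued because
  \<open>v\<close> is free; this lets additivity be shown with any witnesses and leaves uniqueness
  as a statement about classes.\<close>

definition connects :: "nat \<Rightarrow> 't \<Rightarrow> 't \<Rightarrow> bool" where
  "connects n w u \<longleftrightarrow> u \<in> carrier (Fob T (Rob U n)) \<and>
     (\<exists>v \<in> carrier (Fob T (Rob V (Suc n))).
        Fmap T (p (Suc n)) v = w \<and> Fmap T (Rdiff V (Suc n)) v = Fmap T (i n) u)"

lemma connects_exists:
  assumes "w \<in> cycles T W (Suc n)"
  shows "\<exists>u. connects n w u"
proof -
  note w = cyclesD[OF assms]
  obtain v where v: "v \<in> carrier (Fob T (Rob V (Suc n)))" "Fmap T (p (Suc n)) v = w"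
    using Fmap_p_surj[OF w(1)] .
  have "Fmap T (p n) (Fmap T (Rdiff V (Suc n)) v) = \<one>\<^bsub>Fob T (Rob W n)\<^esub>"
    using chain_map_diff[OF res_V res_W chain_p v(1)] v(2) w(2) by simp
  then obtain u where "u \<in> carrier (Fob T (Rob U n))" "Fmap T (i n) u = Fmap T (Rdiff V (Suc n)) v"
    using Fmap_p_kernel[OF Fmap_closed[OF dV v(1)]] by blast
  with v show ?thesis
    unfolding connects_def by metis
qed

text \<open>\<open>Ti\<close> is injective one degree lower, and it sends \<open>Td(u)\<close> to
  \<open>Td(Td(v))\<close>, which is the unit.\<close>

lemma connects_cycles:
  assumes "connects n w u"
  shows "u \<in> cycles T U n"
proof -
  obtain v where u: "u \<in> carrier (Fob T (Rob U n))" and v: "v \<in> carrier (Fob T (Rob V (Suc n)))"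
      "Fmap T (Rdiff V (Suc n)) v = Fmap T (i n) u"
    using assms unfolding connects_def by blast
  show ?thesis
  proof (rule cyclesI[OF u])
    fix m assume m: "n = Suc m"
    have u': "u \<in> carrier (Fob T (Rob U (Suc m)))"
      using u m by simp
    have "Fmap T (i m) (Fmap T (Rdiff U (Suc m)) u) = \<one>\<^bsub>Fob T (Rob V m)\<^esub>"
      using chain_map_diff[OF res_U res_V chain_i u'] v Fmap_diff_diff[OF res_V, of v m] m by simp
    then show "Fmap T (Rdiff U (Suc m)) u = \<one>\<^bsub>Fob T (Rob U m)\<^esub>"
      using Fmap_i_inj[OF Fmap_closed[OF dU u'] Fob_one_closed[OF Rob_in_Obj[OF res_U]]]
        Fmap_one[OF i_Hom] by simp
  qed
qed

lemma connects_mult: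
  assumes "connects n w u" "connects n w' u'"
  shows "connects n (w \<otimes>\<^bsub>Fob T (Rob W (Suc n))\<^esub> w') (u \<otimes>\<^bsub>Fob T (Rob U n)\<^esub> u')"
proof -
  obtain v where v: "u \<in> carrier (Fob T (Rob U n))" "v \<in> carrier (Fob T (Rob V (Suc n)))"
      "Fmap T (p (Suc n)) v = w" "Fmap T (Rdiff V (Suc n)) v = Fmap T (i n) u"
    using assms(1) unfolding connects_def by blast
  obtain v' where v': "u' \<in> carrier (Fob T (Rob U n))" "v' \<in> carrier (Fob T (Rob V (Suc n)))"
      "Fmap T (p (Suc n)) v' = w'" "Fmap T (Rdiff V (Suc n)) v' = Fmap T (i n) u'"
    using assms(2) unfolding connects_def by blast
  show ?thesis
    unfolding connects_def
    using v v' Fob_mult_closed[OF Rob_in_Obj[OF res_U]] Fob_mult_closed[OF Rob_in_Obj[OF res_V]]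
      Fmap_mult[OF i_Hom v(1) v'(1)] Fmap_mult[OF p_Hom v(2) v'(2)] Fmap_mult[OF dV v(2) v'(2)]
    by (intro conjI bexI[of _ "v \<otimes>\<^bsub>Fob T (Rob V (Suc n))\<^esub> v'"]) simp_all
qed

text \<open>The witness is \<open>Ti(y)\<close>, which \<open>Tp\<close> kills. Together with
  \<open>connects_one\<close> this measures the indeterminacy of the snake: over the unit its
  results are exactly the boundaries.\<close>

lemma connects_boundary:
  assumes "y \<in> carrier (Fob T (Rob U (Suc n)))"
  shows "connects n \<one>\<^bsub>Fob T (Rob W (Suc n))\<^esub> (Fmap T (Rdiff U (Suc n)) y)"
  unfolding connects_def
  using Fmap_closed[OF dU assms] Fmap_closed[OF i_Hom assms] Fmap_p_i[OF assms]
    chain_map_diff[OF res_U res_V chain_i assms] by blast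

lemma connects_Fmap_p:
  assumes "v \<in> carrier (Fob T (Rob V (Suc n)))" "Fmap T (Rdiff V (Suc n)) v = \<one>\<^bsub>Fob T (Rob V n)\<^esub>"
  shows "connects n (Fmap T (p (Suc n)) v) \<one>\<^bsub>Fob T (Rob U n)\<^esub>"
  unfolding connects_def using Fob_one_closed[OF Rob_in_Obj[OF res_U]] assms Fmap_one[OF i_Hom] by auto

lemma connects_one:
  assumes "connects n \<one>\<^bsub>Fob T (Rob W (Suc n))\<^esub> u"
  shows "u \<in> boundaries T U n"
proof -
  obtain v where v: "u \<in> carrier (Fob T (Rob U n))" "v \<in> carrier (Fob T (Rob V (Suc n)))"
      "Fmap T (p (Suc n)) v = \<one>\<^bsub>Fob T (Rob W (Suc n))\<^esub>" "Fmap T (Rdiff V (Suc n)) v = Fmap T (i n) u"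
    using assms unfolding connects_def by blast
  obtain y where y: "y \<in> carrier (Fob T (Rob U (Suc n)))" "Fmap T (i (Suc n)) y = v"
    using Fmap_p_kernel[OF v(2,3)] .
  have "u = Fmap T (Rdiff U (Suc n)) y"
    using Fmap_i_inj[OF v(1) Fmap_closed[OF dU y(1)]] chain_map_diff[OF res_U res_V chain_i y(1)] y v
    by simp
  with y show ?thesis
    by (simp add: boundaries_def)
qed

text \<open>The quotient \<open>z\<close> of the two witnesses lies over a boundary
  \<open>Td(b)\<close>. Dividing \<open>z\<close> by \<open>Td(c)\<close>, for a lift
  \<open>c\<close> of \<open>b\<close>, gives a witness \<open>x\<close> over the unit with the same
  differential. So the unit is related to the quotient \<open>y\<close> of \<open>u\<close> and
  \<open>u'\<close>, which is then a boundary by \<open>connects_one\<close>.\<close>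

lemma connects_unique:
  assumes "connects n w u" "connects n w' u'" "w \<in> carrier (Fob T (Rob W (Suc n)))"
    "w' \<in> carrier (Fob T (Rob W (Suc n)))" "homology_class T W (Suc n) w = homology_class T W (Suc n) w'"
  shows "homology_class T U n u = homology_class T U n u'"
proof -
  interpret GU: comm_group "Fob T (Rob U n)"
    using Fob_Rob_comm_group[OF res_U] .
  interpret GV: comm_group "Fob T (Rob V (Suc n))"
    using Fob_Rob_comm_group[OF res_V] .
  interpret GW: comm_group "Fob T (Rob W (Suc n))"
    using Fob_Rob_comm_group[OF res_W] .
  obtain b where b: "b \<in> carrier (Fob T (Rob W (Suc (Suc n))))"
      "w = Fmap T (Rdiff W (Suc (Suc n))) b \<otimes>\<^bsub>Fob T (Rob W (Suc n))\<^esub> w'"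
    using homology_class_eq_iff[OF res_W assms(3,4)] assms(5) by blast
  obtain v where v: "u \<in> carrier (Fob T (Rob U n))" "v \<in> carrier (Fob T (Rob V (Suc n)))"
      "Fmap T (p (Suc n)) v = w" "Fmap T (Rdiff V (Suc n)) v = Fmap T (i n) u"
    using assms(1) unfolding connects_def by blast
  obtain v' where v': "u' \<in> carrier (Fob T (Rob U n))" "v' \<in> carrier (Fob T (Rob V (Suc n)))"
      "Fmap T (p (Suc n)) v' = w'" "Fmap T (Rdiff V (Suc n)) v' = Fmap T (i n) u'"
    using assms(2) unfolding connects_def by blast
  obtain z where z: "z \<in> carrier (Fob T (Rob V (Suc n)))" "v = z \<otimes>\<^bsub>Fob T (Rob V (Suc n))\<^esub> v'"
    using GV.ex_mult_eq[OF v(2) v'(2)] by blast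
  obtain y where y: "y \<in> carrier (Fob T (Rob U n))" "u = y \<otimes>\<^bsub>Fob T (Rob U n)\<^esub> u'"
    using GU.ex_mult_eq[OF v(1) v'(1)] by blast
  note pz = Fmap_closed[OF p_Hom z(1)] and db = Fmap_closed[OF dW b(1)]
  have "Fmap T (p (Suc n)) z = Fmap T (Rdiff W (Suc (Suc n))) b"
    using Fmap_mult[OF p_Hom z(1) v'(2)] z(2) v(3) v'(3) b(2) GW.right_cancel[OF assms(4) pz db] by metis
  moreover have "Fmap T (Rdiff V (Suc n)) z = Fmap T (i n) y"
  proof -
    interpret G: comm_group "Fob T (Rob V n)"
      using Fob_Rob_comm_group[OF res_V] .
    show ?thesis
      using Fmap_mult[OF dV z(1) v'(2)] z(2) v(4) v'(4) Fmap_mult[OF i_Hom y(1) v'(1)] y(2)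
        G.right_cancel[OF Fmap_closed[OF i_Hom v'(1)] Fmap_closed[OF dV z(1)] Fmap_closed[OF i_Hom y(1)]]
      by metis
  qed
  moreover obtain c where c: "c \<in> carrier (Fob T (Rob V (Suc (Suc n))))" "Fmap T (p (Suc (Suc n))) c = b"
    using Fmap_p_surj[OF b(1)] .
  obtain x where x: "x \<in> carrier (Fob T (Rob V (Suc n)))"
      "z = x \<otimes>\<^bsub>Fob T (Rob V (Suc n))\<^esub> Fmap T (Rdiff V (Suc (Suc n))) c"
    using GV.ex_mult_eq[OF z(1) Fmap_closed[OF dV c(1)]] by blast
  note dc = Fmap_closed[OF dV c(1)]
  have pdc: "Fmap T (p (Suc n)) (Fmap T (Rdiff V (Suc (Suc n))) c) = Fmap T (Rdiff W (Suc (Suc n))) b"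
    using chain_map_diff[OF res_V res_W chain_p c(1)] c(2) by simp
  ultimately have "Fmap T (p (Suc n)) x = \<one>\<^bsub>Fob T (Rob W (Suc n))\<^esub>"
    using Fmap_mult[OF p_Hom x(1) dc] x(2) pdc GW.r_cancel_one'[OF db Fmap_closed[OF p_Hom x(1)]] by metis
  moreover have "Fmap T (Rdiff V (Suc n)) x = Fmap T (i n) y"
    using Fmap_mult[OF dV x(1) dc] x(2) Fmap_diff_diff[OF res_V c(1)]
      Fob_r_one[OF Rob_in_Obj[OF res_V] Fmap_closed[OF dV x(1)]] \<open>Fmap T (Rdiff V (Suc n)) z = Fmap T (i n) y\<close>
    by simp
  ultimately have "connects n \<one>\<^bsub>Fob T (Rob W (Suc n))\<^esub> y"
    unfolding connects_def using y(1) x(1) by blast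
  then show ?thesis
    using connects_one y(2) homology_class_eq_iff[OF res_U v(1) v'(1)] by (auto simp: boundaries_def)
qed

text \<open>One run of the snake determines the value: all results lie in one coset by
  \<open>connects_unique\<close>, and multiplication by the results from
  \<open>connects_boundary\<close> reaches every element of it.\<close>

lemma LDer_conn_class:
  assumes "w \<in> cycles T W (Suc n)" "connects n w u"
  shows "LDer_conn C T P n k f (homology_class T W (Suc n) w) = homology_class T U n u"
proof -
  note w = cyclesD(1)[OF assms(1)] and u = cyclesD(1)[OF connects_cycles[OF assms(2)]]
  have "LDer_conn C T P n k f (homology_class T W (Suc n) w) =
      {u. \<exists>w' \<in> homology_class T W (Suc n) w. connects n w' u}"
    unfolding LDer_conn_def connects_def using chosen HomD[OF k] by auto
  also have "\<dots> = homology_class T U n u"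
  proof (intro equalityI subsetI)
    fix u' assume "u' \<in> {u. \<exists>w' \<in> homology_class T W (Suc n) w. connects n w' u}"
    then obtain w' where w': "w' \<in> homology_class T W (Suc n) w" "connects n w' u'"
      by blast
    then have "homology_class T U n u' = homology_class T U n u"
      using connects_unique[OF w'(2) assms(2) _ w] homology_class_mem_iff[OF res_W w] by blast
    then show "u' \<in> homology_class T U n u"
      using homology_class_mem_iff[OF res_U u] cyclesD(1)[OF connects_cycles[OF w'(2)]] by blast
  next
    fix u' assume "u' \<in> homology_class T U n u"
    then obtain b where b: "b \<in> carrier (Fob T (Rob U (Suc n)))"
        "u' = Fmap T (Rdiff U (Suc n)) b \<otimes>\<^bsub>Fob T (Rob U n)\<^esub> u"
      using homology_class_mem_iff[OF res_U u] homology_class_eq_iff[OF res_U _ u] by blast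
    then have "connects n w u'"
      using connects_mult[OF connects_boundary[OF b(1)] assms(2)] Fob_l_one[OF Rob_in_Obj[OF res_W] w]
      by simp
    then show "u' \<in> {u. \<exists>w' \<in> homology_class T W (Suc n) w. connects n w' u}"
      using homology_class_mem_iff[OF res_W w] w by blast
  qed
  finally show ?thesis .
qed

section \<open>Exactness on representatives, with \<open>V\<close> as the middle term\<close>

lemma exact_at_U:
  assumes "u \<in> cycles T U n"
    "homology_class T V n (Fmap T (i n) u) = homology_class T V n \<one>\<^bsub>Fob T (Rob V n)\<^esub>"
  obtains w where "w \<in> cycles T W (Suc n)" "connects n w u"
proof -
  note u = cyclesD(1)[OF assms(1)]
  note oV = Rob_in_Obj[OF res_V]
  obtain v where v: "v \<in> carrier (Fob T (Rob V (Suc n)))" "Fmap T (i n) u = Fmap T (Rdiff V (Suc n)) v"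
    using homology_class_eq_iff[OF res_V Fmap_closed[OF i_Hom u] Fob_one_closed[OF oV]] assms(2)
      Fob_r_one[OF oV Fmap_closed[OF dV]] by auto
  \<comment> \<open>The required cycle is \<open>Tp(v)\<close> for a \<open>v\<close> with
    \<open>Td(v) = Ti(u)\<close>; its differential is \<open>Tp(Ti(u))\<close>, the unit.\<close>
  have "Fmap T (p (Suc n)) v \<in> cycles T W (Suc n)"
    using chain_map_diff[OF res_V res_W chain_p v(1)] v(2) Fmap_p_i[OF u] Fmap_closed[OF p_Hom v(1)]
    by (auto intro: cyclesI)
  moreover have "connects n (Fmap T (p (Suc n)) v) u"
    unfolding connects_def using u v by metis
  ultimately show thesis
    by (rule that)
qed

lemma connects_class_i:
  assumes "connects n w u"
  shows "homology_class T V n (Fmap T (i n) u) = homology_class T V n \<one>\<^bsub>Fob T (Rob V n)\<^esub>"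
proof -
  note oV = Rob_in_Obj[OF res_V]
  obtain v where v: "u \<in> carrier (Fob T (Rob U n))" "v \<in> carrier (Fob T (Rob V (Suc n)))"
      "Fmap T (Rdiff V (Suc n)) v = Fmap T (i n) u"
    using assms unfolding connects_def by blast
  then show ?thesis
    using homology_class_eq_iff[OF res_V Fmap_closed[OF i_Hom v(1)] Fob_one_closed[OF oV]]
      Fob_r_one[OF oV Fmap_closed[OF dV v(2)]] by metis
qed

text \<open>If \<open>u = Td(y)\<close>, dividing the witness \<open>v\<close> by
  \<open>Ti(y)\<close> keeps its image under \<open>Tp\<close> and turns it into a cycle.\<close>

lemma exact_at_W:
  assumes "w \<in> cycles T W (Suc n)" "connects n w u"
    "homology_class T U n u = homology_class T U n \<one>\<^bsub>Fob T (Rob U n)\<^esub>"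
  obtains v where "v \<in> cycles T V (Suc n)" "Fmap T (p (Suc n)) v = w"
proof -
  note oU = Rob_in_Obj[OF res_U]
  interpret GV: comm_group "Fob T (Rob V (Suc n))"
    using Fob_Rob_comm_group[OF res_V] .
  interpret GV': comm_group "Fob T (Rob V n)"
    using Fob_Rob_comm_group[OF res_V] .
  obtain v where v: "u \<in> carrier (Fob T (Rob U n))" "v \<in> carrier (Fob T (Rob V (Suc n)))"
      "Fmap T (p (Suc n)) v = w" "Fmap T (Rdiff V (Suc n)) v = Fmap T (i n) u"
    using assms(2) unfolding connects_def by blast
  obtain y where y: "y \<in> carrier (Fob T (Rob U (Suc n)))" "u = Fmap T (Rdiff U (Suc n)) y"
    using homology_class_eq_iff[OF res_U v(1) Fob_one_closed[OF oU]] assms(3)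
      Fob_r_one[OF oU Fmap_closed[OF dU]] by auto
  note iy = Fmap_closed[OF i_Hom y(1)]
  obtain z where z: "z \<in> carrier (Fob T (Rob V (Suc n)))"
      "v = z \<otimes>\<^bsub>Fob T (Rob V (Suc n))\<^esub> Fmap T (i (Suc n)) y"
    using GV.ex_mult_eq[OF v(2) iy] by blast
  have "Fmap T (p (Suc n)) z = w"
    using Fmap_mult[OF p_Hom z(1) iy] z(2) v(3) Fmap_p_i[OF y(1)]
      Fob_r_one[OF Rob_in_Obj[OF res_W] Fmap_closed[OF p_Hom z(1)]] by simp
  moreover have "Fmap T (Rdiff V (Suc n)) z = \<one>\<^bsub>Fob T (Rob V n)\<^esub>"
    using Fmap_mult[OF dV z(1) iy] z(2) v(4) y(2) chain_map_diff[OF res_U res_V chain_i y(1)]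
      GV'.r_cancel_one'[OF Fmap_closed[OF dV iy] Fmap_closed[OF dV z(1)]] by metis
  ultimately show thesis
    using that z(1) by (auto intro: cyclesI)
qed

text \<open>Here \<open>Tp(v) = Td(b)\<close>. Dividing \<open>v\<close> by \<open>Td(c)\<close>,
  for a lift \<open>c\<close> of \<open>b\<close>, keeps its class and moves it into the kernel of
  \<open>Tp\<close>, that is, into the image of \<open>Ti\<close>. Injectivity of \<open>Ti\<close>
  one degree lower makes the preimage a cycle.\<close>

lemma exact_at_V:
  assumes "v \<in> cycles T V n"
    "homology_class T W n (Fmap T (p n) v) = homology_class T W n \<one>\<^bsub>Fob T (Rob W n)\<^esub>"
  obtains u where "u \<in> cycles T U n" "homology_class T V n v = homology_class T V n (Fmap T (i n) u)"
proof -
  note v = cyclesD[OF assms(1)]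
  note oW = Rob_in_Obj[OF res_W]
  interpret GV: comm_group "Fob T (Rob V n)"
    using Fob_Rob_comm_group[OF res_V] .
  interpret GW: comm_group "Fob T (Rob W n)"
    using Fob_Rob_comm_group[OF res_W] .
  obtain b where b: "b \<in> carrier (Fob T (Rob W (Suc n)))" "Fmap T (p n) v = Fmap T (Rdiff W (Suc n)) b"
    using homology_class_eq_iff[OF res_W Fmap_closed[OF p_Hom v(1)] Fob_one_closed[OF oW]] assms(2)
      Fob_r_one[OF oW Fmap_closed[OF dW]] by auto
  obtain c where c: "c \<in> carrier (Fob T (Rob V (Suc n)))" "Fmap T (p (Suc n)) c = b"
    using Fmap_p_surj[OF b(1)] .
  note dc = Fmap_closed[OF dV c(1)]
  obtain x where x: "x \<in> carrier (Fob T (Rob V n))" "v = x \<otimes>\<^bsub>Fob T (Rob V n)\<^esub> Fmap T (Rdiff V (Suc n)) c"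
    using GV.ex_mult_eq[OF v(1) dc] by blast
  have "Fmap T (p n) x = \<one>\<^bsub>Fob T (Rob W n)\<^esub>"
    using Fmap_mult[OF p_Hom x(1) dc] x(2) b(2) c(2) chain_map_diff[OF res_V res_W chain_p c(1)]
      GW.r_cancel_one'[OF Fmap_closed[OF p_Hom dc] Fmap_closed[OF p_Hom x(1)]] by metis
  then obtain u where u: "u \<in> carrier (Fob T (Rob U n))" "Fmap T (i n) u = x"
    using Fmap_p_kernel[OF x(1)] by blast
  have "u \<in> cycles T U n"
  proof (rule cyclesI[OF u(1)])
    fix m assume m: "n = Suc m"
    have u': "u \<in> carrier (Fob T (Rob U (Suc m)))" and x': "x \<in> carrier (Fob T (Rob V (Suc m)))"
      and dc': "Fmap T (Rdiff V (Suc n)) c \<in> carrier (Fob T (Rob V (Suc m)))"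
      and c': "c \<in> carrier (Fob T (Rob V (Suc (Suc m))))"
      using u(1) x(1) dc c(1) m by simp_all
    have "Fmap T (Rdiff V (Suc m)) x = \<one>\<^bsub>Fob T (Rob V m)\<^esub>"
      using Fmap_mult[OF dV x' dc'] x(2) v(2)[OF m] Fmap_diff_diff[OF res_V c'] m
        Fob_r_one[OF Rob_in_Obj[OF res_V] Fmap_closed[OF dV x']] by simp
    then have "Fmap T (i m) (Fmap T (Rdiff U (Suc m)) u) = Fmap T (i m) \<one>\<^bsub>Fob T (Rob U m)\<^esub>"
      using chain_map_diff[OF res_U res_V chain_i u'] u(2) m Fmap_one[OF i_Hom] by simp
    then show "Fmap T (Rdiff U (Suc m)) u = \<one>\<^bsub>Fob T (Rob U m)\<^esub>"
      using Fmap_i_inj[OF Fmap_closed[OF dU u'] Fob_one_closed[OF Rob_in_Obj[OF res_U]]] by blast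
  qed
  moreover have "homology_class T V n v = homology_class T V n (Fmap T (i n) u)"
    using homology_class_eq_iff[OF res_V v(1) Fmap_closed[OF i_Hom u(1)]] x u(2) c(1)
      GV.m_comm[OF x(1) dc] by blast
  ultimately show thesis
    by (rule that)
qed

text \<open>The middle term \<open>V\<close> of the covering is compared with \<open>P X\<close> through lifts \<open>\<theta>\<close>, \<open>\<eta>\<close> of the
  identity of \<open>X\<close>, which are mutually inverse on homology.\<close>

lemma LDer_long_exact:
  "long_exact (\<lambda>n. LDer T P n K) (\<lambda>n. LDer T P n X) (\<lambda>n. LDer T P n Y)
     (\<lambda>n. LDer_conn C T P n k f) (\<lambda>n. LDer_map C T P n k) (\<lambda>n. LDer_map C T P n f)"
proof -
  note oK = Hom_objs(1)[OF k] and oX = Hom_objs(2)[OF k] and oY = Hom_objs(2)[OF f]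
  note idX = Id_in_Hom[OF oX]
  let ?\<kappa> = "chain_lift C P k" and ?\<phi> = "chain_lift C P f"
  let ?clU = "homology_class T U" and ?clV = "homology_class T V"
    and ?clX = "homology_class T (P X)" and ?clW = "homology_class T W"
  note \<kappa> = chain_lift_over[OF k] and \<phi> = chain_lift_over[OF f]
  obtain \<theta> where \<theta>: "chain_map_over C (Id C X) V (P X) \<theta>"
    using chain_map_exists[OF res_V res_X idX] by blast
  obtain \<eta> where \<eta>: "chain_map_over C (Id C X) (P X) V \<eta>"
    using chain_map_exists[OF res_X res_V idX] by blast
  note \<theta>h = chain_map_overD(1)[OF \<theta>] and \<eta>h = chain_map_overD(1)[OF \<eta>]
  note \<theta>c = chain_map_cycles[OF res_V res_X \<theta>] and \<eta>c = chain_map_cycles[OF res_X res_V \<eta>]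
  note ic = chain_map_cycles[OF res_U res_V chain_i] and pc = chain_map_cycles[OF res_V res_W chain_p]
  note \<kappa>c = chain_map_cycles[OF res_U res_X \<kappa>] and \<phi>c = chain_map_cycles[OF res_X res_W \<phi>]
  note \<theta>cong = chain_map_class_cong[OF res_V res_X \<theta>] and \<eta>cong = chain_map_class_cong[OF res_X res_V \<eta>]
    and pcong = chain_map_class_cong[OF res_V res_W chain_p]
    and \<phi>cong = chain_map_class_cong[OF res_X res_W \<phi>]
  have one: "Fmap T (g n) \<one>\<^bsub>Fob T (Rob A n)\<^esub> = \<one>\<^bsub>Fob T (Rob B n)\<^esub>"
    if "chain_map_over C h A B g" for g h A B n
    using Fmap_one[OF chain_map_overD(1)[OF that]] .
  have closed_one: "\<one>\<^bsub>Fob T (Rob V n)\<^esub> \<in> carrier (Fob T (Rob V n))"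
    "\<one>\<^bsub>Fob T (Rob (P X) n)\<^esub> \<in> carrier (Fob T (Rob (P X) n))"
    "\<one>\<^bsub>Fob T (Rob W n)\<^esub> \<in> carrier (Fob T (Rob W n))" for n
    using Fob_one_closed Rob_in_Obj res_V res_X res_W by blast+
  \<comment> \<open>Both \<open>chain_lift C P k\<close> and the composite of \<open>i\<close> with
    \<open>\<theta>\<close> lift \<open>k\<close>, so they agree on homology. In the same way
    \<open>f\<close> acts as \<open>\<eta>\<close> followed by \<open>p\<close>.\<close>
  have \<kappa>_class: "?clX n (Fmap T (?\<kappa> n) u) = ?clX n (Fmap T (\<theta> n) (Fmap T (i n) u))"
    if u: "u \<in> cycles T U n" for n u
  proof -
    have c: "chain_map_over C k U (P X) (\<lambda>n. \<theta> n \<bullet> i n)"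
      using chain_map_Comp[OF chain_i \<theta> res_U res_V res_X k idX] Comp_Id_left[OF k] by simp
    show ?thesis
      using chain_map_class_unique[OF res_U res_X k \<kappa> c u] Fmap_Comp[OF i_Hom \<theta>h cyclesD(1)[OF u]] by simp
  qed
  have \<phi>_class: "?clW n (Fmap T (?\<phi> n) x) = ?clW n (Fmap T (p n) (Fmap T (\<eta> n) x))"
    if x: "x \<in> cycles T (P X) n" for n x
  proof -
    have c: "chain_map_over C f (P X) W (\<lambda>n. p n \<bullet> \<eta> n)"
      using chain_map_Comp[OF \<eta> chain_p res_X res_V res_W idX f] Comp_Id_right[OF f] by simp
    show ?thesis
      using chain_map_class_unique[OF res_X res_W f \<phi> c x] Fmap_Comp[OF \<eta>h p_Hom cyclesD(1)[OF x]] by simp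
  qed
  have \<eta>\<theta>: "?clV n (Fmap T (\<eta> n) (Fmap T (\<theta> n) v)) = ?clV n v" if v: "v \<in> cycles T V n" for n v
  proof -
    have c: "chain_map_over C (Id C X) V V (\<lambda>n. \<eta> n \<bullet> \<theta> n)"
      using chain_map_Comp[OF \<theta> \<eta> res_V res_X res_V idX idX] Comp_Id_left[OF idX] by simp
    show ?thesis
      using chain_map_class_unique[OF res_V res_V idX c chain_map_Id[OF res_V] v]
        Fmap_Comp[OF \<theta>h \<eta>h cyclesD(1)[OF v]] Fmap_Id[OF Rob_in_Obj[OF res_V] cyclesD(1)[OF v]] by simp
  qed
  have \<theta>\<eta>: "?clX n (Fmap T (\<theta> n) (Fmap T (\<eta> n) x)) = ?clX n x" if x: "x \<in> cycles T (P X) n" for n x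
  proof -
    have c: "chain_map_over C (Id C X) (P X) (P X) (\<lambda>n. \<theta> n \<bullet> \<eta> n)"
      using chain_map_Comp[OF \<eta> \<theta> res_X res_V res_X idX idX] Comp_Id_left[OF idX] by simp
    show ?thesis
      using chain_map_class_unique[OF res_X res_X idX c chain_map_Id[OF res_X] x]
        Fmap_Comp[OF \<eta>h \<theta>h cyclesD(1)[OF x]] Fmap_Id[OF Rob_in_Obj[OF res_X] cyclesD(1)[OF x]] by simp
  qed
  have \<phi>\<theta>: "?clW n (Fmap T (?\<phi> n) (Fmap T (\<theta> n) v)) = ?clW n (Fmap T (p n) v)"
    if v: "v \<in> cycles T V n" for n v
    using \<phi>_class[OF \<theta>c[OF v]] pcong[OF cyclesD(1)[OF \<eta>c[OF \<theta>c[OF v]]] cyclesD(1)[OF v] \<eta>\<theta>[OF v]]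
    by simp
  have \<eta>\<kappa>: "?clV n (Fmap T (\<eta> n) (Fmap T (?\<kappa> n) u)) = ?clV n (Fmap T (i n) u)"
    if u: "u \<in> cycles T U n" for n u
    using \<eta>cong[OF cyclesD(1)[OF \<kappa>c[OF u]] cyclesD(1)[OF \<theta>c[OF ic[OF u]]] \<kappa>_class[OF u]] \<eta>\<theta>[OF ic[OF u]]
    by simp
  have conn_hom: "LDer_conn C T P n k f \<in> hom (LDer T P (Suc n) Y) (LDer T P n K)" for n
  proof (rule homI)
    show "LDer_conn C T P n k f c \<in> carrier (LDer T P n K)" if "c \<in> carrier (LDer T P (Suc n) Y)" for c
    proof -
      obtain w where w: "w \<in> cycles T W (Suc n)" "c = ?clW (Suc n) w"
        using \<open>c \<in> carrier _\<close> unfolding carrier_LDer[OF oY] by blast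
      obtain u where u: "connects n w u"
        using connects_exists[OF w(1)] by blast
      show ?thesis
        using LDer_conn_class[OF w(1) u] connects_cycles[OF u] w(2) carrier_LDer[OF oK] by simp
    qed
    fix c d assume "c \<in> carrier (LDer T P (Suc n) Y)" "d \<in> carrier (LDer T P (Suc n) Y)"
    then obtain w w' where w: "w \<in> cycles T W (Suc n)" "c = ?clW (Suc n) w"
      and w': "w' \<in> cycles T W (Suc n)" "d = ?clW (Suc n) w'"
      unfolding carrier_LDer[OF oY] by blast
    obtain u u' where u: "connects n w u" and u': "connects n w' u'"
      using connects_exists w(1) w'(1) by blast
    show "LDer_conn C T P n k f (c \<otimes>\<^bsub>LDer T P (Suc n) Y\<^esub> d)
        = LDer_conn C T P n k f c \<otimes>\<^bsub>LDer T P n K\<^esub> LDer_conn C T P n k f d"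
      using LDer_mult[OF oY w(1) w'(1)] LDer_mult[OF oK connects_cycles[OF u] connects_cycles[OF u']]
        LDer_conn_class[OF w(1) u] LDer_conn_class[OF w'(1) u'] w(2) w'(2)
        LDer_conn_class[OF mult_in_cycles[OF res_W w(1) w'(1)] connects_mult[OF u u']] by simp
  qed
  have "kernel (LDer T P n X) (LDer T P n Y) (LDer_map C T P n f)
      = LDer_map C T P n k ` carrier (LDer T P n K)" for n
  proof (intro equalityI subsetI)
    fix c assume "c \<in> kernel (LDer T P n X) (LDer T P n Y) (LDer_map C T P n f)"
    then have "c \<in> carrier (LDer T P n X)" and c1: "LDer_map C T P n f c = \<one>\<^bsub>LDer T P n Y\<^esub>"
      by (auto simp: kernel_def)
    then obtain x where x: "x \<in> cycles T (P X) n" "c = ?clX n x"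
      unfolding carrier_LDer[OF oX] by blast
    \<comment> \<open>The class is moved to \<open>V\<close> by \<open>\<eta>\<close>, where
      \<open>exact_at_V\<close> applies, and the answer is returned by
      \<open>\<theta>\<close>.\<close>
    have "?clW n (Fmap T (p n) (Fmap T (\<eta> n) x)) = ?clW n \<one>\<^bsub>Fob T (Rob W n)\<^esub>"
      using c1 LDer_map_class[OF f x(1)] x(2) LDer_one[OF oY] \<phi>_class[OF x(1)] by simp
    then obtain u where u: "u \<in> cycles T U n" "?clV n (Fmap T (\<eta> n) x) = ?clV n (Fmap T (i n) u)"
      using exact_at_V[OF \<eta>c[OF x(1)]] by blast
    have "c = ?clX n (Fmap T (?\<kappa> n) u)"
      using \<theta>cong[OF cyclesD(1)[OF \<eta>c[OF x(1)]] cyclesD(1)[OF ic[OF u(1)]] u(2)] \<theta>\<eta>[OF x(1)]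
        \<kappa>_class[OF u(1)] x(2) by simp
    then show "c \<in> LDer_map C T P n k ` carrier (LDer T P n K)"
      unfolding carrier_LDer[OF oK] using LDer_map_class[OF k u(1)] u(1) by blast
  next
    fix c assume "c \<in> LDer_map C T P n k ` carrier (LDer T P n K)"
    then obtain u where u: "u \<in> cycles T U n" "c = ?clX n (Fmap T (?\<kappa> n) u)"
      unfolding carrier_LDer[OF oK] using LDer_map_class[OF k] by auto
    have "?clW n (Fmap T (?\<phi> n) (Fmap T (?\<kappa> n) u)) = ?clW n (Fmap T (p n) (Fmap T (i n) u))"
      using \<phi>_class[OF \<kappa>c[OF u(1)]]
        pcong[OF cyclesD(1)[OF \<eta>c[OF \<kappa>c[OF u(1)]]] cyclesD(1)[OF ic[OF u(1)]] \<eta>\<kappa>[OF u(1)]] by simp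
    then have "LDer_map C T P n f c = \<one>\<^bsub>LDer T P n Y\<^esub>"
      using LDer_map_class[OF f \<kappa>c[OF u(1)]] u(2) LDer_one[OF oY] Fmap_p_i[OF cyclesD(1)[OF u(1)]] by simp
    then show "c \<in> kernel (LDer T P n X) (LDer T P n Y) (LDer_map C T P n f)"
      using u \<kappa>c carrier_LDer[OF oX] by (simp add: kernel_def)
  qed
  moreover have "kernel (LDer T P n K) (LDer T P n X) (LDer_map C T P n k)
      = LDer_conn C T P n k f ` carrier (LDer T P (Suc n) Y)" for n
  proof (intro equalityI subsetI)
    fix c assume "c \<in> kernel (LDer T P n K) (LDer T P n X) (LDer_map C T P n k)"
    then have "c \<in> carrier (LDer T P n K)" and c1: "LDer_map C T P n k c = \<one>\<^bsub>LDer T P n X\<^esub>"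
      by (auto simp: kernel_def)
    then obtain u where u: "u \<in> cycles T U n" "c = ?clU n u"
      unfolding carrier_LDer[OF oK] by blast
    have "?clX n (Fmap T (?\<kappa> n) u) = ?clX n \<one>\<^bsub>Fob T (Rob (P X) n)\<^esub>"
      using c1 LDer_map_class[OF k u(1)] u(2) LDer_one[OF oX] by simp
    then have "?clV n (Fmap T (\<eta> n) (Fmap T (?\<kappa> n) u)) = ?clV n \<one>\<^bsub>Fob T (Rob V n)\<^esub>"
      using \<eta>cong[OF cyclesD(1)[OF \<kappa>c[OF u(1)]] closed_one(2)] one[OF \<eta>] by simp
    then obtain w where "w \<in> cycles T W (Suc n)" "connects n w u"
      using exact_at_U[OF u(1)] \<eta>\<kappa>[OF u(1)] by metis
    then show "c \<in> LDer_conn C T P n k f ` carrier (LDer T P (Suc n) Y)"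
      unfolding carrier_LDer[OF oY] using LDer_conn_class u(2) by force
  next
    fix c assume "c \<in> LDer_conn C T P n k f ` carrier (LDer T P (Suc n) Y)"
    then obtain w where w: "w \<in> cycles T W (Suc n)" "c = LDer_conn C T P n k f (?clW (Suc n) w)"
      unfolding carrier_LDer[OF oY] by blast
    obtain u where u: "connects n w u"
      using connects_exists[OF w(1)] by blast
    note uc = connects_cycles[OF u]
    have c: "c = ?clU n u"
      using w LDer_conn_class[OF w(1) u] by simp
    have "?clX n (Fmap T (?\<kappa> n) u) = ?clX n \<one>\<^bsub>Fob T (Rob (P X) n)\<^esub>"
      using \<kappa>_class[OF uc] \<theta>cong[OF cyclesD(1)[OF ic[OF uc]] closed_one(1) connects_class_i[OF u]]
        one[OF \<theta>] by simp
    then show "c \<in> kernel (LDer T P n K) (LDer T P n X) (LDer_map C T P n k)"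
      using LDer_map_class[OF k uc] c LDer_one[OF oX] carrier_LDer[OF oK] uc by (simp add: kernel_def)
  qed
  moreover have "kernel (LDer T P (Suc n) Y) (LDer T P n K) (LDer_conn C T P n k f)
      = LDer_map C T P (Suc n) f ` carrier (LDer T P (Suc n) X)" for n
  proof (intro equalityI subsetI)
    fix c assume "c \<in> kernel (LDer T P (Suc n) Y) (LDer T P n K) (LDer_conn C T P n k f)"
    then have "c \<in> carrier (LDer T P (Suc n) Y)" and c1: "LDer_conn C T P n k f c = \<one>\<^bsub>LDer T P n K\<^esub>"
      by (auto simp: kernel_def)
    then obtain w where w: "w \<in> cycles T W (Suc n)" "c = ?clW (Suc n) w"
      unfolding carrier_LDer[OF oY] by blast
    obtain u where u: "connects n w u"
      using connects_exists[OF w(1)] by blast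
    obtain v where v: "v \<in> cycles T V (Suc n)" "Fmap T (p (Suc n)) v = w"
      using exact_at_W[OF w(1) u] LDer_conn_class[OF w(1) u] c1 w(2) LDer_one[OF oK] by metis
    then show "c \<in> LDer_map C T P (Suc n) f ` carrier (LDer T P (Suc n) X)"
      unfolding carrier_LDer[OF oX] using LDer_map_class[OF f \<theta>c[OF v(1)]] \<phi>\<theta>[OF v(1)] w(2) \<theta>c[OF v(1)]
      by force
  next
    fix c assume "c \<in> LDer_map C T P (Suc n) f ` carrier (LDer T P (Suc n) X)"
    then obtain x where x: "x \<in> cycles T (P X) (Suc n)" "c = LDer_map C T P (Suc n) f (?clX (Suc n) x)"
      unfolding carrier_LDer[OF oX] by blast
    let ?v = "Fmap T (\<eta> (Suc n)) x"
    note v = \<eta>c[OF x(1)]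
    have c: "c = ?clW (Suc n) (Fmap T (p (Suc n)) ?v)"
      using x(2) LDer_map_class[OF f x(1)] \<phi>_class[OF x(1)] by simp
    have "LDer_conn C T P n k f c = \<one>\<^bsub>LDer T P n K\<^esub>"
      using LDer_conn_class[OF pc[OF v] connects_Fmap_p[OF cyclesD(1)[OF v] cyclesD(2)[OF v refl]]] c
        LDer_one[OF oK] by simp
    then show "c \<in> kernel (LDer T P (Suc n) Y) (LDer T P n K) (LDer_conn C T P n k f)"
      using c pc[OF v] carrier_LDer[OF oY] by (simp add: kernel_def)
  qed
  moreover have "LDer_map C T P 0 f ` carrier (LDer T P 0 X) = carrier (LDer T P 0 Y)"
  proof (intro equalityI subsetI)
    fix c assume "c \<in> LDer_map C T P 0 f ` carrier (LDer T P 0 X)"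
    then show "c \<in> carrier (LDer T P 0 Y)"
      using LDer_map_hom[OF f] by (auto simp: hom_def)
  next
    fix c assume "c \<in> carrier (LDer T P 0 Y)"
    then obtain w where w: "w \<in> cycles T W 0" "c = ?clW 0 w"
      unfolding carrier_LDer[OF oY] by blast
    obtain v where v: "v \<in> carrier (Fob T (Rob V 0))" "Fmap T (p 0) v = w"
      using Fmap_p_surj[OF cyclesD(1)[OF w(1)]] .
    \<comment> \<open>In degree \<open>0\<close> every element is a cycle, so surjectivity of
      \<open>Tp\<close> is enough to end the sequence.\<close>
    have vc: "v \<in> cycles T V 0"
      using v(1) by (auto intro: cyclesI)
    show "c \<in> LDer_map C T P 0 f ` carrier (LDer T P 0 X)"
      unfolding carrier_LDer[OF oX] using LDer_map_class[OF f \<theta>c[OF vc]] \<phi>\<theta>[OF vc] w(2) v(2) \<theta>c[OF vc]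
      by force
  qed
  ultimately show ?thesis
    unfolding long_exact_iff
    using conn_hom LDer_map_hom[OF k] LDer_map_hom[OF f] LDer_comm_group oK oX oY by simp
qed

end

section \<open>Ext and the Yoneda isomorphism\<close>

definition cohomology_class ::
  "('o, 'm) additive_cat \<Rightarrow> ('o, 'm) resolution \<Rightarrow> nat \<Rightarrow> 'o \<Rightarrow> 'm \<Rightarrow> 'm set" where
  "cohomology_class C U n B x = coboundaries C U n B #>\<^bsub>HomG C (Rob U n) B\<^esub> x"

section \<open>Cocycles, coboundaries and their classes\<close>

context preadditive_category
begin

lemma precompose_group_hom:
  assumes "h \<in> Hom C A A'" "B \<in> Obj C"
  shows "group_hom (HomG C A' B) (HomG C A B) (\<lambda>x. x \<bullet> h)"
proof -
  have "(\<lambda>x. x \<bullet> h) \<in> hom (HomG C A' B) (HomG C A B)"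
    using Comp_in_Hom[OF assms(1)] Comp_Add_left[OF assms(1)] by (auto intro: homI)
  then show ?thesis
    using Hom_comm_group assms(2) Hom_objs[OF assms(1)]
    by (simp add: group_hom_def group_hom_axioms_def comm_group_def)
qed

lemma postcompose_group_hom:
  assumes "g \<in> Hom C B B'" "A \<in> Obj C"
  shows "group_hom (HomG C A B) (HomG C A B') (\<lambda>x. g \<bullet> x)"
proof -
  have "(\<lambda>x. g \<bullet> x) \<in> hom (HomG C A B) (HomG C A B')"
    using Comp_in_Hom[OF _ assms(1)] Comp_Add_right[OF _ _ assms(1)] by (auto intro: homI)
  then show ?thesis
    using Hom_comm_group assms(2) Hom_objs[OF assms(1)]
    by (simp add: group_hom_def group_hom_axioms_def comm_group_def)
qed

lemma cocyclesD:
  assumes "x \<in> cocycles C U n B"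
  shows "x \<in> Hom C (Rob U n) B" "x \<bullet> Rdiff U (Suc n) = Zero C (Rob U (Suc n)) B"
  using assms by (auto simp: cocycles_def)

lemma coboundaries_0: "coboundaries C U 0 B = {Zero C (Rob U 0) B}"
  and coboundaries_Suc:
    "coboundaries C U (Suc m) B = (\<lambda>y. y \<bullet> Rdiff U (Suc m)) ` Hom C (Rob U m) B"
  by (simp_all add: coboundaries_def)

context
  fixes M B :: 'o and U :: "('o, 'm) resolution" and n :: nat
  assumes U: "projective_resolution C M U" and B: "B \<in> Obj C"
begin

lemma HomG_Rob_comm_group: "comm_group (HomG C (Rob U n) B)"
  using Hom_comm_group B Hom_objs(1)[OF projective_resolutionD(2)[OF U]]
    Hom_objs(2)[OF projective_resolutionD(2)[OF U]] by blast

lemma subgroup_cocycles: "subgroup (cocycles C U n B) (HomG C (Rob U n) B)"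
proof -
  interpret group_hom "HomG C (Rob U n) B" "HomG C (Rob U (Suc n)) B" "\<lambda>x. x \<bullet> Rdiff U (Suc n)"
    using precompose_group_hom[OF projective_resolutionD(2)[OF U] B] .
  show ?thesis
    using subgroup_kernel by (simp add: cocycles_def kernel_def)
qed

lemma subgroup_coboundaries: "subgroup (coboundaries C U n B) (HomG C (Rob U n) B)"
proof (cases n)
  case 0
  then show ?thesis
    using group.triv_subgroup[OF comm_group.axioms(2)[OF HomG_Rob_comm_group]]
    by (simp add: coboundaries_0)
next
  case (Suc m)
  interpret group_hom "HomG C (Rob U m) B" "HomG C (Rob U (Suc m)) B" "\<lambda>x. x \<bullet> Rdiff U (Suc m)"
    using precompose_group_hom[OF projective_resolutionD(2)[OF U] B] .
  show ?thesis
    using img_is_subgroup by (simp add: coboundaries_Suc Suc)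
qed

lemma coboundaries_subset_cocycles: "coboundaries C U n B \<subseteq> cocycles C U n B"
proof (cases n)
  case 0
  then show ?thesis
    using subgroup.one_closed[OF subgroup_cocycles] by (simp add: coboundaries_0)
next
  case (Suc m)
  note d = projective_resolutionD(2)[OF U]
  have "y \<bullet> Rdiff U (Suc m) \<in> cocycles C U (Suc m) B" if y: "y \<in> Hom C (Rob U m) B" for y
    using Comp_in_Hom[OF d y] Comp_assoc[OF d d y] resolution_diff_diff[OF U] Comp_Zero_right[OF y]
      Hom_objs(1)[OF d] by (simp add: cocycles_def)
  then show ?thesis
    by (auto simp: coboundaries_Suc Suc)
qed

lemma cohomology_class_eq_iff:
  assumes "x \<in> Hom C (Rob U n) B" "y \<in> Hom C (Rob U n) B"
  shows "cohomology_class C U n B x = cohomology_class C U n B y \<longleftrightarrow>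
    (\<exists>b \<in> coboundaries C U n B. x = Add C b y)"
  using comm_group.rcos_eq_iff[OF HomG_Rob_comm_group subgroup_coboundaries] assms
  by (simp add: cohomology_class_def)

lemma cohomology_class_mem_iff:
  "y \<in> cohomology_class C U n B x \<longleftrightarrow> (\<exists>b \<in> coboundaries C U n B. y = Add C b x)"
  by (auto simp: cohomology_class_def r_coset_def)

end

end

section \<open>Ext groups and their maps on representatives\<close>

context derived_setting
begin

context
  fixes M B :: 'o and n :: nat
  assumes M: "M \<in> Obj C" and B: "B \<in> Obj C"
begin

lemma Ext_Fob:
  "Fob (Ext C P n M) B =
    (HomG C (Rob (P M) n) B)\<lparr>carrier := cocycles C (P M) n B\<rparr> Mod coboundaries C (P M) n B"
  by (simp add: Ext_def)

lemma Ext_comm_group: "comm_group (Fob (Ext C P n M) B)"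
  unfolding Ext_Fob
  using comm_group.comm_group_subquotient[OF HomG_Rob_comm_group subgroup_cocycles
      subgroup_coboundaries coboundaries_subset_cocycles] resolution[OF M] B by blast

lemma carrier_Ext:
  "carrier (Fob (Ext C P n M) B) = cohomology_class C (P M) n B ` cocycles C (P M) n B"
  unfolding Ext_Fob cohomology_class_def
  using comm_group.carrier_subquotient[OF HomG_Rob_comm_group[OF resolution[OF M] B]] .

lemma Ext_mult:
  assumes "x \<in> Hom C (Rob (P M) n) B" "y \<in> Hom C (Rob (P M) n) B"
  shows "cohomology_class C (P M) n B x \<otimes>\<^bsub>Fob (Ext C P n M) B\<^esub> cohomology_class C (P M) n B y =
    cohomology_class C (P M) n B (Add C x y)"
  unfolding Ext_Fob cohomology_class_def
  using comm_group.mult_subquotient[OF HomG_Rob_comm_group[OF resolution[OF M] B]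
      subgroup_coboundaries[OF resolution[OF M] B]] assms by simp

lemma Ext_one:
  "\<one>\<^bsub>Fob (Ext C P n M) B\<^esub> = cohomology_class C (P M) n B (Zero C (Rob (P M) n) B)"
  unfolding Ext_Fob cohomology_class_def
  using comm_group.one_subquotient[OF HomG_Rob_comm_group[OF resolution[OF M] B]]
    comm_group.rcos_one[OF HomG_Rob_comm_group[OF resolution[OF M] B]
      subgroup_coboundaries[OF resolution[OF M] B]] by simp

end

lemma Ext_Fmap_class:
  assumes M: "M \<in> Obj C" and g: "g \<in> Hom C B B'" and x: "x \<in> cocycles C (P M) n B"
  shows "g \<bullet> x \<in> cocycles C (P M) n B'"
    "Fmap (Ext C P n M) g (cohomology_class C (P M) n B x) = cohomology_class C (P M) n B' (g \<bullet> x)"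
proof -
  let ?U = "P M"
  note U = resolution[OF M] and o = Hom_objs[OF g]
  note d = projective_resolutionD(2)[OF U]
  note x' = cocyclesD[OF x]
  show "g \<bullet> x \<in> cocycles C ?U n B'"
    using Comp_in_Hom[OF x'(1) g] Comp_assoc[OF d x'(1) g] x'(2) Comp_Zero_right[OF g]
      Hom_objs(1)[OF d] by (simp add: cocycles_def)
  have "(\<lambda>x. g \<bullet> x) ` coboundaries C ?U n B \<subseteq> coboundaries C ?U n B'"
  proof (cases n)
    case 0
    then show ?thesis
      using Comp_Zero_right[OF g] Rob_in_Obj[OF U] by (simp add: coboundaries_0)
  next
    case (Suc m)
    have "g \<bullet> (y \<bullet> Rdiff ?U (Suc m)) \<in> coboundaries C ?U (Suc m) B'" if y: "y \<in> Hom C (Rob ?U m) B" for y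
      using Comp_assoc[OF d y g] Comp_in_Hom[OF y g] unfolding coboundaries_Suc by (metis imageI)
    then show ?thesis
      by (auto simp: Suc coboundaries_Suc)
  qed
  moreover interpret h: group_hom "HomG C (Rob ?U n) B" "HomG C (Rob ?U n) B'" "\<lambda>x. g \<bullet> x"
    using postcompose_group_hom[OF g Rob_in_Obj[OF U]] .
  have "(\<lambda>x. g \<bullet> x) \<in> hom ((HomG C (Rob ?U n) B)\<lparr>carrier := Hom C (Rob ?U n) B\<rparr>) (HomG C (Rob ?U n) B')"
    using h.homh by (simp add: hom_def)
  moreover have "coboundaries C ?U n B \<subseteq> Hom C (Rob ?U n) B"
    using subgroup.subset[OF subgroup_coboundaries[OF U o(1)]] by simp
  ultimately show "Fmap (Ext C P n M) g (cohomology_class C ?U n B x)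
      = cohomology_class C ?U n B' (g \<bullet> x)"
    using induced_rcos[OF subgroup_coboundaries[OF U o(1)] h.G.is_group
        subgroup_coboundaries[OF U o(2)] h.H.is_group _ _ _ x'(1)] HomD[OF g]
    unfolding cohomology_class_def Ext_def by simp
qed

lemma Ext_map_class:
  assumes f: "f \<in> Hom C M M'" and B: "B \<in> Obj C" and x: "x \<in> cocycles C (P M') n B"
  shows "x \<bullet> chain_lift C P f n \<in> cocycles C (P M) n B"
    "Ext_map C P n f B (cohomology_class C (P M') n B x) =
      cohomology_class C (P M) n B (x \<bullet> chain_lift C P f n)"
proof -
  let ?l = "chain_lift C P f"
  note M = resolution[OF Hom_objs(1)[OF f]] and M' = resolution[OF Hom_objs(2)[OF f]]
  note d = projective_resolutionD(2)[OF M] and d' = projective_resolutionD(2)[OF M']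
  note l = chain_map_overD[OF chain_lift_over[OF f]]
  note x' = cocyclesD[OF x]
  have "(x \<bullet> ?l n) \<bullet> Rdiff (P M) (Suc n) = Zero C (Rob (P M) (Suc n)) B"
    using Comp_assoc[OF d l(1) x'(1)] l(2)[of n] Comp_assoc[OF l(1) d' x'(1)] x'(2)
      Comp_Zero_left[OF l(1) B] by simp
  then show "x \<bullet> ?l n \<in> cocycles C (P M) n B"
    using Comp_in_Hom[OF l(1) x'(1)] by (simp add: cocycles_def)
  have "(\<lambda>x. x \<bullet> ?l n) ` coboundaries C (P M') n B \<subseteq> coboundaries C (P M) n B"
  proof (cases n)
    case 0
    then show ?thesis
      using Comp_Zero_left[OF l(1) B] by (simp add: coboundaries_0)
  next
    case (Suc m)
    have "(y \<bullet> Rdiff (P M') (Suc m)) \<bullet> ?l (Suc m) \<in> coboundaries C (P M) (Suc m) B"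
      if y: "y \<in> Hom C (Rob (P M') m) B" for y
    proof -
      have "(y \<bullet> Rdiff (P M') (Suc m)) \<bullet> ?l (Suc m) = (y \<bullet> ?l m) \<bullet> Rdiff (P M) (Suc m)"
        using Comp_assoc[OF l(1) d' y] Comp_assoc[OF d l(1) y] l(2)[of m] by simp
      then show ?thesis
        using Comp_in_Hom[OF l(1) y] unfolding coboundaries_Suc by (metis imageI)
    qed
    then show ?thesis
      by (auto simp: Suc coboundaries_Suc)
  qed
  moreover interpret h: group_hom "HomG C (Rob (P M') n) B" "HomG C (Rob (P M) n) B" "\<lambda>x. x \<bullet> ?l n"
    using precompose_group_hom[OF l(1) B] .
  have "(\<lambda>x. x \<bullet> ?l n) \<in> hom ((HomG C (Rob (P M') n) B)\<lparr>carrier := Hom C (Rob (P M') n) B\<rparr>)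
      (HomG C (Rob (P M) n) B)"
    using h.homh by (simp add: hom_def)
  moreover have "coboundaries C (P M') n B \<subseteq> Hom C (Rob (P M') n) B"
    using subgroup.subset[OF subgroup_coboundaries[OF M' B]] by simp
  ultimately show "Ext_map C P n f B (cohomology_class C (P M') n B x) =
      cohomology_class C (P M) n B (x \<bullet> ?l n)"
    using induced_rcos[OF subgroup_coboundaries[OF M' B] h.G.is_group
        subgroup_coboundaries[OF M B] h.H.is_group _ _ _ x'(1)] HomD[OF f]
    unfolding cohomology_class_def Ext_map_def by simp
qed

section \<open>Natural transformations as pairings with cycles, and the Yoneda isomorphism\<close>

definition pairing :: "nat \<Rightarrow> 'o \<Rightarrow> 't \<Rightarrow> 'o \<Rightarrow> 'm set \<Rightarrow> 't" where
  "pairing n M w = (\<lambda>B \<in> Obj C. \<lambda>c \<in> carrier (Fob (Ext C P n M) B). Fmap T (SOME x. x \<in> c) w)"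

context
  fixes M :: 'o and n :: nat
  assumes M: "M \<in> Obj C"
begin

text \<open>The representative picked in \<open>pairing\<close> differs from \<open>x\<close> by a
  coboundary \<open>b\<close>, and \<open>Tb(w)\<close> is the unit: in degree \<open>0\<close>
  because \<open>b\<close> is zero, above because \<open>b\<close> factors through the differential,
  which kills the cycle \<open>w\<close>.\<close>

lemma pairing_class:
  assumes B: "B \<in> Obj C" and x: "x \<in> cocycles C (P M) n B" and w: "w \<in> cycles T (P M) n"
  shows "pairing n M w B (cohomology_class C (P M) n B x) = Fmap T x w"
proof -
  let ?U = "P M" and ?c = "cohomology_class C (P M) n B x"
  note U = resolution[OF M]
  note d = projective_resolutionD(2)[OF U]
  note x' = cocyclesD[OF x] and w' = cyclesD[OF w]
  have x_c: "x \<in> ?c"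
    using group.rcos_self[OF comm_group.axioms(2)[OF HomG_Rob_comm_group[OF U B]] _
        subgroup_coboundaries[OF U B]] x'(1) by (simp add: cohomology_class_def)
  then have "(SOME y. y \<in> ?c) \<in> ?c"
    by (rule someI)
  then obtain b where b: "b \<in> coboundaries C ?U n B" "(SOME y. y \<in> ?c) = Add C b x"
    using cohomology_class_mem_iff[OF U B] by blast
  have bh: "b \<in> Hom C (Rob ?U n) B"
    using subgroup.mem_carrier[OF subgroup_coboundaries[OF U B] b(1)] by simp
  have "Fmap T b w = \<one>\<^bsub>Fob T B\<^esub>"
  proof (cases n)
    case 0
    then show ?thesis
      using b(1) Fmap_Zero[OF Rob_in_Obj[OF U] B w'(1)] by (simp add: coboundaries_0)
  next
    case (Suc m)
    then obtain y where y: "y \<in> Hom C (Rob ?U m) B" "b = y \<bullet> Rdiff ?U (Suc m)"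
      using b(1) by (auto simp: coboundaries_Suc)
    have "w \<in> carrier (Fob T (Rob ?U (Suc m)))"
      using w'(1) Suc by simp
    then show ?thesis
      using Fmap_Comp[OF d y(1)] y(2) w'(2)[OF Suc] Fmap_one[OF y(1)] by simp
  qed
  then have "Fmap T (Add C b x) w = Fmap T x w"
    using Fmap_Add[OF bh x'(1) w'(1)] Fob_l_one[OF B Fmap_closed[OF x'(1) w'(1)]] by simp
  then show ?thesis
    using b(2) B x carrier_Ext[OF M B] by (simp add: pairing_def)
qed

lemma pairing_nat_trans:
  assumes w: "w \<in> cycles T (P M) n"
  shows "pairing n M w \<in> nat_trans C (Ext C P n M) T"
proof -
  note U = resolution[OF M] and w' = cyclesD(1)[OF w]
  have "pairing n M w B \<in> hom (Fob (Ext C P n M) B) (Fob T B)" if B: "B \<in> Obj C" for B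
  proof (rule homI)
    show "pairing n M w B c \<in> carrier (Fob T B)" if "c \<in> carrier (Fob (Ext C P n M) B)" for c
      using that pairing_class[OF B _ w] Fmap_closed[OF cocyclesD(1) w'] carrier_Ext[OF M B] by auto
    fix c c' assume "c \<in> carrier (Fob (Ext C P n M) B)" "c' \<in> carrier (Fob (Ext C P n M) B)"
    then obtain x y where x: "x \<in> cocycles C (P M) n B" "c = cohomology_class C (P M) n B x"
      and y: "y \<in> cocycles C (P M) n B" "c' = cohomology_class C (P M) n B y"
      unfolding carrier_Ext[OF M B] by blast
    note x' = cocyclesD(1)[OF x(1)] and y' = cocyclesD(1)[OF y(1)]
    have "Add C x y \<in> cocycles C (P M) n B"
      using subgroup.m_closed[OF subgroup_cocycles[OF U B] x(1) y(1)] by simp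
    then show "pairing n M w B (c \<otimes>\<^bsub>Fob (Ext C P n M) B\<^esub> c')
        = pairing n M w B c \<otimes>\<^bsub>Fob T B\<^esub> pairing n M w B c'"
      using Ext_mult[OF M B x' y'] x y pairing_class[OF B _ w] Fmap_Add[OF x' y' w'] by simp
  qed
  moreover have "pairing n M w B \<in> extensional (carrier (Fob (Ext C P n M) B))" if "B \<in> Obj C" for B
    using that by (simp add: pairing_def)
  moreover have "pairing n M w (Cod C g) (Fmap (Ext C P n M) g c) = Fmap T g (pairing n M w (Dom C g) c)"
    if g: "g \<in> Arr C" and c: "c \<in> carrier (Fob (Ext C P n M) (Dom C g))" for g c
  proof -
    note gh = HomI[OF g]
    note o = Hom_objs[OF gh]
    obtain x where x: "x \<in> cocycles C (P M) n (Dom C g)" "c = cohomology_class C (P M) n (Dom C g) x"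
      using c unfolding carrier_Ext[OF M o(1)] by blast
    show ?thesis
      using Ext_Fmap_class[OF M gh x(1)] x(2) pairing_class[OF o(1) x(1) w]
        pairing_class[OF o(2) _ w] Fmap_Comp[OF cocyclesD(1)[OF x(1)] gh w'] by simp
  qed
  ultimately show ?thesis
    by (auto simp: nat_trans_def pairing_def)
qed

lemma nat_trans_eqI:
  assumes "\<sigma> \<in> nat_trans C (Ext C P n M) T" "\<tau> \<in> nat_trans C (Ext C P n M) T"
    "\<And>B x. B \<in> Obj C \<Longrightarrow> x \<in> cocycles C (P M) n B \<Longrightarrow>
      \<sigma> B (cohomology_class C (P M) n B x) = \<tau> B (cohomology_class C (P M) n B x)"
  shows "\<sigma> = \<tau>"
proof (rule extensionalityI[of _ "Obj C"])
  show "\<sigma> \<in> extensional (Obj C)" "\<tau> \<in> extensional (Obj C)"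
    using assms(1,2) by (simp_all add: nat_trans_def)
  fix B assume B: "B \<in> Obj C"
  show "\<sigma> B = \<tau> B"
  proof (rule extensionalityI[of _ "carrier (Fob (Ext C P n M) B)"])
    show "\<sigma> B \<in> extensional (carrier (Fob (Ext C P n M) B))"
      "\<tau> B \<in> extensional (carrier (Fob (Ext C P n M) B))"
      using assms(1,2) B by (simp_all add: nat_trans_def)
    show "\<sigma> B c = \<tau> B c" if "c \<in> carrier (Fob (Ext C P n M) B)" for c
      using that assms(3)[OF B] unfolding carrier_Ext[OF M B] by blast
  qed
qed

lemma cokernel_cocycle:
  assumes q: "is_cokernel C (Rdiff (P M) (Suc n)) q" "q \<in> Hom C (Rob (P M) n) Q"
  shows "q \<in> cocycles C (P M) n Q"
  using is_cokernel_Comp[OF q(1) projective_resolutionD(2)[OF resolution[OF M]] q(2)] q(2)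
  by (simp add: cocycles_def)

lemma nat_trans_pairing:
  assumes \<tau>: "\<tau> \<in> nat_trans C (Ext C P n M) T"
  obtains w where "w \<in> cycles T (P M) n" "\<tau> = pairing n M w"
proof -
  let ?U = "P M" and ?cl = "cohomology_class C (P M) n"
  note U = resolution[OF M]
  note d = projective_resolutionD(2)[OF U]
  have \<tau>_hom: "\<And>B. B \<in> Obj C \<Longrightarrow> \<tau> B \<in> hom (Fob (Ext C P n M) B) (Fob T B)"
    and \<tau>_nat: "\<And>g B B' c. g \<in> Hom C B B' \<Longrightarrow> c \<in> carrier (Fob (Ext C P n M) B) \<Longrightarrow>
      \<tau> B' (Fmap (Ext C P n M) g c) = Fmap T g (\<tau> B c)"
    using \<tau> HomD by (fastforce simp: nat_trans_def)+
  obtain q where q: "is_cokernel C (Rdiff ?U (Suc n)) q"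
    using ex_cokernel HomD[OF d] by blast
  obtain Q where qh: "q \<in> Hom C (Rob ?U n) Q"
    using is_cokernel_typed[OF q d] .
  note oQ = Hom_objs(2)[OF qh]
  note qc = cokernel_cocycle[OF q qh]
  have clq: "?cl Q q \<in> carrier (Fob (Ext C P n M) Q)"
    using qc carrier_Ext[OF M oQ] by blast
  have surj: "Fmap T q ` carrier (Fob T (Rob ?U n)) = carrier (Fob T Q)"
    using Fmap_cokernel(2)[OF _ d _ q qh] aug_exact[OF U, of n] aug_diff_in_Hom[OF U, of n] by simp
  have "\<tau> Q (?cl Q q) \<in> carrier (Fob T Q)"
    using hom_in_carrier[OF \<tau>_hom[OF oQ] clq] .
  then obtain w where w: "w \<in> carrier (Fob T (Rob ?U n))" "Fmap T q w = \<tau> Q (?cl Q q)"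
    using surj by (metis imageE)
  have \<tau>_value: "\<tau> B (?cl B x) = Fmap T x w" if B: "B \<in> Obj C" and x: "x \<in> cocycles C ?U n B" for B x
  proof -
    obtain u where u: "u \<in> Hom C Q B" "u \<bullet> q = x"
      using is_cokernel_factor[OF q d qh cocyclesD[OF x]] by blast
    then show ?thesis
      using Ext_Fmap_class(2)[OF M u(1) qc] \<tau>_nat[OF u(1) clq] w Fmap_Comp[OF qh u(1) w(1)] by simp
  qed
  have wc: "w \<in> cycles T ?U n"
  proof (rule cyclesI[OF w(1)])
    fix m assume m: "n = Suc m"
    note oU = Rob_in_Obj[OF U, of m]
    let ?d = "Rdiff ?U (Suc m)"
    \<comment> \<open>The differential, as a cochain with values in \<open>Rob ?U m\<close>, is the
      coboundary of the identity. Hence \<open>\<tau>\<close> sends its class to the unit, while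
      \<open>\<tau>_value\<close> evaluates that class to \<open>Td(w)\<close>; this is why
      \<open>w\<close> is a cycle.\<close>
    have db: "?d \<in> coboundaries C ?U n (Rob ?U m)"
      using Comp_Id_left[OF d] Id_in_Hom[OF oU] unfolding m coboundaries_Suc by (metis imageI)
    then have dc: "?d \<in> cocycles C ?U n (Rob ?U m)"
      using coboundaries_subset_cocycles[OF U oU] by blast
    have "?cl (Rob ?U m) ?d = \<one>\<^bsub>Fob (Ext C P n M) (Rob ?U m)\<^esub>"
      using cohomology_class_eq_iff[OF U oU cocyclesD(1)[OF dc] Zero_in_Hom[OF Rob_in_Obj[OF U] oU]]
        db Add_Zero_right[OF cocyclesD(1)[OF dc]] Ext_one[OF M oU] by metis
    then show "Fmap T ?d w = \<one>\<^bsub>Fob T (Rob ?U m)\<^esub>"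
      using \<tau>_value[OF oU dc] hom_one[OF \<tau>_hom[OF oU]] Ext_comm_group[OF M oU] Fob_group[OF oU]
      by (simp add: comm_group_def)
  qed
  have "\<tau> = pairing n M w"
    using nat_trans_eqI[OF \<tau> pairing_nat_trans[OF wc]] \<tau>_value pairing_class[OF _ _ wc] by simp
  with wc show thesis
    by (rule that)
qed

text \<open>With this parametrization, group laws on \<open>Nat\<close> and statements about
  precomposition become computations with cycles.\<close>

lemma carrier_Nat: "carrier (Nat C (Ext C P n M) T) = pairing n M ` cycles T (P M) n"
proof (intro equalityI subsetI)
  show "\<tau> \<in> pairing n M ` cycles T (P M) n" if "\<tau> \<in> carrier (Nat C (Ext C P n M) T)" for \<tau>
    using that nat_trans_pairing[of \<tau>] unfolding Nat_def by auto
  show "\<tau> \<in> carrier (Nat C (Ext C P n M) T)" if "\<tau> \<in> pairing n M ` cycles T (P M) n" for \<tau>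
    using that pairing_nat_trans unfolding Nat_def by auto
qed

text \<open>The value of the Yoneda map is a fibre of \<open>Tq\<close>, hence a coset of the kernel
  of \<open>Tq\<close>, and \<open>Fmap_cokernel\<close> identifies this kernel with the
  boundaries.\<close>

lemma Yoneda_pairing:
  assumes w: "w \<in> cycles T (P M) n"
  shows "Yoneda C T P n M (pairing n M w) = homology_class T (P M) n w"
proof -
  let ?U = "P M"
  note U = resolution[OF M] and w' = cyclesD(1)[OF w]
  note d = projective_resolutionD(2)[OF U]
  define q where "q = (SOME q. is_cokernel C (Rdiff ?U (Suc n)) q)"
  have q: "is_cokernel C (Rdiff ?U (Suc n)) q"
    unfolding q_def using someI_ex[OF ex_cokernel[OF HomD(1)[OF d]]] .
  obtain Q where qh: "q \<in> Hom C (Rob ?U n) Q"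
    using is_cokernel_typed[OF q d] .
  note oQ = Hom_objs(2)[OF qh]
  have ker: "kernel (Fob T (Rob ?U n)) (Fob T Q) (Fmap T q) = boundaries T ?U n"
    using Fmap_cokernel(1)[OF _ d _ q qh] aug_exact[OF U, of n] aug_diff_in_Hom[OF U, of n]
    by (simp add: boundaries_def)
  interpret G: comm_group "Fob T (Rob ?U n)"
    using Fob_Rob_comm_group[OF U] .
  interpret GQ: group "Fob T Q"
    using Fob_group[OF oQ] .
  have "Yoneda C T P n M (pairing n M w) = {u \<in> carrier (Fob T (Rob ?U n)). Fmap T q u = Fmap T q w}"
    using pairing_class[OF oQ cokernel_cocycle[OF q qh] w] HomD(3)[OF qh]
    unfolding Yoneda_def Let_def cohomology_class_def q_def[symmetric] by simp
  also have "\<dots> = homology_class T ?U n w"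
  proof (intro equalityI subsetI)
    fix u assume "u \<in> {u \<in> carrier (Fob T (Rob ?U n)). Fmap T q u = Fmap T q w}"
    then have u: "u \<in> carrier (Fob T (Rob ?U n))" "Fmap T q u = Fmap T q w"
      by auto
    obtain z where z: "z \<in> carrier (Fob T (Rob ?U n))" "u = z \<otimes>\<^bsub>Fob T (Rob ?U n)\<^esub> w"
      using G.ex_mult_eq[OF u(1) w'] by blast
    have "Fmap T q z = \<one>\<^bsub>Fob T Q\<^esub>"
      using Fmap_mult[OF qh z(1) w'] z(2) u(2)
        GQ.r_cancel_one'[OF Fmap_closed[OF qh w'] Fmap_closed[OF qh z(1)]] by metis
    then have "z \<in> boundaries T ?U n"
      using z(1) ker by (auto simp: kernel_def)
    then show "u \<in> homology_class T ?U n w"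
      using z(2) by (auto simp: homology_class_def r_coset_def)
  next
    fix u assume "u \<in> homology_class T ?U n w"
    then obtain z where z: "z \<in> boundaries T ?U n" "u = z \<otimes>\<^bsub>Fob T (Rob ?U n)\<^esub> w"
      by (auto simp: homology_class_def r_coset_def)
    then have zk: "z \<in> carrier (Fob T (Rob ?U n))" "Fmap T q z = \<one>\<^bsub>Fob T Q\<^esub>"
      unfolding ker[symmetric] kernel_def by auto
    then show "u \<in> {u \<in> carrier (Fob T (Rob ?U n)). Fmap T q u = Fmap T q w}"
      using z(2) w' Fmap_mult[OF qh zk(1) w'] Fmap_closed[OF qh w'] by simp
  qed
  finally show ?thesis .
qed

text \<open>The mirror image of \<open>pairing_class\<close>: there a cycle annihilates
  coboundaries, here a cocycle annihilates boundaries. It yields injectivity of the Yoneda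
  map.\<close>

lemma pairing_cong:
  assumes w: "w \<in> cycles T (P M) n" and w': "w' \<in> cycles T (P M) n"
    and eq: "homology_class T (P M) n w = homology_class T (P M) n w'"
  shows "pairing n M w = pairing n M w'"
proof (rule nat_trans_eqI[OF pairing_nat_trans[OF w] pairing_nat_trans[OF w']])
  fix B x assume B: "B \<in> Obj C" and x: "x \<in> cocycles C (P M) n B"
  let ?U = "P M"
  note U = resolution[OF M]
  note d = projective_resolutionD(2)[OF U]
  obtain b where b: "b \<in> carrier (Fob T (Rob ?U (Suc n)))"
      "w = Fmap T (Rdiff ?U (Suc n)) b \<otimes>\<^bsub>Fob T (Rob ?U n)\<^esub> w'"
    using homology_class_eq_iff[OF U cyclesD(1)[OF w] cyclesD(1)[OF w']] eq by blast
  note x' = cocyclesD[OF x] and w'c = cyclesD(1)[OF w']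
  have "Fmap T x w = Fmap T x w'"
    using b(2) Fmap_mult[OF x'(1) Fmap_closed[OF d b(1)] w'c] Fmap_Comp_Zero[OF d x'(1) x'(2) b(1)]
      Fob_l_one[OF B Fmap_closed[OF x'(1) w'c]] by simp
  then show "pairing n M w B (cohomology_class C ?U n B x) = pairing n M w' B (cohomology_class C ?U n B x)"
    using pairing_class[OF B x] w w' by simp
qed

lemma Nat_mult_pairing:
  assumes w: "w \<in> cycles T (P M) n" and w': "w' \<in> cycles T (P M) n"
  shows "pairing n M w \<otimes>\<^bsub>Nat C (Ext C P n M) T\<^esub> pairing n M w' =
    pairing n M (w \<otimes>\<^bsub>Fob T (Rob (P M) n)\<^esub> w')"
proof -
  note U = resolution[OF M]
  note ww = mult_in_cycles[OF U w w']
  have "pairing n M w B c \<otimes>\<^bsub>Fob T B\<^esub> pairing n M w' B c = pairing n M (w \<otimes>\<^bsub>Fob T (Rob (P M) n)\<^esub> w') B c"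
    if B: "B \<in> Obj C" and c: "c \<in> carrier (Fob (Ext C P n M) B)" for B c
  proof -
    obtain x where x: "x \<in> cocycles C (P M) n B" "c = cohomology_class C (P M) n B x"
      using c unfolding carrier_Ext[OF M B] by blast
    then show ?thesis
      using pairing_class[OF B x(1)] w w' ww
        Fmap_mult[OF cocyclesD(1)[OF x(1)] cyclesD(1)[OF w] cyclesD(1)[OF w']] by simp
  qed
  then show ?thesis
    by (auto simp: Nat_def fun_eq_iff restrict_def) (auto simp: pairing_def)
qed

lemma Nat_one_pairing:
  "\<one>\<^bsub>Nat C (Ext C P n M) T\<^esub> = pairing n M \<one>\<^bsub>Fob T (Rob (P M) n)\<^esub>"
proof -
  note U = resolution[OF M]
  have "pairing n M \<one>\<^bsub>Fob T (Rob (P M) n)\<^esub> B c = \<one>\<^bsub>Fob T B\<^esub>"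
    if B: "B \<in> Obj C" and c: "c \<in> carrier (Fob (Ext C P n M) B)" for B c
  proof -
    obtain x where x: "x \<in> cocycles C (P M) n B" "c = cohomology_class C (P M) n B x"
      using c unfolding carrier_Ext[OF M B] by blast
    then show ?thesis
      using pairing_class[OF B x(1) one_in_cycles[OF U]] Fmap_one[OF cocyclesD(1)[OF x(1)]] by simp
  qed
  then show ?thesis
    by (auto simp: Nat_def fun_eq_iff restrict_def) (auto simp: pairing_def)
qed

text \<open>Under the surjection \<open>pairing\<close> the operation of \<open>Nat\<close>
  corresponds to that of the group of cycles, so the axioms are inherited; in particular, inverse
  transformations come from inverse cycles.\<close>

lemma Nat_comm_group: "comm_group (Nat C (Ext C P n M) T)"
proof -
  let ?N = "Nat C (Ext C P n M) T" and ?Z = "cycles T (P M) n"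
  note U = resolution[OF M]
  interpret Z: comm_group "(Fob T (Rob (P M) n))\<lparr>carrier := ?Z\<rparr>"
    using comm_group.subgroup_is_comm_group[OF Fob_Rob_comm_group[OF U] subgroup_cycles[OF U]] .
  have m: "pairing n M w \<otimes>\<^bsub>?N\<^esub> pairing n M w' = pairing n M (w \<otimes>\<^bsub>Fob T (Rob (P M) n)\<^esub> w')"
    if "w \<in> ?Z" "w' \<in> ?Z" for w w'
    using Nat_mult_pairing that .
  have mc: "w \<otimes>\<^bsub>Fob T (Rob (P M) n)\<^esub> w' \<in> ?Z" if "w \<in> ?Z" "w' \<in> ?Z" for w w'
    using mult_in_cycles[OF U that] .
  show ?thesis
  proof (rule comm_groupI)
    show "x \<otimes>\<^bsub>?N\<^esub> y \<in> carrier ?N" if "x \<in> carrier ?N" "y \<in> carrier ?N" for x y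
      using that m mc unfolding carrier_Nat by auto
    show "\<one>\<^bsub>?N\<^esub> \<in> carrier ?N"
      using Nat_one_pairing one_in_cycles[OF U] unfolding carrier_Nat by blast
    show "x \<otimes>\<^bsub>?N\<^esub> y \<otimes>\<^bsub>?N\<^esub> z = x \<otimes>\<^bsub>?N\<^esub> (y \<otimes>\<^bsub>?N\<^esub> z)"
      if "x \<in> carrier ?N" "y \<in> carrier ?N" "z \<in> carrier ?N" for x y z
      using that m mc Z.m_assoc unfolding carrier_Nat by auto
    show "x \<otimes>\<^bsub>?N\<^esub> y = y \<otimes>\<^bsub>?N\<^esub> x" if "x \<in> carrier ?N" "y \<in> carrier ?N" for x y
      using that m Z.m_comm unfolding carrier_Nat by auto
    show "\<one>\<^bsub>?N\<^esub> \<otimes>\<^bsub>?N\<^esub> x = x" if "x \<in> carrier ?N" for x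
      using that m one_in_cycles[OF U] Z.l_one Nat_one_pairing unfolding carrier_Nat by auto
    show "\<exists>y \<in> carrier ?N. y \<otimes>\<^bsub>?N\<^esub> x = \<one>\<^bsub>?N\<^esub>" if x: "x \<in> carrier ?N" for x
    proof -
      obtain w where w: "w \<in> ?Z" "x = pairing n M w"
        using x unfolding carrier_Nat by blast
      obtain w' where "w' \<in> ?Z" "w' \<otimes>\<^bsub>Fob T (Rob (P M) n)\<^esub> w = \<one>\<^bsub>Fob T (Rob (P M) n)\<^esub>"
        using Z.l_inv_ex w(1) by auto
      then show ?thesis
        using m w Nat_one_pairing unfolding carrier_Nat by (metis imageI)
    qed
  qed
qed

lemma Yoneda_iso: "Yoneda C T P n M \<in> iso (Nat C (Ext C P n M) T) (LDer T P n M)"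
proof -
  let ?N = "Nat C (Ext C P n M) T"
  note U = resolution[OF M]
  have "Yoneda C T P n M \<in> hom ?N (LDer T P n M)"
  proof (rule homI)
    show "Yoneda C T P n M x \<in> carrier (LDer T P n M)" if "x \<in> carrier ?N" for x
      using that Yoneda_pairing unfolding carrier_Nat carrier_LDer[OF M] by auto
    show "Yoneda C T P n M (x \<otimes>\<^bsub>?N\<^esub> y) = Yoneda C T P n M x \<otimes>\<^bsub>LDer T P n M\<^esub> Yoneda C T P n M y"
      if "x \<in> carrier ?N" "y \<in> carrier ?N" for x y
      using that Yoneda_pairing Nat_mult_pairing LDer_mult[OF M] mult_in_cycles[OF U]
      unfolding carrier_Nat by auto
  qed
  moreover have "inj_on (Yoneda C T P n M) (carrier ?N)"
    unfolding carrier_Nat by (intro inj_onI) (auto simp: Yoneda_pairing intro: pairing_cong)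
  moreover have "Yoneda C T P n M ` carrier ?N = carrier (LDer T P n M)"
    unfolding carrier_Nat carrier_LDer[OF M] image_image using Yoneda_pairing by simp
  ultimately show ?thesis
    by (simp add: iso_iff)
qed

end

section \<open>Precomposition in terms of cycles\<close>

lemma precomp_pairing_eqI:
  assumes M: "M \<in> Obj C" and w: "w \<in> cycles T (P M) n"
    and val: "\<And>B x. B \<in> Obj C \<Longrightarrow> x \<in> cocycles C (P M) n B \<Longrightarrow>
      \<tau> B (\<phi> B (cohomology_class C (P M) n B x)) = Fmap T x w"
  shows "precomp C (Ext C P n M) \<phi> \<tau> = pairing n M w"
proof -
  have "\<tau> B (\<phi> B c) = pairing n M w B c" if B: "B \<in> Obj C" and c: "c \<in> carrier (Fob (Ext C P n M) B)" for B c
    using c val[OF B] pairing_class[OF M B _ w] unfolding carrier_Ext[OF M B] by auto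
  then show ?thesis
    by (auto simp: precomp_def fun_eq_iff restrict_def) (auto simp: pairing_def)
qed

lemma precomp_Ext_map:
  assumes f: "f \<in> Hom C M M'" and w: "w \<in> cycles T (P M) n"
  shows "precomp C (Ext C P n M') (Ext_map C P n f) (pairing n M w) =
    pairing n M' (Fmap T (chain_lift C P f n) w)"
proof -
  note o = Hom_objs[OF f]
  note l = chain_lift_over[OF f]
  have "pairing n M w B (Ext_map C P n f B (cohomology_class C (P M') n B x))
      = Fmap T x (Fmap T (chain_lift C P f n) w)"
    if B: "B \<in> Obj C" and x: "x \<in> cocycles C (P M') n B" for B x
    using Ext_map_class[OF f B x] pairing_class[OF o(1) B _ w]
      Fmap_Comp[OF chain_map_overD(1)[OF l] cocyclesD(1)[OF x] cyclesD(1)[OF w]] by simp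
  then show ?thesis
    using precomp_pairing_eqI[OF o(2) chain_map_cycles[OF resolution[OF o(1)] resolution[OF o(2)] l w]]
    by blast
qed

end

context ses_setting
begin

text \<open>The hypotheses record one run of the snake on the Hom side. The results of all other
  runs differ from \<open>y0\<close> by coboundaries, and every coboundary occurs, as in
  \<open>LDer_conn_class\<close>.\<close>

lemma Ext_conn_value:
  assumes B: "B \<in> Obj C" and x0: "x0 \<in> Hom C (Rob U n) B" and z0: "z0 \<in> Hom C (Rob V n) B"
    and y0: "y0 \<in> Hom C (Rob W (Suc n)) B"
    and zx: "z0 \<bullet> i n = x0" and zy: "z0 \<bullet> Rdiff V (Suc n) = y0 \<bullet> p (Suc n)"
  shows "Ext_conn C P n k f B (cohomology_class C U n B x0) = cohomology_class C W (Suc n) B y0"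
proof -
  have pd: "(s \<bullet> p n) \<bullet> Rdiff V (Suc n) = (s \<bullet> Rdiff W (Suc n)) \<bullet> p (Suc n)"
    if s: "s \<in> Hom C (Rob W n) B" for s
    using Comp_assoc[OF p_Hom dW s] Comp_assoc[OF dV p_Hom s] chain_map_overD(2)[OF chain_p] by simp
  \<comment> \<open>Changing the representative by a coboundary can be followed in \<open>V\<close>
    without affecting the differential: \<open>b = t \<bullet> d\<close> extends to
    \<open>t \<bullet> r \<bullet> d\<close>, where \<open>r\<close> retracts \<open>i m\<close> one
    degree lower, and this extension is killed by the next differential.\<close>
  have ext: "\<exists>z' \<in> Hom C (Rob V n) B. z' \<bullet> i n = b \<and> z' \<bullet> Rdiff V (Suc n) = Zero C (Rob V (Suc n)) B"
    if b: "b \<in> coboundaries C U n B" for b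
  proof (cases n)
    case 0
    then show ?thesis
      using b Zero_in_Hom[OF Rob_in_Obj[OF res_V] B] Comp_Zero_left[OF i_Hom B] Comp_Zero_left[OF dV B]
      by (auto simp: coboundaries_0)
  next
    case (Suc m)
    then obtain t where t: "t \<in> Hom C (Rob U m) B" "b = t \<bullet> Rdiff U (Suc m)"
      using b by (auto simp: coboundaries_Suc)
    obtain r where r: "r \<in> Hom C (Rob V m) (Rob U m)" "r \<bullet> i m = Id C (Rob U m)"
      using i_retraction by blast
    note tr = Comp_in_Hom[OF r(1) t(1)]
    have "(t \<bullet> r) \<bullet> Rdiff V (Suc m) \<bullet> i (Suc m) = ((t \<bullet> r) \<bullet> i m) \<bullet> Rdiff U (Suc m)"
      using Comp_assoc[OF i_Hom dV tr] Comp_assoc[OF dU i_Hom tr] chain_map_overD(2)[OF chain_i, of m] by simp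
    also have "(t \<bullet> r) \<bullet> i m = t"
      using Comp_assoc[OF i_Hom r(1) t(1)] r(2) Comp_Id_right[OF t(1)] by simp
    finally have "(t \<bullet> r) \<bullet> Rdiff V (Suc m) \<bullet> i (Suc m) = b"
      using t(2) by simp
    moreover have "(t \<bullet> r) \<bullet> Rdiff V (Suc m) \<bullet> Rdiff V (Suc (Suc m)) = Zero C (Rob V (Suc (Suc m))) B"
      using Comp_assoc[OF dV dV tr] resolution_diff_diff[OF res_V] Comp_Zero_right[OF tr]
        Rob_in_Obj[OF res_V] by simp
    ultimately show ?thesis
      using Comp_in_Hom[OF dV tr] Suc by blast
  qed
  have "Ext_conn C P n k f B (cohomology_class C U n B x0) =
      {y \<in> Hom C (Rob W (Suc n)) B. \<exists>x \<in> cohomology_class C U n B x0. \<exists>z \<in> Hom C (Rob V n) B.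
        z \<bullet> i n = x \<and> z \<bullet> Rdiff V (Suc n) = y \<bullet> p (Suc n)}"
    unfolding Ext_conn_def using chosen HomD[OF f] by simp
  also have "\<dots> = cohomology_class C W (Suc n) B y0"
  proof (intro equalityI subsetI)
    fix y assume "y \<in> {y \<in> Hom C (Rob W (Suc n)) B. \<exists>x \<in> cohomology_class C U n B x0.
        \<exists>z \<in> Hom C (Rob V n) B. z \<bullet> i n = x \<and> z \<bullet> Rdiff V (Suc n) = y \<bullet> p (Suc n)}"
    then obtain z where y: "y \<in> Hom C (Rob W (Suc n)) B" and z: "z \<in> Hom C (Rob V n) B"
        "z \<bullet> i n \<in> cohomology_class C U n B x0" "z \<bullet> Rdiff V (Suc n) = y \<bullet> p (Suc n)"
      by blast
    obtain b where b: "b \<in> coboundaries C U n B" "z \<bullet> i n = Add C b x0"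
      using z(2) cohomology_class_mem_iff[OF res_U B] by blast
    obtain z' where z': "z' \<in> Hom C (Rob V n) B" "z' \<bullet> i n = b"
        "z' \<bullet> Rdiff V (Suc n) = Zero C (Rob V (Suc n)) B"
      using ext[OF b(1)] by blast
    note zz = Add_in_Hom[OF z'(1) z0]
    \<comment> \<open>\<open>e\<close> is what remains of \<open>z\<close> after removal of
      \<open>z0\<close> and \<open>z'\<close>. It vanishes along \<open>i n\<close>, so it is
      \<open>s \<bullet> p n\<close>, and \<open>y\<close> differs from \<open>y0\<close> by the
      coboundary of \<open>s\<close>.\<close>
    obtain e where e: "e \<in> Hom C (Rob V n) B" "z = Add C e (Add C z' z0)"
      using ex_diff[OF z(1) zz] by blast
    have "Add C (e \<bullet> i n) (z \<bullet> i n) = z \<bullet> i n"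
      using Comp_Add_left[OF i_Hom e(1) zz] Comp_Add_left[OF i_Hom z'(1) z0] e(2) z'(2) zx b(2) by metis
    then have "e \<bullet> i n = Zero C (Rob U n) B"
      using Add_right_cancel_Zero[OF Comp_in_Hom[OF i_Hom e(1)] Comp_in_Hom[OF i_Hom z(1)]] by blast
    then obtain s where s: "s \<in> Hom C (Rob W n) B" "s \<bullet> p n = e"
      using is_cokernel_factor[OF is_cokernel_ip i_Hom p_Hom e(1)] by blast
    note sd = Comp_in_Hom[OF dW s(1)]
    have "y \<bullet> p (Suc n) = Add C (e \<bullet> Rdiff V (Suc n)) (z0 \<bullet> Rdiff V (Suc n))"
      using z(3) e(2) Comp_Add_left[OF dV e(1) zz] Comp_Add_left[OF dV z'(1) z0] z'(3)
        Add_Zero_left[OF Comp_in_Hom[OF dV z0]] by metis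
    also have "\<dots> = Add C (s \<bullet> Rdiff W (Suc n)) y0 \<bullet> p (Suc n)"
      using Comp_Add_left[OF p_Hom sd y0] pd[OF s(1)] s(2) zy by simp
    finally have "y = Add C (s \<bullet> Rdiff W (Suc n)) y0"
      using epi_arr_cancel[OF is_cokernel_epi[OF is_cokernel_ip] p_Hom y Add_in_Hom[OF sd y0]] by blast
    moreover have "s \<bullet> Rdiff W (Suc n) \<in> coboundaries C W (Suc n) B"
      using s(1) by (simp add: coboundaries_Suc)
    ultimately show "y \<in> cohomology_class C W (Suc n) B y0"
      using cohomology_class_mem_iff[OF res_W B] by blast
  next
    fix y assume "y \<in> cohomology_class C W (Suc n) B y0"
    then obtain b where b: "b \<in> coboundaries C W (Suc n) B" "y = Add C b y0"
      using cohomology_class_mem_iff[OF res_W B] by blast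
    obtain s where s: "s \<in> Hom C (Rob W n) B" "y = Add C (s \<bullet> Rdiff W (Suc n)) y0"
      using b by (auto simp: coboundaries_Suc)
    note sd = Comp_in_Hom[OF dW s(1)] and sp = Comp_in_Hom[OF p_Hom s(1)]
    have "(s \<bullet> p n) \<bullet> i n = Zero C (Rob U n) B"
      using Comp_assoc[OF i_Hom p_Hom s(1)] is_kernel_Comp[OF is_kernel_pi i_Hom p_Hom]
        Comp_Zero_right[OF s(1)] Rob_in_Obj[OF res_U] by simp
    \<comment> \<open>Adding \<open>s \<bullet> p n\<close> to \<open>z0\<close> keeps its
      restriction along \<open>i n\<close> and shifts the result by the coboundary of
      \<open>s\<close>.\<close>
    then have 1: "Add C (s \<bullet> p n) z0 \<bullet> i n = x0"
      using Comp_Add_left[OF i_Hom sp z0] zx Add_Zero_left[OF x0] by simp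
    have 2: "Add C (s \<bullet> p n) z0 \<bullet> Rdiff V (Suc n) = y \<bullet> p (Suc n)"
      using Comp_Add_left[OF dV sp z0] pd[OF s(1)] zy Comp_Add_left[OF p_Hom sd y0] s(2) by simp
    have "x0 \<in> cohomology_class C U n B x0"
      using group.rcos_self[OF comm_group.axioms(2)[OF HomG_Rob_comm_group[OF res_U B]] _
          subgroup_coboundaries[OF res_U B]] x0 by (simp add: cohomology_class_def)
    then show "y \<in> {y \<in> Hom C (Rob W (Suc n)) B. \<exists>x \<in> cohomology_class C U n B x0.
        \<exists>z \<in> Hom C (Rob V n) B. z \<bullet> i n = x \<and> z \<bullet> Rdiff V (Suc n) = y \<bullet> p (Suc n)}"
      using 1 2 Add_in_Hom[OF sp z0] Add_in_Hom[OF sd y0] s(2) by blast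
  qed
  finally show ?thesis .
qed

lemma precomp_Ext_conn:
  assumes w: "w \<in> cycles T W (Suc n)" and u: "connects n w u"
  shows "precomp C (Ext C P n K) (Ext_conn C P n k f) (pairing (Suc n) Y w) = pairing n K u"
proof (rule precomp_pairing_eqI[OF Hom_objs(1)[OF k] connects_cycles[OF u]])
  fix B x assume B: "B \<in> Obj C" and x: "x \<in> cocycles C U n B"
  note x' = cocyclesD[OF x]
  obtain r where r: "r \<in> Hom C (Rob V n) (Rob U n)" "r \<bullet> i n = Id C (Rob U n)"
    using i_retraction by blast
  \<comment> \<open>An explicit extension of \<open>x\<close> along \<open>i n\<close>. Since
    \<open>x\<close> is a cocycle, the differential of \<open>z\<close> vanishes along
    \<open>i (Suc n)\<close> and descends to a map \<open>y\<close> on \<open>W\<close>.\<close>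
  define z where "z = x \<bullet> r"
  have z: "z \<in> Hom C (Rob V n) B" "z \<bullet> i n = x"
    using Comp_in_Hom[OF r(1) x'(1)] Comp_assoc[OF i_Hom r(1) x'(1)] r(2) Comp_Id_right[OF x'(1)]
    by (simp_all add: z_def)
  note zd = Comp_in_Hom[OF dV z(1)]
  have "(z \<bullet> Rdiff V (Suc n)) \<bullet> i (Suc n) = Zero C (Rob U (Suc n)) B"
    using Comp_assoc[OF i_Hom dV z(1)] Comp_assoc[OF dU i_Hom z(1)] chain_map_overD(2)[OF chain_i, of n]
      z(2) x'(2) by simp
  then obtain y where y: "y \<in> Hom C (Rob W (Suc n)) B" "y \<bullet> p (Suc n) = z \<bullet> Rdiff V (Suc n)"
    using is_cokernel_factor[OF is_cokernel_ip i_Hom p_Hom zd] by blast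
  \<comment> \<open>That \<open>y\<close> is a cocycle is tested after composition with the next
    component of \<open>p\<close>, which is epi; there it becomes
    \<open>z \<bullet> d \<bullet> d\<close>.\<close>
  have "(y \<bullet> Rdiff W (Suc (Suc n))) \<bullet> p (Suc (Suc n)) = Zero C (Rob V (Suc (Suc n))) B"
    using Comp_assoc[OF p_Hom dW y(1)] Comp_assoc[OF dV p_Hom y(1)] y(2)
      chain_map_overD(2)[OF chain_p, of "Suc n"] Comp_assoc[OF dV dV z(1)] resolution_diff_diff[OF res_V]
      Comp_Zero_right[OF z(1)] Rob_in_Obj[OF res_V] by simp
  then have "y \<bullet> Rdiff W (Suc (Suc n)) = Zero C (Rob W (Suc (Suc n))) B"
    using epi_arr_cancel_Zero[OF is_cokernel_epi[OF is_cokernel_ip] p_Hom Comp_in_Hom[OF dW y(1)]] by blast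
  then have yc: "y \<in> cocycles C W (Suc n) B"
    using y(1) by (simp add: cocycles_def)
  obtain v where v: "u \<in> carrier (Fob T (Rob U n))" "v \<in> carrier (Fob T (Rob V (Suc n)))"
      "Fmap T (p (Suc n)) v = w" "Fmap T (Rdiff V (Suc n)) v = Fmap T (i n) u"
    using u unfolding connects_def by blast
  have "Fmap T y w = Fmap T x u"
    using Fmap_Comp[OF p_Hom y(1) v(2)] Fmap_Comp[OF dV z(1) v(2)] Fmap_Comp[OF i_Hom z(1) v(1)]
      v(3,4) y(2) z(2) by simp
  then show "pairing (Suc n) Y w B (Ext_conn C P n k f B (cohomology_class C U n B x)) = Fmap T x u"
    using Ext_conn_value[OF B x'(1) z(1) y(1) z(2)] y(2) pairing_class[OF Hom_objs(2)[OF f] B yc w] by simp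
qed

end

section \<open>The ladder and its exact rows\<close>

theorem theorem1p4:
  fixes C :: "('o, 'm) additive_cat"
    and T :: "('o, 'm, 't) ab_functor"
    and P :: "'o \<Rightarrow> ('o, 'm) resolution"
    and K X Y :: 'o and k f :: 'm
  assumes "abelian_category C"
    and "enough_projectives C"
    and "\<And>M. M \<in> Obj C \<Longrightarrow> projective_resolution C M (P M)"
    and "k \<in> Hom C K X" and "f \<in> Hom C X Y" and "short_exact C k f"
    and "right_exact_functor C T"
  shows "long_exact
           (\<lambda>n. Nat C (Ext C P n K) T) (\<lambda>n. Nat C (Ext C P n X) T) (\<lambda>n. Nat C (Ext C P n Y) T)
           (\<lambda>n. precomp C (Ext C P n K) (Ext_conn C P n k f))
           (\<lambda>n. precomp C (Ext C P n X) (Ext_map C P n k))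
           (\<lambda>n. precomp C (Ext C P n Y) (Ext_map C P n f))
    \<and> long_exact (\<lambda>n. LDer T P n K) (\<lambda>n. LDer T P n X) (\<lambda>n. LDer T P n Y)
           (\<lambda>n. LDer_conn C T P n k f) (\<lambda>n. LDer_map C T P n k) (\<lambda>n. LDer_map C T P n f)
    \<and> (\<forall>n. Yoneda C T P n K \<in> iso (Nat C (Ext C P n K) T) (LDer T P n K))
    \<and> (\<forall>n. Yoneda C T P n X \<in> iso (Nat C (Ext C P n X) T) (LDer T P n X))
    \<and> (\<forall>n. Yoneda C T P n Y \<in> iso (Nat C (Ext C P n Y) T) (LDer T P n Y))
    \<and> (\<forall>n. \<forall>\<tau> \<in> carrier (Nat C (Ext C P (Suc n) Y) T).
           Yoneda C T P n K (precomp C (Ext C P n K) (Ext_conn C P n k f) \<tau>)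
             = LDer_conn C T P n k f (Yoneda C T P (Suc n) Y \<tau>))
    \<and> (\<forall>n. \<forall>\<tau> \<in> carrier (Nat C (Ext C P n K) T).
           Yoneda C T P n X (precomp C (Ext C P n X) (Ext_map C P n k) \<tau>)
             = LDer_map C T P n k (Yoneda C T P n K \<tau>))
    \<and> (\<forall>n. \<forall>\<tau> \<in> carrier (Nat C (Ext C P n X) T).
           Yoneda C T P n Y (precomp C (Ext C P n Y) (Ext_map C P n f) \<tau>)
             = LDer_map C T P n f (Yoneda C T P n X \<tau>))"
proof -
  obtain V i p where chosen: "chosen_covering C P k f = (V, i, p)"
    by (metis prod_cases3)
  interpret abelian_category C by fact
  interpret right_exact_functor C T by fact
  interpret ses_setting C T P k f K X Y V i p
    using assms chosen by unfold_locales
  note oK = Hom_objs(1)[OF assms(4)] and oX = Hom_objs(2)[OF assms(4)] and oY = Hom_objs(2)[OF assms(5)]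
  \<comment> \<open>One computation for a general \<open>g\<close> serves the squares of both
    \<open>k\<close> and \<open>f\<close>.\<close>
  have map: "precomp C (Ext C P n M') (Ext_map C P n g) \<tau> \<in> carrier (Nat C (Ext C P n M') T)"
    "Yoneda C T P n M' (precomp C (Ext C P n M') (Ext_map C P n g) \<tau>)
      = LDer_map C T P n g (Yoneda C T P n M \<tau>)"
    if g: "g \<in> Hom C M M'" and \<tau>: "\<tau> \<in> carrier (Nat C (Ext C P n M) T)" for g M M' n \<tau>
  proof -
    note o = Hom_objs[OF g]
    obtain w where w: "w \<in> cycles T (P M) n" "\<tau> = pairing n M w"
      using \<tau> unfolding carrier_Nat[OF o(1)] by blast
    note c = chain_map_cycles[OF resolution[OF o(1)] resolution[OF o(2)] chain_lift_over[OF g] w(1)]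
    show "precomp C (Ext C P n M') (Ext_map C P n g) \<tau> \<in> carrier (Nat C (Ext C P n M') T)"
      using precomp_Ext_map[OF g w(1)] w(2) c carrier_Nat[OF o(2)] by simp
    show "Yoneda C T P n M' (precomp C (Ext C P n M') (Ext_map C P n g) \<tau>)
        = LDer_map C T P n g (Yoneda C T P n M \<tau>)"
      using precomp_Ext_map[OF g w(1)] w(2) Yoneda_pairing[OF o(2) c] Yoneda_pairing[OF o(1) w(1)]
        LDer_map_class[OF g w(1)] by simp
  qed
  have conn: "precomp C (Ext C P n K) (Ext_conn C P n k f) \<tau> \<in> carrier (Nat C (Ext C P n K) T)"
    "Yoneda C T P n K (precomp C (Ext C P n K) (Ext_conn C P n k f) \<tau>)
      = LDer_conn C T P n k f (Yoneda C T P (Suc n) Y \<tau>)"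
    if \<tau>: "\<tau> \<in> carrier (Nat C (Ext C P (Suc n) Y) T)" for n \<tau>
  proof -
    obtain w where w: "w \<in> cycles T (P Y) (Suc n)" "\<tau> = pairing (Suc n) Y w"
      using \<tau> unfolding carrier_Nat[OF oY] by blast
    obtain u where u: "connects n w u"
      using connects_exists[OF w(1)] by blast
    note c = connects_cycles[OF u]
    show "precomp C (Ext C P n K) (Ext_conn C P n k f) \<tau> \<in> carrier (Nat C (Ext C P n K) T)"
      using precomp_Ext_conn[OF w(1) u] w(2) c carrier_Nat[OF oK] by simp
    show "Yoneda C T P n K (precomp C (Ext C P n K) (Ext_conn C P n k f) \<tau>)
        = LDer_conn C T P n k f (Yoneda C T P (Suc n) Y \<tau>)"
      using precomp_Ext_conn[OF w(1) u] w(2) Yoneda_pairing[OF oK c] Yoneda_pairing[OF oY w(1)]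
        LDer_conn_class[OF w(1) u] by simp
  qed
  \<comment> \<open>The squares come first because exactness of this row is inherited through
    them.\<close>
  have "long_exact
      (\<lambda>n. Nat C (Ext C P n K) T) (\<lambda>n. Nat C (Ext C P n X) T) (\<lambda>n. Nat C (Ext C P n Y) T)
      (\<lambda>n. precomp C (Ext C P n K) (Ext_conn C P n k f))
      (\<lambda>n. precomp C (Ext C P n X) (Ext_map C P n k))
      (\<lambda>n. precomp C (Ext C P n Y) (Ext_map C P n f))"
    by (rule long_exact_transport[OF LDer_long_exact, where YK = "\<lambda>n. Yoneda C T P n K"
          and YX = "\<lambda>n. Yoneda C T P n X" and YY = "\<lambda>n. Yoneda C T P n Y"])
      (fact Nat_comm_group[OF oK] Nat_comm_group[OF oX] Nat_comm_group[OF oY] Yoneda_iso[OF oK]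
        Yoneda_iso[OF oX] Yoneda_iso[OF oY] conn map[OF assms(4)] map[OF assms(5)])+
  then show ?thesis
    using LDer_long_exact Yoneda_iso[OF oK] Yoneda_iso[OF oX] Yoneda_iso[OF oY] conn(2)
      map(2)[OF assms(4)] map(2)[OF assms(5)] by blast
qed

end
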